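(* Let $([\varrho,\mathbf m,S],E_0)$ be a dissipative solution to the Euler system emanating from initial data with $\varrho_0=\overline\varrho$ a positive constant, $\mathbf m_0=0$, and $S_0$ a constant (and total energy $E_0$). Suppose that $([\varrho,\mathbf m,S],E_0)$ is a maximal dissipative solution. Then, for times $t>0$, $$\varrho=\overline\varrho,\qquad\mathbf m=0,\qquad S=\overline S,$$ where $\overline S\in\mathbb R$ is the constant determined by $$\int_\Omega c_v\overline\varrho^{\,\gamma}\exp\left(\frac{\overline S}{c_v\overline\varrho}\right)dx=E_0.$$
   Context: Setting. $\Omega\subset\mathbb R^N$, $N\in\{1,2,3\}$, is a bounded domain with smooth boundary and outer normal $\mathbf n$; $\gamma>1$, $c_v=\frac1{\gamma-1}$; $s_0\in\mathbb R$ and $\ell>\frac N2+1$ are fixed. $W^{-\ell,2}(\Omega)$ is the dual of $W^{\ell,2}_0(\Omega)$. The Euler system is (formally) $\partial_t\varrho+\mathrm{div}\,\mathbf m=0$, $\partial_t\mathbf m+\mathrm{div}(\mathbf m\otimes\mathbf m/\varrho)+\nabla p=0$, together with energy conservation, $\mathbf m\cdot\mathbf n|_{\partial\Omega}=0$, and the entropy inequality $\partial_tS+\mathrm{div}(S\mathbf m/\varrho)\ge0$. Put $p(\varrho,S)=\varrho^\gamma\exp\left(\frac{S}{c_v\varrho}\right)$ for $\varrho>0$, $p(0,S)=0$ if $S\le0$, $p(0,S)=\infty$ if $S>0$; expressions $\varrho^\gamma\exp(S/(c_v\varrho))$ are understood this way. $|\mathbf m|^2/\varrho$ is $0$ if $\mathbf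 m=0$ and $\infty$ if $\varrho=0,\mathbf m\neq0$; $\mathbf m\otimes\mathbf m/\varrho$ and $S\mathbf m/\varrho$ are $0$ when $\varrho=0$, $\mathbf m=0$. Measure-valued solutions. Let $\mathcal Q=\{[\tilde\varrho,\tilde{\mathbf m},\tilde S]:\tilde\varrho\ge0,\tilde{\mathbf m}\in\mathbb R^N,\tilde S\in\mathbb R\}$, $\mathcal P(\mathcal Q)$ the probability measures on $\mathcal Q$, $\mathcal M^+$ the positive bounded Radon measures, $S^{N-1}$ the unit sphere; $\langle\mathcal V;f\rangle$ is the expectation of $f(\tilde\varrho,\tilde{\mathbf m},\tilde S)$ under $\mathcal V$. A dissipative measure-valued solution with data $([\varrho_0,\mathbf m_0,S_0],E_0)$ consists of $\mathcal V\in L^\infty_{\rm weak-( * )}((0,\infty)\times\Omega;\mathcal P(\mathcal Q))$, $\mathfrak C_{\rm kin},\mathfrak C_{\rm int}\in L^\infty_{\rm weak-( * )}(0,\infty;\mathcal M^+(\overline\Omega))$ and $\mathfrak C_{\rm conv}\in L^\infty_{\rm weak-( * )}(0,\infty;\mathcal M^+(S^{N-1}\times\overline\Omega))$ with $\frac12\int_{S^{N-1}}\mathrm d\mathfrak C_{\rm conv}=\mathfrak C_{\rm kin}$, such that: (1) $\int_\Omega\big\langle\mathcal V_{t,x};\frac12\frac{|\tilde{\mathbf m}|^2}{\tilde\varrho}+c_v\tilde\varrho^\gamma\exp(\frac{\tilde S}{c_v\tilde\varrho})\big\rangle dx+\int_{\overline\Omega}(\mathrm d\mathfrak C_{\rm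 kin}(t)+\mathrm d\mathfrak C_{\rm int}(t))=E_0$ for a.a. $t\ge0$; (2) $\int_{\tau_1}^{\tau_2}\int_\Omega[\langle\mathcal V_{t,x};\tilde\varrho\rangle\partial_t\varphi+\langle\mathcal V_{t,x};\tilde{\mathbf m}\rangle\cdot\nabla\varphi]dxdt=\big[\int_\Omega\langle\mathcal V_{t,x};\tilde\varrho\rangle\varphi\,dx\big]_{t=\tau_1}^{t=\tau_2}$ for all $0\le\tau_1<\tau_2<\infty$, $\varphi\in C^1_c([0,\infty)\times\overline\Omega)$, with $\langle\mathcal V_{0,x};\tilde\varrho\rangle=\varrho_0(x)$; (3) $\int_{\tau_1}^{\tau_2}\int_\Omega[\langle\mathcal V_{t,x};\tilde{\mathbf m}\rangle\cdot\partial_t\boldsymbol\varphi+\langle\mathcal V_{t,x};\frac{\tilde{\mathbf m}\otimes\tilde{\mathbf m}}{\tilde\varrho}\rangle:\nabla\boldsymbol\varphi+\langle\mathcal V_{t,x};p(\tilde\varrho,\tilde S)\rangle\mathrm{div}\boldsymbol\varphi]dxdt+\int_{\tau_1}^{\tau_2}\int_{\overline\Omega}\int_{S^{N-1}}(\xi\otimes\xi):\nabla\boldsymbol\varphi\,\mathrm d\mathfrak C_{\rm conv}(t)dt+(\gamma-1)\int_{\tau_1}^{\tau_2}\int_{\overline\Omega}\mathrm{div}\boldsymbol\varphi\,\mathrm d\mathfrak C_{\rm int}(t)dt=\big[\int_\Omega\langle\mathcal V_{t,x};\tilde{\mathbf m}\rangle\cdot\boldsymbol\varphi\,dx\big]_{t=\tau_1}^{t=\tau_2}$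 for all $0\le\tau_1<\tau_2<\infty$, $\boldsymbol\varphi\in C^1_c([0,\infty)\times\overline\Omega;\mathbb R^N)$ with $\boldsymbol\varphi\cdot\mathbf n|_{\partial\Omega}=0$, with $\langle\mathcal V_{0,x};\tilde{\mathbf m}\rangle=\mathbf m_0(x)$; (4) $\int_{\tau_1}^{\tau_2}\int_\Omega[\langle\mathcal V_{t,x};\tilde S\rangle\partial_t\varphi+\langle\mathcal V_{t,x};\tilde S\frac{\tilde{\mathbf m}}{\tilde\varrho}\rangle\cdot\nabla\varphi]dxdt\le\big[\int_\Omega\langle\mathcal V_{t,x};\tilde S\rangle\varphi\,dx\big]_{t=\tau_1-}^{t=\tau_2+}$ for all $0\le\tau_1<\tau_2<\infty$, $\varphi\in C^1([0,\infty)\times\overline\Omega)$, $\varphi\ge0$, where values at $\tau\pm$ are one-sided limits in time and $\langle\mathcal V_{0-,x};\tilde S\rangle=S_0(x)$; (5) (standing assumption) $\mathcal V_{t,x}\{\tilde S\ge s_0\tilde\varrho\}=1$ for a.a. $(t,x)$. Dissipative solution. $([\varrho,\mathbf m,S],E_0)$ with $\varrho\in C_{\rm weak,loc}([0,\infty);L^\gamma(\Omega))$, $\mathbf m\in C_{\rm weak,loc}([0,\infty);L^{\frac{2\gamma}{\gamma+1}}(\Omega;\mathbb R^N))$, $S\in L^\infty(0,\infty;L^\gamma(\Omega))\cap BV_{\rm weak,loc}([0,\infty);W^{-\ell,2}(\Omega))$ is a dissipative solution with initial data $([\varrho_0,\mathbf m_0,S_0],E_0)\in L^\gamma(\Omega)\times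 L^{\frac{2\gamma}{\gamma+1}}(\Omega;\mathbb R^N)\times L^\gamma(\Omega)\times[0,\infty)$ if there is a dissipative measure-valued solution with these data such that $\varrho=\langle\mathcal V_{t,x};\tilde\varrho\rangle$, $\mathbf m=\langle\mathcal V_{t,x};\tilde{\mathbf m}\rangle$, $S=\langle\mathcal V_{t,x};\tilde S\rangle$. ($BV_{\rm weak,loc}$: $t\mapsto\int_\Omega S\varphi\,dx\in BV_{\rm loc}[0,\infty)$ for test functions $\varphi$; thus $S(t\pm)$ exist, with $S(0-)=S_0$.) Maximality. For a dissipative solution with initial entropy $S_0$ put $\sigma(\tau)=\int_\Omega(S(\tau)-S_0)dx$. For two dissipative solutions with the same initial data (including $E_0$), write $([\varrho^1,\mathbf m^1,S^1],E_0)\succ([\varrho^2,\mathbf m^2,S^2],E_0)$ iff $\sigma^1(\tau\pm)\ge\sigma^2(\tau\pm)$ for all $\tau\in(0,\infty)$. A dissipative solution is maximal if, whenever another dissipative solution with the same initial data, with entropy production $\tilde\sigma$, is $\succ$ it, then $\tilde\sigma=\sigma$ in $[0,\infty)$. *)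

theory Defs
  imports "HOL-Analysis.Analysis" "HOL-Probability.Probability_Measure"
begin

section \<open>Bounded domains with smooth boundary\<close>

definition partial_deriv :: "'n \<Rightarrow> (real ^ 'n \<Rightarrow> real) \<Rightarrow> real ^ 'n \<Rightarrow> real"
  where "partial_deriv i f x = frechet_derivative f (at x) (axis i 1)"

definition partial_derivs :: "'n list \<Rightarrow> (real ^ 'n \<Rightarrow> real) \<Rightarrow> real ^ 'n \<Rightarrow> real"
  where "partial_derivs is f = foldr partial_deriv is f"

definition grad :: "(real ^ 'n \<Rightarrow> real) \<Rightarrow> real ^ 'n \<Rightarrow> real ^ 'n"
  where "grad f x = (\<chi> i. partial_deriv i f x)"

text \<open>Used for open \<open>U\<close> only: differentiability of all iterated partial derivatives on an open
  set is membership in \<open>C\<close>-infinity.\<close>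

definition smooth_on :: "(real ^ 'n \<Rightarrow> real) \<Rightarrow> (real ^ 'n) set \<Rightarrow> bool"
  where "smooth_on f U \<longleftrightarrow> (\<forall>is. partial_derivs is f differentiable_on U)"

definition defining_function ::
  "(real ^ 'n) set \<Rightarrow> real ^ 'n \<Rightarrow> (real ^ 'n) set \<Rightarrow> (real ^ 'n \<Rightarrow> real) \<Rightarrow> bool"
  where "defining_function \<Omega> x U g \<longleftrightarrow>
    open U \<and> x \<in> U \<and> smooth_on g U \<and> (\<forall>y\<in>U. grad g y \<noteq> 0) \<and> \<Omega> \<inter> U = {y \<in> U. g y < 0}"

definition smooth_bounded_domain :: "(real ^ 'n) set \<Rightarrow> bool"
  where "smooth_bounded_domain \<Omega> \<longleftrightarrow>
    open \<Omega> \<and> connected \<Omega> \<and> \<Omega> \<noteq> {} \<and> bounded \<Omega> \<and>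
    (\<forall>x\<in>frontier \<Omega>. \<exists>U g. defining_function \<Omega> x U g)"

definition outer_normal :: "(real ^ 'n) set \<Rightarrow> real ^ 'n \<Rightarrow> real ^ 'n \<Rightarrow> bool"
  where "outer_normal \<Omega> x \<nu> \<longleftrightarrow>
    (\<exists>U g. defining_function \<Omega> x U g \<and> \<nu> = grad g x /\<^sub>R norm (grad g x))"


section \<open>Function spaces\<close>

definition Lp :: "real \<Rightarrow> (real ^ 'n) set \<Rightarrow> (real ^ 'n \<Rightarrow> 'b::euclidean_space) set"
  where "Lp p \<Omega> = {f \<in> borel_measurable (lebesgue_on \<Omega>).
    integrable (lebesgue_on \<Omega>) (\<lambda>x. norm (f x) powr p)}"

text \<open>Weak continuity on \<open>[0,\<infinity>)\<close> with values in \<open>L\<^sup>p\<close>, \<open>1 < p < \<infinity>\<close>; the dual space is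
  \<open>L\<close> to the conjugate exponent \<open>p / (p - 1)\<close>.\<close>

definition C_weak_loc ::
  "real \<Rightarrow> (real ^ 'n) set \<Rightarrow> (real \<Rightarrow> real ^ 'n \<Rightarrow> 'b::euclidean_space) set"
  where "C_weak_loc p \<Omega> = {u. (\<forall>t\<ge>0. u t \<in> Lp p \<Omega>) \<and>
    (\<forall>\<psi>\<in>Lp (p / (p - 1)) \<Omega>.
       continuous_on {0..} (\<lambda>t. LINT x|lebesgue_on \<Omega>. u t x \<bullet> \<psi> x))}"

text \<open>Elements of \<open>L\<^sup>\<infinity>(0,\<infinity>; L\<^sup>p)\<close> are given by a representative that is bounded at every time.
  Measurability in time is not demanded here; it is implied by the BV condition below, the only
  place where this set is used.\<close>

definition Linf_Lp :: "real \<Rightarrow> (real ^ 'n) set \<Rightarrow> (real \<Rightarrow> real ^ 'n \<Rightarrow> real) set"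
  where "Linf_Lp p \<Omega> = {u. (\<forall>t\<ge>0. u t \<in> Lp p \<Omega>) \<and>
    (\<exists>B. \<forall>t\<ge>0. (LINT x|lebesgue_on \<Omega>. \<bar>u t x\<bar> powr p) \<le> B)}"

definition test_functions :: "(real ^ 'n) set \<Rightarrow> (real ^ 'n \<Rightarrow> real) set"
  where "test_functions \<Omega> = {\<phi>. smooth_on \<phi> UNIV \<and>
    (\<exists>K. compact K \<and> K \<subseteq> \<Omega> \<and> (\<forall>x. x \<notin> K \<longrightarrow> \<phi> x = 0))}"

text \<open>Square of the \<open>W\<close>-norm of real order \<open>l \<ge> 0\<close> and exponent 2 (Sobolev-Slobodeckij if \<open>l\<close> is
  not an integer). Summing over index lists instead of multi-indices repeats each derivative a
  bounded number of times, which gives an equivalent norm.\<close>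

definition sobolev_sq :: "real \<Rightarrow> (real ^ 'n) set \<Rightarrow> (real ^ 'n \<Rightarrow> real) \<Rightarrow> ennreal"
  where "sobolev_sq l \<Omega> f =
    (\<Sum>is | length is \<le> nat \<lfloor>l\<rfloor>. \<integral>\<^sup>+x. ennreal ((partial_derivs is f x)\<^sup>2) \<partial>lebesgue_on \<Omega>) +
    (if frac l = 0 then 0 else
      (\<Sum>is | length is = nat \<lfloor>l\<rfloor>. \<integral>\<^sup>+x. \<integral>\<^sup>+y.
        ennreal ((partial_derivs is f x - partial_derivs is f y)\<^sup>2 /
                 norm (x - y) powr (real CARD('n) + 2 * frac l))
        \<partial>lebesgue_on \<Omega> \<partial>lebesgue_on \<Omega>))"

text \<open>The closure of the test functions in that norm, realised inside \<open>L\<^sup>2\<close>.\<close>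

definition W0 :: "real \<Rightarrow> (real ^ 'n) set \<Rightarrow> (real ^ 'n \<Rightarrow> real) set"
  where "W0 l \<Omega> = {f \<in> borel_measurable (lebesgue_on \<Omega>). \<exists>\<phi>. (\<forall>k. \<phi> k \<in> test_functions \<Omega>) \<and>
    (\<forall>\<epsilon>>0. \<exists>M::nat. \<forall>j\<ge>M. \<forall>k\<ge>M. sobolev_sq l \<Omega> (\<lambda>x. \<phi> j x - \<phi> k x) < ennreal \<epsilon>) \<and>
    ((\<lambda>k. \<integral>\<^sup>+x. ennreal ((\<phi> k x - f x)\<^sup>2) \<partial>lebesgue_on \<Omega>) \<longlonglongrightarrow> 0)}"

definition BV_loc :: "(real \<Rightarrow> real) \<Rightarrow> bool"
  where "BV_loc f \<longleftrightarrow> (\<forall>T\<ge>0. \<exists>B. \<forall>n::nat. \<forall>s.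
    mono_on {..n} s \<and> s ` {..n} \<subseteq> {0..T} \<longrightarrow> (\<Sum>k<n. \<bar>f (s (Suc k)) - f (s k)\<bar>) \<le> B)"

definition BV_weak_loc :: "real \<Rightarrow> (real ^ 'n) set \<Rightarrow> (real \<Rightarrow> real ^ 'n \<Rightarrow> real) set"
  where "BV_weak_loc l \<Omega> = {u. \<forall>\<phi>\<in>W0 l \<Omega>. BV_loc (\<lambda>t. LINT x|lebesgue_on \<Omega>. u t x * \<phi> x)}"

text \<open>Convergence along a filter in time, weakly in the dual of \<open>W0\<close>. With \<open>at_left t\<close> and
  \<open>at_right t\<close> this says that \<open>v\<close> is the one-sided value \<open>u(t-)\<close>, respectively \<open>u(t+)\<close>.\<close>

definition has_weak_limit ::
  "real \<Rightarrow> (real ^ 'n) set \<Rightarrow> (real \<Rightarrow> real ^ 'n \<Rightarrow> real) \<Rightarrow> (real ^ 'n \<Rightarrow> real) \<Rightarrow> real filter \<Rightarrow> bool"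
  where "has_weak_limit l \<Omega> u v F \<longleftrightarrow> (\<forall>\<phi>\<in>W0 l \<Omega>.
    ((\<lambda>t. LINT x|lebesgue_on \<Omega>. u t x * \<phi> x) \<longlongrightarrow> (LINT x|lebesgue_on \<Omega>. v x * \<phi> x)) F)"

text \<open>\<open>\<phi>\<close> is continuously differentiable on the closed set \<open>[0,\<infinity>) \<times> closure \<Omega>\<close>, with time derivative
  \<open>\<phi>t\<close> and space gradient (Jacobian matrix in the vector case) \<open>G\<close>.\<close>

definition C1_scalar :: "(real ^ 'n) set \<Rightarrow> (real \<Rightarrow> real ^ 'n \<Rightarrow> real) \<Rightarrow>
    (real \<Rightarrow> real ^ 'n \<Rightarrow> real) \<Rightarrow> (real \<Rightarrow> real ^ 'n \<Rightarrow> real ^ 'n) \<Rightarrow> bool"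
  where "C1_scalar \<Omega> \<phi> \<phi>t G \<longleftrightarrow>
    (\<forall>t\<ge>0. \<forall>x\<in>closure \<Omega>. ((\<lambda>(t, x). \<phi> t x) has_derivative (\<lambda>(s, h). s * \<phi>t t x + G t x \<bullet> h))
      (at (t, x) within {0..} \<times> closure \<Omega>)) \<and>
    continuous_on ({0..} \<times> closure \<Omega>) (\<lambda>(t, x). \<phi>t t x) \<and>
    continuous_on ({0..} \<times> closure \<Omega>) (\<lambda>(t, x). G t x)"

definition C1_vector :: "(real ^ 'n) set \<Rightarrow> (real \<Rightarrow> real ^ 'n \<Rightarrow> real ^ 'n) \<Rightarrow>
    (real \<Rightarrow> real ^ 'n \<Rightarrow> real ^ 'n) \<Rightarrow> (real \<Rightarrow> real ^ 'n \<Rightarrow> real ^ 'n ^ 'n) \<Rightarrow> bool"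
  where "C1_vector \<Omega> \<phi> \<phi>t G \<longleftrightarrow>
    (\<forall>t\<ge>0. \<forall>x\<in>closure \<Omega>. ((\<lambda>(t, x). \<phi> t x) has_derivative (\<lambda>(s, h). s *\<^sub>R \<phi>t t x + G t x *v h))
      (at (t, x) within {0..} \<times> closure \<Omega>)) \<and>
    continuous_on ({0..} \<times> closure \<Omega>) (\<lambda>(t, x). \<phi>t t x) \<and>
    continuous_on ({0..} \<times> closure \<Omega>) (\<lambda>(t, x). G t x)"

text \<open>Compact support in \<open>[0,\<infinity>) \<times> closure \<Omega>\<close>; since \<open>closure \<Omega>\<close> is compact, this only
  restricts large times.\<close>

definition compact_support :: "(real ^ 'n) set \<Rightarrow> (real \<Rightarrow> real ^ 'n \<Rightarrow> 'b::zero) \<Rightarrow> bool"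
  where "compact_support \<Omega> \<phi> \<longleftrightarrow>
    (\<exists>K. compact K \<and> K \<subseteq> {0..} \<times> closure \<Omega> \<and>
         (\<forall>t\<ge>0. \<forall>x\<in>closure \<Omega>. (t, x) \<notin> K \<longrightarrow> \<phi> t x = 0))"


section \<open>Constitutive relations\<close>

definition cv :: "real \<Rightarrow> real"
  where "cv \<gamma> = 1 / (\<gamma> - 1)"

definition pressure :: "real \<Rightarrow> real \<Rightarrow> real \<Rightarrow> ennreal"
  where "pressure \<gamma> r s =
    (if r > 0 then ennreal (r powr \<gamma> * exp (s / (cv \<gamma> * r))) else if s \<le> 0 then 0 else \<infinity>)"

definition kinetic :: "real \<Rightarrow> real ^ 'n \<Rightarrow> ennreal"
  where "kinetic r m =
    (if m = 0 then 0 else if r > 0 then ennreal ((norm m)\<^sup>2 / (2 * r)) else \<infinity>)"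

definition outer_prod :: "real ^ 'n \<Rightarrow> real ^ 'n \<Rightarrow> real ^ 'n ^ 'n"
  where "outer_prod a b = (\<chi> i j. a $ i * b $ j)"


section \<open>Dissipative measure-valued solutions\<close>

definition phase_space :: "(real \<times> (real ^ 'n) \<times> real) set"
  where "phase_space = {(r, m, s). 0 \<le> r}"

text \<open>Weakly-star measurable families of probability measures on the phase space over
  \<open>(0,\<infinity>) \<times> \<Omega>\<close>, tested with the continuous functions vanishing at infinity. Such a family is
  an equivalence class modulo null sets; we work with Borel representatives, which are
  probability measures at every \<open>(t,x)\<close>, including \<open>t = 0\<close> where the data are prescribed.\<close>

definition young_measure ::
  "(real ^ 'n) set \<Rightarrow> (real \<Rightarrow> real ^ 'n \<Rightarrow> (real \<times> (real ^ 'n) \<times> real) measure) \<Rightarrow> bool"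
  where "young_measure \<Omega> V \<longleftrightarrow>
    (\<forall>t\<ge>0. \<forall>x\<in>\<Omega>. prob_space (V t x) \<and> sets (V t x) = sets (restrict_space borel phase_space)) \<and>
    (\<forall>f :: real \<times> (real ^ 'n) \<times> real \<Rightarrow> real.
       continuous_on phase_space f \<and> (f \<longlongrightarrow> 0) (inf at_infinity (principal phase_space)) \<longrightarrow>
       (\<lambda>(t, x). integral\<^sup>L (V t x) f) \<in> borel_measurable (restrict_space borel ({0<..} \<times> \<Omega>)))"

text \<open>\<open>L\<^sup>\<infinity>\<close>-weak-star in time with values in the positive bounded Radon measures on a compact set \<open>K\<close>
  (on which every finite Borel measure is Radon), again with a Borel representative.\<close>

definition measure_family :: "'a::euclidean_space set \<Rightarrow> (real \<Rightarrow> 'a measure) \<Rightarrow> bool"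
  where "measure_family K C \<longleftrightarrow>
    (\<forall>t>0. finite_measure (C t) \<and> sets (C t) = sets (restrict_space borel K)) \<and>
    (\<forall>f :: 'a \<Rightarrow> real. continuous_on K f \<longrightarrow>
       (\<lambda>t. integral\<^sup>L (C t) f) \<in> borel_measurable (restrict_space borel {0<..})) \<and>
    (\<exists>B. AE t in lebesgue_on {0<..}. measure (C t) K \<le> B)"

definition mean_density :: "(real \<times> (real ^ 'n) \<times> real) measure \<Rightarrow> real"
  where "mean_density \<mu> = (LINT (r, m, s)|\<mu>. r)"

definition mean_momentum :: "(real \<times> (real ^ 'n) \<times> real) measure \<Rightarrow> real ^ 'n"
  where "mean_momentum \<mu> = (LINT (r, m, s)|\<mu>. m)"

definition mean_entropy :: "(real \<times> (real ^ 'n) \<times> real) measure \<Rightarrow> real"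
  where "mean_entropy \<mu> = (LINT (r, m, s)|\<mu>. s)"

definition mean_energy :: "real \<Rightarrow> (real \<times> (real ^ 'n) \<times> real) measure \<Rightarrow> ennreal"
  where "mean_energy \<gamma> \<mu> = (\<integral>\<^sup>+(r, m, s). kinetic r m + ennreal (cv \<gamma>) * pressure \<gamma> r s \<partial>\<mu>)"

text \<open>The fluxes below are real valued: \<open>\<infinity>\<close> is sent to \<open>0\<close> and so are quotients with denominator
  \<open>0\<close>. Finiteness of the energy makes the states concerned negligible, except for those where
  the numerator vanishes, for which \<open>0\<close> is the intended value. The energy identity together with
  the lower bound on the entropy also gives integrability of all quantities that are averaged.\<close>

definition mean_convection :: "(real \<times> (real ^ 'n) \<times> real) measure \<Rightarrow> real ^ 'n ^ 'n"
  where "mean_convection \<mu> = (LINT (r, m, s)|\<mu>. outer_prod m m /\<^sub>R r)"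

definition mean_pressure :: "real \<Rightarrow> (real \<times> (real ^ 'n) \<times> real) measure \<Rightarrow> real"
  where "mean_pressure \<gamma> \<mu> = (LINT (r, m, s)|\<mu>. enn2real (pressure \<gamma> r s))"

definition mean_entropy_flux :: "(real \<times> (real ^ 'n) \<times> real) measure \<Rightarrow> real ^ 'n"
  where "mean_entropy_flux \<mu> = (LINT (r, m, s)|\<mu>. (s / r) *\<^sub>R m)"

definition energy_identity where
  "energy_identity \<Omega> \<gamma> E0 V Ckin Cint \<longleftrightarrow>
    (AE t in lebesgue_on {0..}.
      (\<integral>\<^sup>+x. mean_energy \<gamma> (V t x) \<partial>lebesgue_on \<Omega>) +
      emeasure (Ckin t) (closure \<Omega>) + emeasure (Cint t) (closure \<Omega>) = ennreal E0)"

definition continuity_equation where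
  "continuity_equation \<Omega> \<rho>0 V \<longleftrightarrow>
    (AE x in lebesgue_on \<Omega>. mean_density (V 0 x) = \<rho>0 x) \<and>
    (\<forall>\<tau>1 \<tau>2 \<phi> \<phi>t G. 0 \<le> \<tau>1 \<and> \<tau>1 < \<tau>2 \<and> C1_scalar \<Omega> \<phi> \<phi>t G \<and> compact_support \<Omega> \<phi> \<longrightarrow>
      (LINT t|lebesgue_on {\<tau>1..\<tau>2}. LINT x|lebesgue_on \<Omega>.
         mean_density (V t x) * \<phi>t t x + mean_momentum (V t x) \<bullet> G t x) =
      (LINT x|lebesgue_on \<Omega>. mean_density (V \<tau>2 x) * \<phi> \<tau>2 x) -
      (LINT x|lebesgue_on \<Omega>. mean_density (V \<tau>1 x) * \<phi> \<tau>1 x))"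

text \<open>On matrices, \<open>\<bullet>\<close> is the Frobenius product and \<open>trace\<close> of the Jacobian is the divergence.\<close>

definition momentum_equation where
  "momentum_equation \<Omega> \<gamma> m0 V Cint Cconv \<longleftrightarrow>
    (AE x in lebesgue_on \<Omega>. mean_momentum (V 0 x) = m0 x) \<and>
    (\<forall>\<tau>1 \<tau>2 \<phi> \<phi>t G. 0 \<le> \<tau>1 \<and> \<tau>1 < \<tau>2 \<and> C1_vector \<Omega> \<phi> \<phi>t G \<and> compact_support \<Omega> \<phi> \<and>
      (\<forall>t\<ge>0. \<forall>x\<in>frontier \<Omega>. \<forall>\<nu>. outer_normal \<Omega> x \<nu> \<longrightarrow> \<phi> t x \<bullet> \<nu> = 0) \<longrightarrow>
      (LINT t|lebesgue_on {\<tau>1..\<tau>2}. LINT x|lebesgue_on \<Omega>.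
         mean_momentum (V t x) \<bullet> \<phi>t t x + mean_convection (V t x) \<bullet> G t x +
         mean_pressure \<gamma> (V t x) * trace (G t x)) +
      (LINT t|lebesgue_on {\<tau>1..\<tau>2}. LINT (\<xi>, x)|Cconv t. outer_prod \<xi> \<xi> \<bullet> G t x) +
      (\<gamma> - 1) * (LINT t|lebesgue_on {\<tau>1..\<tau>2}. LINT x|Cint t. trace (G t x)) =
      (LINT x|lebesgue_on \<Omega>. mean_momentum (V \<tau>2 x) \<bullet> \<phi> \<tau>2 x) -
      (LINT x|lebesgue_on \<Omega>. mean_momentum (V \<tau>1 x) \<bullet> \<phi> \<tau>1 x))"

text \<open>\<open>a\<close> and \<open>b\<close> are the values of the pairing of entropy and test function at \<open>\<tau>1-\<close> and \<open>\<tau>2+\<close>;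
  at \<open>0-\<close> the initial entropy is used.\<close>

definition entropy_inequality where
  "entropy_inequality \<Omega> S0 V \<longleftrightarrow>
    (\<forall>\<tau>1 \<tau>2 \<phi> \<phi>t G. 0 \<le> \<tau>1 \<and> \<tau>1 < \<tau>2 \<and> C1_scalar \<Omega> \<phi> \<phi>t G \<and>
      (\<forall>t\<ge>0. \<forall>x\<in>closure \<Omega>. 0 \<le> \<phi> t x) \<longrightarrow>
      (\<exists>a b. (if \<tau>1 = 0 then a = (LINT x|lebesgue_on \<Omega>. S0 x * \<phi> 0 x)
              else ((\<lambda>t. LINT x|lebesgue_on \<Omega>. mean_entropy (V t x) * \<phi> t x) \<longlongrightarrow> a) (at_left \<tau>1)) \<and>
             ((\<lambda>t. LINT x|lebesgue_on \<Omega>. mean_entropy (V t x) * \<phi> t x) \<longlongrightarrow> b) (at_right \<tau>2) \<and>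
             (LINT t|lebesgue_on {\<tau>1..\<tau>2}. LINT x|lebesgue_on \<Omega>.
                mean_entropy (V t x) * \<phi>t t x + mean_entropy_flux (V t x) \<bullet> G t x) \<le> b - a))"

definition dissipative_mv_solution ::
  "(real ^ 'n) set \<Rightarrow> real \<Rightarrow> real \<Rightarrow>
   (real ^ 'n \<Rightarrow> real) \<Rightarrow> (real ^ 'n \<Rightarrow> real ^ 'n) \<Rightarrow> (real ^ 'n \<Rightarrow> real) \<Rightarrow> real \<Rightarrow>
   (real \<Rightarrow> real ^ 'n \<Rightarrow> (real \<times> (real ^ 'n) \<times> real) measure) \<Rightarrow>
   (real \<Rightarrow> (real ^ 'n) measure) \<Rightarrow> (real \<Rightarrow> (real ^ 'n) measure) \<Rightarrow>
   (real \<Rightarrow> ((real ^ 'n) \<times> (real ^ 'n)) measure) \<Rightarrow> bool"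
  where "dissipative_mv_solution \<Omega> \<gamma> s0 \<rho>0 m0 S0 E0 V Ckin Cint Cconv \<longleftrightarrow>
    young_measure \<Omega> V \<and>
    measure_family (closure \<Omega>) Ckin \<and> measure_family (closure \<Omega>) Cint \<and>
    measure_family (sphere 0 1 \<times> closure \<Omega>) Cconv \<and>
    (AE t in lebesgue_on {0<..}. \<forall>A\<in>sets (restrict_space borel (closure \<Omega>)).
       emeasure (Cconv t) (sphere 0 1 \<times> A) / 2 = emeasure (Ckin t) A) \<and>
    energy_identity \<Omega> \<gamma> E0 V Ckin Cint \<and>
    continuity_equation \<Omega> \<rho>0 V \<and>
    momentum_equation \<Omega> \<gamma> m0 V Cint Cconv \<and>
    entropy_inequality \<Omega> S0 V \<and>
    (AE (t, x) in lebesgue_on ({0<..} \<times> \<Omega>). AE (r, m, s) in V t x. s0 * r \<le> s)"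


section \<open>Dissipative solutions and maximality\<close>

definition dissipative_solution ::
  "(real ^ 'n) set \<Rightarrow> real \<Rightarrow> real \<Rightarrow> real \<Rightarrow>
   (real ^ 'n \<Rightarrow> real) \<Rightarrow> (real ^ 'n \<Rightarrow> real ^ 'n) \<Rightarrow> (real ^ 'n \<Rightarrow> real) \<Rightarrow> real \<Rightarrow>
   (real \<Rightarrow> real ^ 'n \<Rightarrow> real) \<Rightarrow> (real \<Rightarrow> real ^ 'n \<Rightarrow> real ^ 'n) \<Rightarrow> (real \<Rightarrow> real ^ 'n \<Rightarrow> real) \<Rightarrow> bool"
  where "dissipative_solution \<Omega> \<gamma> s0 l \<rho>0 m0 S0 E0 \<rho> m S \<longleftrightarrow>
    \<rho>0 \<in> Lp \<gamma> \<Omega> \<and> m0 \<in> Lp (2 * \<gamma> / (\<gamma> + 1)) \<Omega> \<and> S0 \<in> Lp \<gamma> \<Omega> \<and> 0 \<le> E0 \<and>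
    \<rho> \<in> C_weak_loc \<gamma> \<Omega> \<and> m \<in> C_weak_loc (2 * \<gamma> / (\<gamma> + 1)) \<Omega> \<and>
    S \<in> Linf_Lp \<gamma> \<Omega> \<inter> BV_weak_loc l \<Omega> \<and>
    (\<exists>V Ckin Cint Cconv.
       dissipative_mv_solution \<Omega> \<gamma> s0 \<rho>0 m0 S0 E0 V Ckin Cint Cconv \<and>
       (\<forall>t\<ge>0. AE x in lebesgue_on \<Omega>.
          \<rho> t x = mean_density (V t x) \<and> m t x = mean_momentum (V t x) \<and>
          S t x = mean_entropy (V t x)))"

definition entropy_production ::
  "(real ^ 'n) set \<Rightarrow> (real ^ 'n \<Rightarrow> real) \<Rightarrow> (real \<Rightarrow> real ^ 'n \<Rightarrow> real) \<Rightarrow> real \<Rightarrow> real"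
  where "entropy_production \<Omega> S0 S \<tau> = (LINT x|lebesgue_on \<Omega>. S \<tau> x - S0 x)"

text \<open>The relation on two solutions with the same data, in terms of their entropies \<open>S1\<close>, \<open>S2\<close>.
  The one-sided limits exist, because \<open>S1\<close> and \<open>S2\<close> are bounded in \<open>L\<^sup>\<gamma>\<close> and weakly of bounded
  variation.\<close>

definition more_dissipative ::
  "(real ^ 'n) set \<Rightarrow> (real ^ 'n \<Rightarrow> real) \<Rightarrow>
   (real \<Rightarrow> real ^ 'n \<Rightarrow> real) \<Rightarrow> (real \<Rightarrow> real ^ 'n \<Rightarrow> real) \<Rightarrow> bool"
  where "more_dissipative \<Omega> S0 S1 S2 \<longleftrightarrow> (\<forall>\<tau>>0.
    Lim (at_left \<tau>) (entropy_production \<Omega> S0 S1) \<ge> Lim (at_left \<tau>) (entropy_production \<Omega> S0 S2) \<and>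
    Lim (at_right \<tau>) (entropy_production \<Omega> S0 S1) \<ge> Lim (at_right \<tau>) (entropy_production \<Omega> S0 S2))"

text \<open>Equality on \<open>[0,\<infinity>)\<close> of entropy productions as functions of bounded variation, that is, of all
  one-sided limits (at \<open>0-\<close> the value is \<open>0\<close> by convention). Equality of values at every single
  time would make no sense: they depend on the representative of the entropy at its jumps.\<close>

definition same_production ::
  "(real ^ 'n) set \<Rightarrow> (real ^ 'n \<Rightarrow> real) \<Rightarrow>
   (real \<Rightarrow> real ^ 'n \<Rightarrow> real) \<Rightarrow> (real \<Rightarrow> real ^ 'n \<Rightarrow> real) \<Rightarrow> bool"
  where "same_production \<Omega> S0 S1 S2 \<longleftrightarrow>
    (\<forall>\<tau>>0. Lim (at_left \<tau>) (entropy_production \<Omega> S0 S1) = Lim (at_left \<tau>) (entropy_production \<Omega> S0 S2)) \<and>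
    (\<forall>\<tau>\<ge>0. Lim (at_right \<tau>) (entropy_production \<Omega> S0 S1) = Lim (at_right \<tau>) (entropy_production \<Omega> S0 S2))"

definition maximal_dissipative_solution ::
  "(real ^ 'n) set \<Rightarrow> real \<Rightarrow> real \<Rightarrow> real \<Rightarrow>
   (real ^ 'n \<Rightarrow> real) \<Rightarrow> (real ^ 'n \<Rightarrow> real ^ 'n) \<Rightarrow> (real ^ 'n \<Rightarrow> real) \<Rightarrow> real \<Rightarrow>
   (real \<Rightarrow> real ^ 'n \<Rightarrow> real) \<Rightarrow> (real \<Rightarrow> real ^ 'n \<Rightarrow> real ^ 'n) \<Rightarrow> (real \<Rightarrow> real ^ 'n \<Rightarrow> real) \<Rightarrow> bool"
  where "maximal_dissipative_solution \<Omega> \<gamma> s0 l \<rho>0 m0 S0 E0 \<rho> m S \<longleftrightarrow>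
    dissipative_solution \<Omega> \<gamma> s0 l \<rho>0 m0 S0 E0 \<rho> m S \<and>
    (\<forall>\<rho>' m' S'. dissipative_solution \<Omega> \<gamma> s0 l \<rho>0 m0 S0 E0 \<rho>' m' S' \<and>
       more_dissipative \<Omega> S0 S' S \<longrightarrow> same_production \<Omega> S0 S' S)"

end

theory Submission
  imports Defs "HOL-Probability.Giry_Monad"
begin

text \<open>
  Test functions of time alone show that the mass is conserved and that the total entropy has
  one-sided limits at every time, which are not below its initial value. The energy is strictly
  convex in the conserved variables away from vacuum, so Jensen's inequality, applied first to the
  Young measure and then on \<open>\<Omega>\<close>, bounds the total entropy at almost every time by that of the constant
  state with density \<open>\<rho>bar\<close> and energy \<open>E0\<close>, with equality only for this state. The constant state is
  itself a dissipative solution: its momentum balance says that the divergence of a field tangent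
  to the boundary has integral zero. It thus dominates the given solution, and maximality forces the
  equality case at almost every time. Weak continuity and bounded variation extend this to all times.
\<close>

section \<open>The divergence theorem for tangent fields\<close>

text \<open>The given solution itself makes the comparison state admissible. Its entropy inequality
  yields \<open>Sinit \<le> Sbar\<close>, so that the jump of the comparison entropy at time 0 has
  the right sign; its lower entropy bound yields \<open>s0 * \<rho>bar \<le> Sbar\<close>; and its
  energy yields \<open>E0 > 0\<close>, without which \<open>Sbar\<close> would not exist. Convexity
  enters only through supporting hyperplanes. Integrated, the terms of first order cancel, and
  equality of the integrals becomes a pointwise equality. Vacuum is the delicate point: states of
  finite energy there have \<open>m = 0\<close> and \<open>s \<le> 0\<close>, which puts them
  strictly above the hyperplane. The boundary is known only through local defining functions, so the
  divergence theorem is proved without a surface measure: for a tangent field there is no flux to be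
  defined, and it suffices that cutting off a thin boundary layer costs nothing in the limit. Values
  of the entropy at single times carry no information. Therefore every argument about it passes
  through one-sided limits or almost every time.\<close>

lemma lborel_integral_translate:
  fixes f :: "'a::euclidean_space \<Rightarrow> real"
  assumes "f \<in> borel_measurable borel"
  shows "(LINT x|lborel. f (x + a)) = (LINT x|lborel. f x)"
proof -
  have "(LINT x|lborel. f x) = (LINT x|distr lborel borel ((+) a). f x)"
    by (simp add: lborel_distr_plus)
  also have "\<dots> = (LINT x|lborel. f (a + x))"
    using assms by (subst integral_distr) auto
  finally show ?thesis by (simp add: add.commute)
qed

lemma integrable_continuous_compact_support:
  fixes f :: "'a::euclidean_space \<Rightarrow> real"
  assumes "continuous_on UNIV f" "compact K" "\<And>x. x \<notin> K \<Longrightarrow> f x = 0"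
  shows "integrable lborel f"
proof -
  have "integrable lborel (\<lambda>x. indicator K x *\<^sub>R f x)"
    using borel_integrable_compact[OF assms(2) continuous_on_subset[OF assms(1)]]
    by simp
  moreover have "(\<lambda>x. indicator K x *\<^sub>R f x) = f"
    using assms(3) by (auto simp: indicator_def fun_eq_iff)
  ultimately show ?thesis by simp
qed

text \<open>The forward difference quotients of \<open>u\<close> along \<open>e\<close> have
  integral zero by translation invariance. They converge to \<open>d\<close>, and the mean value
  theorem bounds them by a bound of \<open>d\<close>, so dominated convergence applies.\<close>

lemma integral_directional_derivative_zero:
  fixes u d :: "'a::euclidean_space \<Rightarrow> real"
  assumes der: "\<And>x. ((\<lambda>s. u (x + s *\<^sub>R e)) has_real_derivative d x) (at 0)"
    and cu: "continuous_on UNIV u" and cd: "continuous_on UNIV d" and K: "compact K"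
    and uK: "\<And>x. x \<notin> K \<Longrightarrow> u x = 0" and dK: "\<And>x. x \<notin> K \<Longrightarrow> d x = 0"
  shows "(LINT x|lborel. d x) = 0"
proof -
  have iu: "integrable lborel u"
    by (rule integrable_continuous_compact_support[OF cu K uK])
  have mu: "u \<in> borel_measurable borel"
    using cu by (rule borel_measurable_continuous_onI)
  have md: "d \<in> borel_measurable borel"
    using cd by (rule borel_measurable_continuous_onI)
  obtain M where M: "\<And>x. \<bar>d x\<bar> \<le> M" "M \<ge> 0"
  proof -
    have "bounded (d ` K)"
      using compact_continuous_image[OF continuous_on_subset[OF cd] K] compact_imp_bounded by blast
    then obtain B where "\<And>x. x \<in> K \<Longrightarrow> \<bar>d x\<bar> \<le> B"
      by (auto simp: bounded_iff)
    then have "\<bar>d x\<bar> \<le> max B 0" for x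
      using dK[of x] by (cases "x \<in> K") (auto simp: le_max_iff_disj)
    then show ?thesis using that[of "max B 0"] by auto
  qed
  have der': "((\<lambda>s. u (x + s *\<^sub>R e)) has_real_derivative d (x + s *\<^sub>R e)) (at s)" for x s
  proof -
    have "((\<lambda>r. u ((x + s *\<^sub>R e) + r *\<^sub>R e)) has_real_derivative d (x + s *\<^sub>R e)) (at 0)"
      by (rule der)
    then have "((\<lambda>r. u (x + (r + s) *\<^sub>R e)) has_real_derivative d (x + s *\<^sub>R e)) (at 0)"
      by (simp add: algebra_simps)
    then show ?thesis
      using DERIV_at_within_shift[of "\<lambda>s. u (x + s *\<^sub>R e)" "d (x + s *\<^sub>R e)" s 0 UNIV]
      by (simp add: add.commute)
  qed
  let ?h = "\<lambda>n::nat. 1 / (real n + 1)"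
  let ?q = "\<lambda>n x. (u (x + ?h n *\<^sub>R e) - u x) / ?h n"
  have mvt: "\<bar>u (x + h *\<^sub>R e) - u x\<bar> \<le> M * h" if hp: "h > 0" for x h
  proof -
    have "\<exists>z>0. z < h \<and> u (x + h *\<^sub>R e) - u (x + 0 *\<^sub>R e) = (h - 0) * d (x + z *\<^sub>R e)"
      by (rule MVT2[OF hp]) (rule der')
    then obtain z where "u (x + h *\<^sub>R e) - u x = h * d (x + z *\<^sub>R e)"
      by auto
    then show ?thesis using M(1)[of "x + z *\<^sub>R e"] hp
      by (simp add: abs_mult mult.commute)
  qed
  \<comment> \<open>The increments \<open>?h n\<close> are at most 1, so one enlargement of
    \<open>K\<close> by \<open>norm e\<close> contains the supports of all difference
    quotients.\<close>
  let ?K = "{x + y | x y. x \<in> K \<and> y \<in> cball 0 (norm e)}"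
  have K': "compact ?K"
    by (intro compact_sums K compact_cball)
  have supp: "?q n x = 0" if "x \<notin> ?K" for n x
  proof -
    have "x \<notin> K" using that by (auto dest: spec[of _ x] spec[of _ 0])
    moreover have "x + ?h n *\<^sub>R e \<notin> K"
    proof
      assume a: "x + ?h n *\<^sub>R e \<in> K"
      have "- (?h n *\<^sub>R e) \<in> cball 0 (norm e)"
        by (simp add: divide_simps) (simp add: algebra_simps)
      then have "x \<in> ?K"
        using a by (intro CollectI exI[of _ "x + ?h n *\<^sub>R e"] exI[of _ "- (?h n *\<^sub>R e)"]) auto
      then show False using that by simp
    qed
    ultimately show ?thesis using uK by simp
  qed
  have "(\<lambda>n. LINT x|lborel. ?q n x) \<longlonglongrightarrow> (LINT x|lborel. d x)"
  proof (rule integral_dominated_convergence[where w="\<lambda>x. M * indicator ?K x"])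
    show "integrable lborel (\<lambda>x. M * indicator ?K x)"
      using emeasure_compact_finite[OF K'] compact_imp_closed[OF K']
      by (intro integrable_mult_right integrable_real_indicator) auto
    show "AE x in lborel. (\<lambda>n. ?q n x) \<longlonglongrightarrow> d x"
    proof (rule AE_I2)
      fix x
      have "((\<lambda>s. (u (x + s *\<^sub>R e) - u x) / s) \<longlongrightarrow> d x) (at 0)"
        using der[of x] by (simp add: has_field_derivative_iff)
      moreover have "filterlim ?h (at 0) sequentially"
        using lim_1_over_n LIMSEQ_Suc[OF lim_1_over_n] by (intro filterlim_atI) (auto simp: add.commute)
      ultimately show "(\<lambda>n. ?q n x) \<longlonglongrightarrow> d x"
        by (rule filterlim_compose)
    qed
    show "AE x in lborel. norm (?q n x) \<le> M * indicator ?K x" for n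
    proof (rule AE_I2)
      fix x
      show "norm (?q n x) \<le> M * indicator ?K x"
      proof (cases "x \<in> ?K")
        case True
        have "\<bar>u (x + ?h n *\<^sub>R e) - u x\<bar> \<le> M * ?h n" by (rule mvt) simp
        then have "\<bar>?q n x\<bar> \<le> M" by (simp add: abs_mult divide_simps)
        then show ?thesis using True by simp
      next
        case False then show ?thesis using supp[OF False, of n] M(2) by simp
      qed
    qed
  qed (use mu md in measurable)
  moreover have "(LINT x|lborel. ?q n x) = 0" for n
  proof -
    have i2: "integrable lborel (\<lambda>x. u (x + ?h n *\<^sub>R e))"
    proof -
      have "integrable (distr lborel borel ((+) (?h n *\<^sub>R e))) u"
        using iu by (simp add: lborel_distr_plus)
      then show ?thesis using mu by (subst (asm) integrable_distr_eq) (auto simp: add.commute)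
    qed
    have "(LINT x|lborel. u (x + ?h n *\<^sub>R e) - u x) = 0"
      using iu i2 lborel_integral_translate[OF mu] by simp
    then show ?thesis by simp
  qed
  ultimately have "(\<lambda>n::nat. 0) \<longlonglongrightarrow> (LINT x|lborel. d x)"
    by (simp only:)
  then show ?thesis
    by (simp only: LIMSEQ_const_iff)
qed

text \<open>Here \<open>g\<close> is the extension of \<open>f\<close> by zero. The model integrates
  over \<open>lebesgue_on\<close>, while translation and Fubini are used for \<open>lborel\<close>;
  this is the passage between them.\<close>

lemma integral_lebesgue_on_eq_lborel:
  fixes f g :: "'a::euclidean_space \<Rightarrow> real"
  assumes "S \<in> sets borel" and "g \<in> borel_measurable borel"
    and "\<And>x. x \<in> S \<Longrightarrow> g x = f x" and "\<And>x. x \<notin> S \<Longrightarrow> g x = 0"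
  shows "(LINT x|lebesgue_on S. f x) = (LINT x|lborel. g x)"
proof -
  have "(LINT x|lebesgue_on S. f x) = (LINT x|lebesgue. indicator S x *\<^sub>R f x)"
    using assms(1) by (subst integral_restrict_space) auto
  also have "(\<lambda>x. indicator S x *\<^sub>R f x) = g"
    using assms(3,4) by (auto simp: indicator_def fun_eq_iff)
  also have "(LINT x|lebesgue. g x) = (LINT x|lborel. g x)"
    using assms(2) by (subst integral_completion) auto
  finally show ?thesis .
qed

text \<open>Extended by zero, the field is continuously differentiable everywhere, because the open
  sets \<open>U\<close> and \<open>- K\<close> cover the space. Each diagonal entry of the Jacobian
  is then the derivative of one component along its own axis, and its integral vanishes.\<close>

lemma integral_trace_compact_support:
  fixes w :: "real ^ 'n \<Rightarrow> real ^ 'n" and D :: "real ^ 'n \<Rightarrow> real ^ 'n ^ 'n"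
  assumes U: "open U" and K: "compact K" "K \<subseteq> U"
    and der: "\<And>x. x \<in> U \<Longrightarrow> (w has_derivative (\<lambda>h. D x *v h)) (at x)"
    and cont: "continuous_on U D"
    and zero: "\<And>x. x \<in> U - K \<Longrightarrow> w x = 0" "\<And>x. x \<in> U - K \<Longrightarrow> D x = 0"
  shows "(LINT x|lebesgue_on U. trace (D x)) = 0"
proof -
  define w' where "w' x = (if x \<in> U then w x else 0)" for x
  define D' where "D' x = (if x \<in> U then D x else 0)" for x
  have oK: "open (- K)" using K(1) by (simp add: compact_imp_closed open_Compl)
  have cov: "U \<union> - K = UNIV" using K(2) by auto
  have w'0: "w' x = 0" "D' x = 0" if "x \<notin> K" for x
    using that zero by (auto simp: w'_def D'_def)
  have der': "(w' has_derivative (\<lambda>h. D' x *v h)) (at x)" for x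
  proof (cases "x \<in> U")
    case True
    then show ?thesis
      using has_derivative_transform_within_open[OF der[OF True] U True, of w']
      by (simp add: w'_def D'_def)
  next
    case False
    then have "x \<in> - K" using K(2) by auto
    moreover have "((\<lambda>x. 0) has_derivative (\<lambda>h. D' x *v h)) (at x)"
      using False by (simp add: D'_def)
    ultimately show ?thesis
      using has_derivative_transform_within_open[OF _ oK, of "\<lambda>x. 0" _ x UNIV w'] w'0 by auto
  qed
  have "continuous_on (U \<union> - K) D'"
  proof (rule continuous_on_open_Un[OF U oK])
    show "continuous_on U D'"
      using cont by (rule continuous_on_eq) (simp add: D'_def)
    have "continuous_on (- K) (\<lambda>x. 0 :: real ^ 'n ^ 'n)" by simp
    then show "continuous_on (- K) D'"
      by (rule continuous_on_eq) (simp add: w'0)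
  qed
  then have cD: "continuous_on UNIV D'" using cov by simp
  have cw: "continuous_on UNIV w'"
    using der' by (meson has_derivative_continuous continuous_at_imp_continuous_on)
  have i0: "(LINT x|lborel. D' x $ i $ i) = 0" for i
  proof (rule integral_directional_derivative_zero[where u="\<lambda>x. w' x $ i" and e="axis i 1" and K=K])
    fix x
    have "((\<lambda>s. w' (x + s *\<^sub>R axis i 1)) has_derivative (\<lambda>s. D' (x + 0 *\<^sub>R axis i 1) *v (s *\<^sub>R axis i 1))) (at 0)"
      by (rule has_derivative_compose[where g=w', OF _ der']) (auto intro!: derivative_eq_intros)
    then have "((\<lambda>s. w' (x + s *\<^sub>R axis i 1) $ i) has_derivative (\<lambda>s. (D' x *v (s *\<^sub>R axis i 1)) $ i)) (at 0)"
      by (auto intro!: bounded_linear.has_derivative[OF bounded_linear_vec_nth])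
    moreover have "(D' x *v (s *\<^sub>R axis i 1)) $ i = D' x $ i $ i * s" for s
      by (simp add: matrix_vector_mult_scaleR matrix_vector_mul_component inner_axis)
    ultimately show "((\<lambda>s. w' (x + s *\<^sub>R axis i 1) $ i) has_real_derivative D' x $ i $ i) (at 0)"
      by (simp add: has_field_derivative_def)
  qed (use cw cD K w'0 in \<open>auto intro!: continuous_intros\<close>)
  have tr: "continuous_on UNIV (\<lambda>x. trace (D' x))"
    unfolding trace_def by (intro continuous_intros cD)
  have "(LINT x|lebesgue_on U. trace (D x)) = (LINT x|lborel. trace (D' x))"
    using U tr by (intro integral_lebesgue_on_eq_lborel)
      (auto simp: D'_def trace_def intro: borel_measurable_continuous_onI)
  also have "\<dots> = (\<Sum>i\<in>UNIV. LINT x|lborel. D' x $ i $ i)"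
    unfolding trace_def
    by (intro Bochner_Integration.integral_sum integrable_continuous_compact_support[OF _ K(1)])
      (auto simp: w'0 intro!: continuous_intros cD)
  finally show ?thesis using i0 by simp
qed

section \<open>Thin layers and cutoffs at the boundary\<close>

text \<open>The translates of \<open>A\<close> by multiples of \<open>(2 * \<epsilon> / c) *\<^sub>R e\<close> are disjoint and about \<open>c / (2 * \<epsilon>)\<close> of
  them fit into a fixed ball, so no integration along the direction \<open>e\<close> is needed.\<close>

lemma measure_layer_le:
  fixes g :: "'a::euclidean_space \<Rightarrow> real"
  assumes meas: "A \<in> lmeasurable" and A: "A \<subseteq> ball x0 r" and "c > 0" "\<epsilon> > 0"
    and len: "\<And>x t. x \<in> A \<Longrightarrow> t > 0 \<Longrightarrow> x + t *\<^sub>R e \<in> A \<Longrightarrow> c * t \<le> \<epsilon>"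
  shows "measure lebesgue A \<le> 2 * \<epsilon> / c * measure lebesgue (ball x0 (r + norm e))"
proof -
  \<comment> \<open>The factor 2 gives \<open>c * \<delta> = 2 * \<epsilon>\<close>, which strictly
    violates the bound in \<open>len\<close>; hence two different translates cannot meet.\<close>
  define \<delta> where "\<delta> = 2 * \<epsilon> / c"
  have \<delta>: "\<delta> > 0" using assms by (simp add: \<delta>_def)
  \<comment> \<open>Counting from 0, the last shift is \<open>(n - 1) * \<delta> \<le> 1\<close>, so
    all translates stay within distance \<open>norm e\<close> of \<open>A\<close>, and still there
    are at least \<open>1 / \<delta>\<close> of them.\<close>
  define n where "n = nat \<lfloor>1 / \<delta>\<rfloor> + 1"
  have n1: "real n \<ge> 1 / \<delta>" and n2: "(real n - 1) * \<delta> \<le> 1"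
  proof -
    have fl: "0 \<le> \<lfloor>1 / \<delta>\<rfloor>" using \<delta> by simp
    then have "real n = real_of_int \<lfloor>1 / \<delta>\<rfloor> + 1" by (simp add: n_def)
    then show "real n \<ge> 1 / \<delta>" by linarith
    have "real_of_int \<lfloor>1 / \<delta>\<rfloor> * \<delta> \<le> 1 / \<delta> * \<delta>"
      using \<delta> by (intro mult_right_mono) auto
    then show "(real n - 1) * \<delta> \<le> 1"
      using \<delta> \<open>real n = _\<close> by simp
  qed
  define T where "T k = (+) ((real k * \<delta>) *\<^sub>R e) ` A" for k :: nat
  have T_meas: "T k \<in> lmeasurable" "measure lebesgue (T k) = measure lebesgue A" for k
    using meas measurable_translation[of A] measure_translation[of _ A] by (auto simp: T_def)
  have disj: "disjoint_family_on T {..<n}"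
  proof -
    have False if jk: "j < k" "z \<in> T j" "z \<in> T k" for j k z
    proof -
      obtain x where x: "x \<in> A" "z = (real j * \<delta>) *\<^sub>R e + x"
        using jk(2) by (auto simp: T_def)
      obtain y where y: "y \<in> A" "z = (real k * \<delta>) *\<^sub>R e + y"
        using jk(3) by (auto simp: T_def)
      note xy = x(1) y(1) x(2) y(2)
      have "x = y + ((real k - real j) * \<delta>) *\<^sub>R e"
        using xy(3,4) by (simp add: algebra_simps)
      moreover have "(real k - real j) * \<delta> > 0" using that \<delta> by simp
      ultimately have "c * ((real k - real j) * \<delta>) \<le> \<epsilon>" using len[of y] xy by auto
      moreover have "real k - real j \<ge> 1" using that by linarith
      then have "c * (1 * \<delta>) \<le> c * ((real k - real j) * \<delta>)"
        using assms(3) \<delta> by (intro mult_left_mono mult_right_mono) auto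
      moreover have "c * \<delta> = 2 * \<epsilon>" using assms(3) by (simp add: \<delta>_def)
      ultimately show False using assms(4) by simp
    qed
    then show ?thesis
      by (auto simp: disjoint_family_on_def) (metis linorder_neqE_nat)
  qed
  have sub: "(\<Union>k<n. T k) \<subseteq> ball x0 (r + norm e)"
  proof
    fix z assume "z \<in> (\<Union>k<n. T k)"
    then obtain k x where kx: "k < n" "x \<in> A" "z = (real k * \<delta>) *\<^sub>R e + x"
      by (auto simp: T_def)
    have "real k * \<delta> \<le> (real n - 1) * \<delta>" using kx(1) \<delta> by (intro mult_right_mono) auto
    then have "real k * \<delta> \<le> 1" using n2 by linarith
    then have "norm ((real k * \<delta>) *\<^sub>R e) \<le> norm e"
      using \<delta> mult_right_mono[of "real k * \<delta>" 1 "norm e"] by simp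
    moreover have "dist x0 x < r" using kx A by auto
    moreover have "dist x0 z \<le> dist x0 x + norm ((real k * \<delta>) *\<^sub>R e)"
    proof -
      have "dist x z = norm ((real k * \<delta>) *\<^sub>R e)"
        unfolding kx(3) dist_norm by (metis add_diff_cancel_left' add.commute norm_minus_commute)
      then show ?thesis using dist_triangle[of x0 z x] by simp
    qed
    ultimately show "z \<in> ball x0 (r + norm e)" by simp
  qed
  have "real n * measure lebesgue A = (\<Sum>k<n. measure lebesgue (T k))"
    by (simp add: T_meas)
  also have "\<dots> = measure lebesgue (\<Union>k<n. T k)"
  proof (rule measure_finite_Union[symmetric])
    show "emeasure lebesgue (T k) \<noteq> \<infinity>" for k
      using T_meas(1)[of k] by (metis fmeasurableD2 infinity_ennreal_def)
  qed (use T_meas disj in auto)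
  also have "\<dots> \<le> measure lebesgue (ball x0 (r + norm e))"
    using sub T_meas by (intro measure_mono_fmeasurable) (auto intro: fmeasurableD)
  finally have *: "real n * measure lebesgue A \<le> measure lebesgue (ball x0 (r + norm e))" .
  have "1 / \<delta> * measure lebesgue A \<le> real n * measure lebesgue A"
    using n1 by (intro mult_right_mono) auto
  then have "1 / \<delta> * measure lebesgue A \<le> measure lebesgue (ball x0 (r + norm e))"
    using * by simp
  then have "measure lebesgue A \<le> \<delta> * measure lebesgue (ball x0 (r + norm e))"
    using \<delta> by (simp add: field_simps)
  then show ?thesis by (simp add: \<delta>_def)
qed

text \<open>Half the second difference of the squared positive part, hence continuously differentiable.\<close>

definition ramp :: "real \<Rightarrow> real"
  where "ramp s = ((max 0 s)\<^sup>2 - 2 * (max 0 (s - 1))\<^sup>2 + (max 0 (s - 2))\<^sup>2) / 2"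

text \<open>The hat function on the interval from 0 to 2 with peak value 1 at 1.\<close>

definition ramp' :: "real \<Rightarrow> real"
  where "ramp' s = max 0 s - 2 * max 0 (s - 1) + max 0 (s - 2)"

lemma DERIV_max_0_square: "((\<lambda>s. (max 0 s)\<^sup>2) has_real_derivative 2 * max 0 s) (at s)"
proof (cases s "0 :: real" rule: linorder_cases)
  case less
  show ?thesis
    by (rule has_field_derivative_transform_within_open[where S="{..<0}" and f="\<lambda>_. 0"])
      (use less in auto)
next
  case greater
  have "((\<lambda>s. s\<^sup>2) has_real_derivative 2 * s) (at s)"
    by (auto intro!: derivative_eq_intros)
  then have "((\<lambda>s. (max 0 s)\<^sup>2) has_real_derivative 2 * s) (at s)"
    by (rule has_field_derivative_transform_within_open[where S="{0<..}"])
      (use greater in auto)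
  then show ?thesis using greater by simp
next
  case equal
  have "((\<lambda>h. (max 0 h)\<^sup>2 / h) \<longlongrightarrow> 0) (at (0 :: real))"
  proof (rule Lim_null_comparison)
    show "\<forall>\<^sub>F h in at 0. norm ((max 0 h)\<^sup>2 / h) \<le> \<bar>h\<bar>"
      by (intro always_eventually allI) (auto simp: max_def power2_eq_square)
    show "((\<lambda>h. \<bar>h\<bar>) \<longlongrightarrow> 0) (at (0::real))"
      by (intro tendsto_rabs_zero tendsto_ident_at)
  qed
  then show ?thesis using equal by (simp add: has_field_derivative_iff)
qed

lemma DERIV_ramp: "(ramp has_real_derivative ramp' s) (at s)"
proof -
  have sh: "((\<lambda>s. (max 0 (s - a))\<^sup>2) has_real_derivative 2 * max 0 (s - a)) (at s)" for a :: real
  proof -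
    have "((\<lambda>s. s - a) has_real_derivative 1) (at s)"
      by (auto intro!: derivative_eq_intros)
    from DERIV_chain2[OF DERIV_max_0_square this] show ?thesis by simp
  qed
  have "((\<lambda>s. ((max 0 (s - 0))\<^sup>2 - 2 * (max 0 (s - 1))\<^sup>2 + (max 0 (s - 2))\<^sup>2) / 2) has_real_derivative
      (2 * max 0 (s - 0) - 2 * (2 * max 0 (s - 1)) + 2 * max 0 (s - 2)) / 2) (at s)"
    by (intro DERIV_cdivide DERIV_add DERIV_diff DERIV_cmult sh)
  moreover have "(2 * max 0 (s - 0) - 2 * (2 * max 0 (s - 1)) + 2 * max 0 (s - 2)) / 2 = ramp' s"
    by (simp add: ramp'_def field_simps)
  moreover have "(\<lambda>s. ((max 0 (s - 0))\<^sup>2 - 2 * (max 0 (s - 1))\<^sup>2 + (max 0 (s - 2))\<^sup>2) / 2) = ramp"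
    by (simp add: ramp_def fun_eq_iff)
  ultimately show ?thesis by simp
qed

lemma ramp_simps: "s \<le> 0 \<Longrightarrow> ramp s = 0" "s \<ge> 2 \<Longrightarrow> ramp s = 1"
    "s \<le> 0 \<Longrightarrow> ramp' s = 0" "s \<ge> 2 \<Longrightarrow> ramp' s = 0"
  and ramp_bounds: "0 \<le> ramp s" "ramp s \<le> 1" "0 \<le> ramp' s" "ramp' s \<le> 1"
proof -
  show a: "s \<le> 0 \<Longrightarrow> ramp s = 0" "s \<ge> 2 \<Longrightarrow> ramp s = 1"
    "s \<le> 0 \<Longrightarrow> ramp' s = 0" "s \<ge> 2 \<Longrightarrow> ramp' s = 0"
    by (auto simp: ramp_def ramp'_def max_def power2_eq_square algebra_simps)
  show r': "0 \<le> ramp' s" "ramp' s \<le> 1" for s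
    by (auto simp: ramp'_def max_def)
  have mono: "ramp x \<le> ramp y" if "x \<le> y" for x y
    by (rule DERIV_nonneg_imp_nondecreasing[OF that]) (use DERIV_ramp r' in blast)
  show "0 \<le> ramp s" using mono[of "min s 0" s] by (simp add: ramp_def)
  show "ramp s \<le> 1"
  proof (cases "s \<le> 2")
    case True
    then show ?thesis using mono[of s 2] by (simp add: ramp_def)
  qed (use a in simp)
qed

lemma continuous_on_ramp: "continuous_on A ramp" "continuous_on A ramp'"
  unfolding ramp_def ramp'_def by (intro continuous_intros; simp)+

lemma trace_outer_prod: "trace (outer_prod a b) = a \<bullet> b"
  by (simp add: trace_def outer_prod_def inner_vec_def)

lemma outer_prod_mult_vec: "outer_prod a b *v h = (b \<bullet> h) *\<^sub>R a"
  by (simp add: vec_eq_iff matrix_vector_mult_def outer_prod_def inner_vec_def sum_distrib_left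
      mult.assoc flip: mult.commute[of "a $ _"])

lemma continuous_on_outer_prod:
  assumes "continuous_on A a" "continuous_on A b"
  shows "continuous_on A (\<lambda>x. outer_prod (a x) (b x))"
  unfolding outer_prod_def by (intro continuous_intros assms)

text \<open>The product rule in matrix form. Its trace is
  \<open>f x * trace G + v x \<bullet> d\<close>, the divergence of a field multiplied by a cutoff
  or by a member of a partition of unity.\<close>

lemma has_derivative_scaleR_matrix:
  fixes v :: "real ^ 'n \<Rightarrow> real ^ 'n" and f :: "real ^ 'n \<Rightarrow> real"
  assumes "(v has_derivative (\<lambda>h. G *v h)) F" "F = at x within S"
    and "(f has_derivative (\<lambda>h. d \<bullet> h)) F"
  shows "((\<lambda>y. f y *\<^sub>R v y) has_derivative (\<lambda>h. (f x *\<^sub>R G + outer_prod (v x) d) *v h)) F"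
proof -
  have "((\<lambda>y. f y *\<^sub>R v y) has_derivative (\<lambda>h. f x *\<^sub>R (G *v h) + (d \<bullet> h) *\<^sub>R v x)) F"
    using has_derivative_scaleR[of f "\<lambda>h. d \<bullet> h" x S v] assms by simp
  moreover have "(f x *\<^sub>R G + outer_prod (v x) d) *v h = f x *\<^sub>R (G *v h) + (d \<bullet> h) *\<^sub>R v x" for h
    by (simp add: matrix_vector_mult_add_rdistrib outer_prod_mult_vec scaleR_matrix_vector_assoc)
  ultimately show ?thesis by simp
qed

lemma trace_scaleR_add: "trace (a *\<^sub>R G + H) = a * trace G + trace (H :: real ^ 'n ^ 'n)"
  by (simp add: trace_def sum.distrib sum_distrib_left)

lemma continuous_on_trace [continuous_intros]:
  fixes G :: "'a::topological_space \<Rightarrow> real ^ 'n ^ 'n"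
  shows "continuous_on A G \<Longrightarrow> continuous_on A (\<lambda>x. trace (G x))"
  unfolding trace_def by (intro continuous_intros)

lemma integrable_lebesgue_on_continuous_bounded:
  fixes f :: "'a::euclidean_space \<Rightarrow> real"
  assumes "S \<in> lmeasurable" "continuous_on S f" "\<And>x. x \<in> S \<Longrightarrow> \<bar>f x\<bar> \<le> B"
  shows "integrable (lebesgue_on S) f"
proof -
  interpret finite_measure "lebesgue_on S"
    using assms(1) by (rule finite_measure_lebesgue_on)
  show ?thesis
  proof (rule integrable_const_bound[where B=B])
    show "f \<in> borel_measurable (lebesgue_on S)"
      using assms by (intro continuous_imp_measurable_on_sets_lebesgue) (auto intro: fmeasurableD)
    show "AE x in lebesgue_on S. norm (f x) \<le> B"
      using assms(3) by (intro AE_I2) auto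
  qed
qed

text \<open>The field is cut off by \<open>ramp (- g x / \<epsilon> - 1)\<close>. The gradient of the cutoff has size \<open>1 / \<epsilon>\<close>, on a
  layer of volume \<open>O(\<epsilon>)\<close>; its product with \<open>v\<close> is \<open>o(1 / \<epsilon>)\<close>, because \<open>v\<close> is tangent to the boundary.\<close>

lemma integral_trace_boundary_patch:
  fixes \<Omega> :: "(real ^ 'n) set" and v d :: "real ^ 'n \<Rightarrow> real ^ 'n"
    and G :: "real ^ 'n \<Rightarrow> real ^ 'n ^ 'n"
  assumes \<Omega>: "open \<Omega>" "bounded \<Omega>" and U: "open U"
    and dg: "\<And>y. y \<in> U \<Longrightarrow> (g has_derivative (\<lambda>h. d y \<bullet> h)) (at y)" and cd: "continuous_on U d"
    and lt: "\<Omega> \<inter> U = {y \<in> U. g y < 0}"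
    and r: "cball x0 r \<subseteq> U" and c: "c > 0" "\<And>y. y \<in> cball x0 r \<Longrightarrow> c \<le> d y \<bullet> e"
    and dv: "\<And>x. x \<in> closure \<Omega> \<Longrightarrow> (v has_derivative (\<lambda>h. G x *v h)) (at x within closure \<Omega>)"
    and cG: "continuous_on (closure \<Omega>) G"
    and v0: "\<And>x. x \<in> closure \<Omega> - ball x0 r \<Longrightarrow> v x = 0"
    and G0: "\<And>x. x \<in> closure \<Omega> - ball x0 r \<Longrightarrow> G x = 0"
    and tan: "\<And>y. y \<in> frontier \<Omega> \<inter> U \<Longrightarrow> v y \<bullet> d y = 0"
  shows "(LINT x|lebesgue_on \<Omega>. trace (G x)) = 0"
proof -
  define P where "P = \<Omega> \<inter> U"
  have P: "open P" "P \<subseteq> \<Omega>" "P \<subseteq> U" "P \<subseteq> closure \<Omega>"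
    using \<Omega> U closure_subset by (auto simp: P_def)
  have bP: "bounded P" using \<Omega>(2) P(2) bounded_subset by blast
  have mP: "P \<in> lmeasurable" using P(1) bP by (simp add: lmeasurable_open)
  interpret P: finite_measure "lebesgue_on P"
    using mP by (rule finite_measure_lebesgue_on)
  have cl: "compact (closure \<Omega>)" using \<Omega>(2) by (simp add: compact_closure)
  have dv': "(v has_derivative (\<lambda>h. G x *v h)) (at x)" if "x \<in> P" for x
  proof -
    have "x \<in> closure \<Omega>" using that P by auto
    moreover have "x \<in> interior (closure \<Omega>)"
      using that P interior_maximal[of P "closure \<Omega>"] by auto
    ultimately show ?thesis using dv[of x] by (metis at_within_interior)
  qed
  have cv: "continuous_on (closure \<Omega>) v"
    using dv by (meson continuous_on_eq_continuous_within has_derivative_continuous)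
  have cg: "continuous_on U g"
    using dg U by (meson continuous_at_imp_continuous_on has_derivative_continuous)
  have g_neg: "g y < 0" if "y \<in> P" for y using that lt by (auto simp: P_def)
  \<comment> \<open>A point of the closure inside \<open>U\<close> lies either on the boundary,
    where \<open>v\<close> is tangent, or in \<Omega>, where \<open>g\<close> is negative.\<close>
  have g_cl: "v y \<bullet> d y = 0 \<or> g y < 0" if y: "y \<in> closure \<Omega>" "y \<in> U" for y
    using tan[of y] y lt \<Omega>(1) by (auto simp: frontier_def interior_open)
  obtain M where M: "\<And>x. x \<in> closure \<Omega> \<Longrightarrow> \<bar>trace (G x)\<bar> \<le> M"
  proof -
    have "bounded ((\<lambda>x. trace (G x)) ` closure \<Omega>)"
      by (intro compact_imp_bounded compact_continuous_image continuous_intros cG cl)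
    then show ?thesis using that by (auto simp: bounded_iff)
  qed
  have itr: "integrable (lebesgue_on P) (\<lambda>x. trace (G x))"
    using P M mP by (intro integrable_lebesgue_on_continuous_bounded[where B=M] continuous_intros
        continuous_on_subset[OF cG]) auto
  have cvd: "continuous_on (closure \<Omega> \<inter> cball x0 r) (\<lambda>x. v x \<bullet> d x)"
    using r by (intro continuous_intros continuous_on_subset[OF cv] continuous_on_subset[OF cd]) auto
  have cmp: "compact (closure \<Omega> \<inter> cball x0 r)" using cl by (intro compact_Int) auto
  \<comment> \<open>The field \<open>d\<close> is controlled only on compact parts of
    \<open>U\<close>. Since \<open>v\<close> vanishes off the ball, a bound on the closed ball is
    enough.\<close>
  obtain M2 where M2: "\<And>x. x \<in> closure \<Omega> \<inter> cball x0 r \<Longrightarrow> \<bar>v x \<bullet> d x\<bar> \<le> M2"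
  proof -
    have "\<exists>a. \<forall>x\<in>closure \<Omega> \<inter> cball x0 r. \<bar>v x \<bullet> d x\<bar> \<le> a"
      using compact_imp_bounded[OF compact_continuous_image[OF cvd cmp]] by (simp add: bounded_iff)
    then show ?thesis using that by blast
  qed
  let ?s = "\<lambda>\<epsilon> x. - g x / \<epsilon> - 1"
  have i2: "integrable (lebesgue_on P) (\<lambda>x. ramp' (?s \<epsilon> x) / \<epsilon> * (v x \<bullet> d x))" if \<epsilon>: "\<epsilon> > 0" for \<epsilon>
  proof (intro integrable_lebesgue_on_continuous_bounded[where B="\<bar>M2\<bar> / \<epsilon>"] mP)
    have cs: "continuous_on P (\<lambda>x. ?s \<epsilon> x)"
      using \<epsilon> P by (intro continuous_intros continuous_on_subset[OF cg]) auto
      show "continuous_on P (\<lambda>x. ramp' (?s \<epsilon> x) / \<epsilon> * (v x \<bullet> d x))"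
        using P \<epsilon> by (intro continuous_intros continuous_on_compose2[OF continuous_on_ramp(2) cs]
            continuous_on_subset[OF cv] continuous_on_subset[OF cd]) auto
      show "\<bar>ramp' (?s \<epsilon> x) / \<epsilon> * (v x \<bullet> d x)\<bar> \<le> \<bar>M2\<bar> / \<epsilon>" if "x \<in> P" for x
      proof (cases "x \<in> ball x0 r")
        case True
        then have "\<bar>v x \<bullet> d x\<bar> \<le> \<bar>M2\<bar>" using M2[of x] that P by force
        then have "\<bar>ramp' (?s \<epsilon> x)\<bar> * \<bar>v x \<bullet> d x\<bar> \<le> 1 * \<bar>M2\<bar>"
          using ramp_bounds[of "?s \<epsilon> x"] by (intro mult_mono) auto
        then show ?thesis using \<epsilon> by (simp add: abs_mult divide_right_mono)
      next
        case False
        then show ?thesis using v0[of x] that P \<epsilon> by auto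
      qed
    qed
  \<comment> \<open>The field multiplied by the cutoff has compact support in \<open>P\<close>, so
    its divergence has integral zero. The cutoff has gradient
    \<open>- ramp' (?s \<epsilon> x) / \<epsilon>\<close> times \<open>d x\<close>, which explains
    the sign on the right.\<close>
  have cut: "(LINT x|lebesgue_on P. ramp (?s \<epsilon> x) * trace (G x)) =
      (LINT x|lebesgue_on P. ramp' (?s \<epsilon> x) / \<epsilon> * (v x \<bullet> d x))" if \<epsilon>: "\<epsilon> > 0" for \<epsilon>
  proof -
    \<comment> \<open>Where \<open>g\<close> exceeds \<open>- \<epsilon>\<close> the argument of
      \<open>ramp\<close> is negative and the cutoff vanishes. On this compact set \<open>g\<close>
      is negative, so that it lies in \<open>P\<close>.\<close>
    let ?K = "{x \<in> cball x0 r. g x \<in> {..-\<epsilon>}}"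
    let ?D = "\<lambda>x. ramp (?s \<epsilon> x) *\<^sub>R G x + outer_prod (v x) ((- ramp' (?s \<epsilon> x) / \<epsilon>) *\<^sub>R d x)"
    have sm: "ramp (?s \<epsilon> x) = 0" "ramp' (?s \<epsilon> x) = 0" if "\<not> g x \<le> - \<epsilon>" for x
    proof -
      have "?s \<epsilon> x \<le> 0" using that \<epsilon> by (simp add: field_simps)
      then show "ramp (?s \<epsilon> x) = 0" "ramp' (?s \<epsilon> x) = 0" by (simp_all only: ramp_simps)
    qed
    have z: "x \<notin> ball x0 r \<or> \<not> g x \<le> - \<epsilon>" if "x \<in> P - ?K" for x using that by auto
    have cs: "continuous_on P (\<lambda>x. ?s \<epsilon> x)"
      using \<epsilon> P by (intro continuous_intros continuous_on_subset[OF cg]) auto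
    have cont: "continuous_on P ?D"
      using \<epsilon> P
      by (intro continuous_intros continuous_on_outer_prod cs continuous_on_compose2[OF continuous_on_ramp(1) cs]
          continuous_on_compose2[OF continuous_on_ramp(2) cs]
          continuous_on_subset[OF cG] continuous_on_subset[OF cd] continuous_on_subset[OF cv]) auto
    have "(LINT x|lebesgue_on P. trace (?D x)) = 0"
    proof (rule integral_trace_compact_support[where K="?K" and w="\<lambda>x. ramp (?s \<epsilon> x) *\<^sub>R v x"])
      have "closed ?K"
        using continuous_closed_preimage[OF continuous_on_subset[OF cg r] closed_cball closed_atMost]
        by (simp add: vimage_def Int_def)
      then have "compact (cball x0 r \<inter> ?K)" by (intro compact_Int_closed compact_cball)
      moreover have "cball x0 r \<inter> ?K = ?K" by auto
      ultimately show "compact ?K" by simp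
      show "?K \<subseteq> P" using r lt \<epsilon> by (auto simp: P_def)
      show "((\<lambda>x. ramp (?s \<epsilon> x) *\<^sub>R v x) has_derivative (\<lambda>h. ?D x *v h)) (at x)" if x: "x \<in> P" for x
      proof (rule has_derivative_scaleR_matrix[OF dv'[OF x] refl])
        have "(ramp has_derivative (\<lambda>h. ramp' (?s \<epsilon> x) * h)) (at (?s \<epsilon> x))"
          using DERIV_ramp by (simp add: has_field_derivative_def)
        moreover have "((\<lambda>x. ?s \<epsilon> x) has_derivative (\<lambda>h. - (d x \<bullet> h) / \<epsilon>)) (at x)"
          using dg[of x] x P \<epsilon> by (auto intro!: derivative_eq_intros)
        ultimately have "((\<lambda>x. ramp (?s \<epsilon> x)) has_derivative (\<lambda>h. ramp' (?s \<epsilon> x) * (- (d x \<bullet> h) / \<epsilon>))) (at x)"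
          using has_derivative_compose by blast
        then show "((\<lambda>x. ramp (?s \<epsilon> x)) has_derivative (\<lambda>h. ((- ramp' (?s \<epsilon> x) / \<epsilon>) *\<^sub>R d x) \<bullet> h)) (at x)"
          by simp
      qed
      show "ramp (?s \<epsilon> x) *\<^sub>R v x = 0" if x: "x \<in> P - ?K" for x
        using z[OF x] sm[of x] v0[of x] x P by auto
      show "?D x = 0" if x: "x \<in> P - ?K" for x
        using z[OF x] sm[of x] v0[of x] G0[of x] x P by (auto simp: outer_prod_def vec_eq_iff)
    qed (use P cont in auto)
    then have "(LINT x|lebesgue_on P. ramp (?s \<epsilon> x) * trace (G x) - ramp' (?s \<epsilon> x) / \<epsilon> * (v x \<bullet> d x)) = 0"
      by (simp add: trace_scaleR_add trace_outer_prod)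
    moreover have "integrable (lebesgue_on P) (\<lambda>x. ramp (?s \<epsilon> x) * trace (G x))"
    proof (intro integrable_lebesgue_on_continuous_bounded[where B=M] mP)
      show "continuous_on P (\<lambda>x. ramp (?s \<epsilon> x) * trace (G x))"
        using P by (intro continuous_intros continuous_on_compose2[OF continuous_on_ramp(1) cs]
            continuous_on_subset[OF cG]) auto
      show "\<bar>ramp (?s \<epsilon> x) * trace (G x)\<bar> \<le> M" if "x \<in> P" for x
      proof -
        have "\<bar>ramp (?s \<epsilon> x)\<bar> * \<bar>trace (G x)\<bar> \<le> 1 * M"
          using M[of x] that P ramp_bounds[of "?s \<epsilon> x"] by (intro mult_mono) auto
        then show ?thesis by (simp add: abs_mult)
      qed
    qed
    moreover note i2[OF \<epsilon>]
    ultimately show ?thesis by (simp add: Bochner_Integration.integral_diff)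
  qed
  \<comment> \<open>The gradient of the cutoff lives where \<open>- 3 * \<epsilon> < g\<close>, a
    layer of volume at most \<open>6 * \<epsilon> / c\<close> times that of the larger ball. There
    the integrand is at most \<open>\<delta> / \<epsilon>\<close>, so that \<epsilon> cancels in the
    product.\<close>
  define C where "C = 6 / c * measure lebesgue (ball x0 (r + norm e))"
  have C0: "C \<ge> 0" using c by (simp add: C_def)
  have small: "\<bar>LINT x|lebesgue_on P. trace (G x)\<bar> \<le> \<delta> * C" if \<delta>: "\<delta> > 0" for \<delta>
  proof -
    obtain \<epsilon>0 where \<epsilon>0: "\<epsilon>0 > 0"
      and \<epsilon>0': "\<And>x. x \<in> closure \<Omega> \<inter> cball x0 r \<Longrightarrow> - \<epsilon>0 < g x \<Longrightarrow> \<bar>v x \<bullet> d x\<bar> \<le> \<delta>"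
    proof -
      \<comment> \<open>On this compact set \<open>v \<bullet> d\<close> is nonzero, so
        \<open>g_cl\<close> makes \<open>g\<close> negative there. If the set is nonempty, the
        maximum of \<open>g\<close> on it is some \<open>- \<epsilon>0 < 0\<close>; nearer to the
        boundary \<open>v \<bullet> d\<close> is small.\<close>
      let ?L = "{x \<in> closure \<Omega> \<inter> cball x0 r. v x \<bullet> d x \<in> {y. \<delta> \<le> \<bar>y\<bar>}}"
      have "closed {y::real. \<delta> \<le> \<bar>y\<bar>}"
        by (intro closed_Collect_le continuous_intros)
      from continuous_closed_preimage[OF cvd compact_imp_closed[OF cmp] this] have "closed ?L"
        by (simp add: vimage_def Int_def)
      from compact_Int_closed[OF cmp this]
      have "compact ((closure \<Omega> \<inter> cball x0 r) \<inter> ?L)" .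
      moreover have "(closure \<Omega> \<inter> cball x0 r) \<inter> ?L = ?L" by auto
      ultimately have cL: "compact ?L" by simp
      have sub: "?L \<subseteq> U" using r by auto
      show ?thesis
      proof (cases "?L = {}")
        case True
        then show ?thesis using that[of 1] by force
      next
        case False
        obtain y where y: "y \<in> ?L" "\<And>z. z \<in> ?L \<Longrightarrow> g z \<le> g y"
          using continuous_attains_sup[OF cL False continuous_on_subset[OF cg sub]] by auto
        have "y \<in> closure \<Omega>" "y \<in> U" "v y \<bullet> d y \<noteq> 0" using y(1) r \<delta> by auto
        then have "g y < 0" using g_cl[of y] by blast
        then show ?thesis
          using that[of "- g y"] y(2) by (smt (verit, best) mem_Collect_eq)
      qed
    qed
    have bd: "\<bar>LINT x|lebesgue_on P. ramp (?s \<epsilon> x) * trace (G x)\<bar> \<le> \<delta> * C"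
      if \<epsilon>: "\<epsilon> > 0" "3 * \<epsilon> \<le> \<epsilon>0" for \<epsilon>
    proof -
      define A where "A = {x \<in> ball x0 r. g x \<in> {-3 * \<epsilon> <..< 0}}"
      have "open A"
        unfolding A_def
        using continuous_open_preimage[OF continuous_on_subset[OF cg, of "ball x0 r"] open_ball, of "{-3 * \<epsilon> <..< 0}"] r
        by (simp add: vimage_def Int_def) (meson ball_subset_cball order_trans)
      moreover have "bounded A" by (rule bounded_subset[OF bounded_ball]) (auto simp: A_def)
      ultimately have mA: "A \<in> lmeasurable" by (simp add: lmeasurable_open)
      have AP: "A \<subseteq> P" using r lt by (auto simp: A_def P_def)
      \<comment> \<open>By convexity the segment stays in the ball, where \<open>g\<close> grows
        along \<open>e\<close> at rate at least \<open>c\<close>; but between two points of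
        \<open>A\<close> it can grow by at most \<open>3 * \<epsilon>\<close>.\<close>
      have mvt: "c * t \<le> 3 * \<epsilon>" if t: "x \<in> A" "t > 0" "x + t *\<^sub>R e \<in> A" for x t
      proof -
        have seg: "x + s *\<^sub>R e \<in> ball x0 r" if "0 \<le> s" "s \<le> t" for s
        proof -
          have "(1 - s / t) *\<^sub>R x + (s / t) *\<^sub>R (x + t *\<^sub>R e) \<in> ball x0 r"
            using t that by (intro convexD[OF convex_ball]) (auto simp: A_def)
          moreover have "(1 - s / t) *\<^sub>R x + (s / t) *\<^sub>R (x + t *\<^sub>R e) = x + s *\<^sub>R e"
            using t(2) by (simp add: algebra_simps)
          ultimately show ?thesis by simp
        qed
        have "\<exists>z>0. z < t \<and> g (x + t *\<^sub>R e) - g (x + 0 *\<^sub>R e) = (t - 0) * (d (x + z *\<^sub>R e) \<bullet> e)"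
        proof (rule MVT2[OF t(2)])
          fix s assume s: "0 \<le> s" "s \<le> t"
          have "x + s *\<^sub>R e \<in> U" using seg[OF s] r by auto
          then have "((\<lambda>s. g (x + s *\<^sub>R e)) has_derivative (\<lambda>h. d (x + s *\<^sub>R e) \<bullet> (h *\<^sub>R e))) (at s)"
            by (intro has_derivative_compose[where g=g, OF _ dg]) (auto intro!: derivative_eq_intros)
          then show "((\<lambda>s. g (x + s *\<^sub>R e)) has_real_derivative d (x + s *\<^sub>R e) \<bullet> e) (at s)"
            by (simp add: has_field_derivative_def mult.commute[of _ "d _ \<bullet> _"])
        qed
        then obtain z where z: "0 < z" "z < t" "g (x + t *\<^sub>R e) - g x = t * (d (x + z *\<^sub>R e) \<bullet> e)"
          by auto
        have "c * t \<le> (d (x + z *\<^sub>R e) \<bullet> e) * t"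
          using z seg[of z] t(2) by (intro mult_right_mono c(2)) auto
        also have "\<dots> = g (x + t *\<^sub>R e) - g x" using z(3) by simp
        also have "\<dots> \<le> 3 * \<epsilon>" using t by (auto simp: A_def)
        finally show ?thesis .
      qed
      have mAle: "measure lebesgue A \<le> 2 * (3 * \<epsilon>) / c * measure lebesgue (ball x0 (r + norm e))"
        by (rule measure_layer_le[OF mA _ c(1) _ mvt]) (use \<epsilon> in \<open>auto simp: A_def\<close>)
      have pt: "\<bar>ramp' (?s \<epsilon> x) / \<epsilon> * (v x \<bullet> d x)\<bar> \<le> \<delta> / \<epsilon> * indicator A x" if x: "x \<in> P" for x
      proof (cases "x \<in> A")
        case True
        have "\<bar>v x \<bullet> d x\<bar> \<le> \<delta>" using True x P \<epsilon> by (intro \<epsilon>0') (auto simp: A_def)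
        then have "\<bar>ramp' (?s \<epsilon> x)\<bar> * \<bar>v x \<bullet> d x\<bar> \<le> 1 * \<delta>"
          using ramp_bounds[of "?s \<epsilon> x"] by (intro mult_mono) auto
        then show ?thesis using \<epsilon> True by (simp add: abs_mult divide_right_mono)
      next
        case False
        then have "x \<notin> ball x0 r \<or> g x \<le> - 3 * \<epsilon>"
          using x g_neg[of x] by (auto simp: A_def)
        moreover have "ramp' (?s \<epsilon> x) = 0" if "g x \<le> - 3 * \<epsilon>"
        proof -
          have "?s \<epsilon> x \<ge> 2" using that \<epsilon> by (simp add: field_simps)
          then show ?thesis by (simp only: ramp_simps)
        qed
        ultimately have "v x = 0 \<or> ramp' (?s \<epsilon> x) = 0"
          using v0[of x] x P by auto
        then show ?thesis using False by auto
      qed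
      have "\<bar>LINT x|lebesgue_on P. ramp' (?s \<epsilon> x) / \<epsilon> * (v x \<bullet> d x)\<bar> \<le> (LINT x|lebesgue_on P. \<delta> / \<epsilon> * indicator A x)"
      proof (rule integral_abs_bound_integral[OF i2[OF \<epsilon>(1)]])
        show "integrable (lebesgue_on P) (\<lambda>x. \<delta> / \<epsilon> * indicator A x)"
          using mA AP mP by (intro integrable_mult_right integrable_real_indicator P.emeasure_finite)
            (auto simp: sets_restrict_space_iff P.emeasure_eq_measure dest: fmeasurableD)
      qed (use pt in auto)
      also have "\<dots> = \<delta> / \<epsilon> * measure lebesgue A"
        using mA AP mP by (simp add: measure_restrict_space Int_absorb2 fmeasurableD)
      also have "\<dots> \<le> \<delta> / \<epsilon> * (2 * (3 * \<epsilon>) / c * measure lebesgue (ball x0 (r + norm e)))"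
        using mAle \<delta> \<epsilon> by (intro mult_left_mono) auto
      also have "\<dots> = \<delta> * C" using \<epsilon> by (simp add: C_def)
      finally show ?thesis using cut[OF \<epsilon>(1)] by simp
    qed
    \<comment> \<open>Dividing by 3 ensures \<open>3 * ?e n \<le> \<epsilon>0\<close>, as
      \<open>bd\<close> demands. At a fixed point of \<open>P\<close> the cutoff equals 1 as soon as
      \<open>3 * ?e n \<le> - g x\<close>.\<close>
    let ?e = "\<lambda>n. \<epsilon>0 / 3 / (real n + 1)"
    have lim: "(\<lambda>n. LINT x|lebesgue_on P. ramp (?s (?e n) x) * trace (G x)) \<longlonglongrightarrow> (LINT x|lebesgue_on P. trace (G x))"
    proof (rule integral_dominated_convergence[where w="\<lambda>x. M"])
      show "AE x in lebesgue_on P. norm (ramp (?s (?e n) x) * trace (G x)) \<le> M" for n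
      proof (rule AE_I2)
        fix x assume "x \<in> space (lebesgue_on P)"
        then have "\<bar>ramp (?s (?e n) x)\<bar> * \<bar>trace (G x)\<bar> \<le> 1 * M"
          using M[of x] P ramp_bounds[of "?s (?e n) x"] by (intro mult_mono) auto
        then show "norm (ramp (?s (?e n) x) * trace (G x)) \<le> M" by (simp add: abs_mult)
      qed
      show "AE x in lebesgue_on P. (\<lambda>n. ramp (?s (?e n) x) * trace (G x)) \<longlonglongrightarrow> trace (G x)"
      proof (rule AE_I2)
        fix x assume "x \<in> space (lebesgue_on P)"
        then have gx: "g x < 0" using g_neg by simp
        have "eventually (\<lambda>n. ramp (?s (?e n) x) * trace (G x) = trace (G x)) sequentially"
          unfolding eventually_sequentially
        proof (intro exI allI impI)
          fix n assume n: "nat \<lceil>\<epsilon>0 / (- g x)\<rceil> \<le> n"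
          have "\<epsilon>0 / (- g x) \<le> real n + 1" using n by linarith
          then have "3 * ?e n \<le> - g x" using gx by (simp add: field_simps)
          moreover have "?e n > 0" using \<epsilon>0 by simp
          ultimately have "3 \<le> - g x / ?e n"
            by (simp only: pos_le_divide_eq)
          then have "?s (?e n) x \<ge> 2" by linarith
          then show "ramp (?s (?e n) x) * trace (G x) = trace (G x)"
            by (simp only: ramp_simps mult_1)
        qed
        then show "(\<lambda>n. ramp (?s (?e n) x) * trace (G x)) \<longlonglongrightarrow> trace (G x)"
          by (rule tendsto_eventually)
      qed
      show "(\<lambda>x. ramp (?s (?e n) x) * trace (G x)) \<in> borel_measurable (lebesgue_on P)" for n
      proof (rule continuous_imp_measurable_on_sets_lebesgue)
        have cs: "continuous_on P (\<lambda>x. ?s (?e n) x)"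
          using \<epsilon>0 P by (intro continuous_intros continuous_on_subset[OF cg]) auto
        then show "continuous_on P (\<lambda>x. ramp (?s (?e n) x) * trace (G x))"
          using P by (intro continuous_intros continuous_on_compose2[OF continuous_on_ramp(1) cs]
            continuous_on_subset[OF cG]) auto
      qed (use mP in \<open>auto intro: fmeasurableD\<close>)
    qed (use itr in auto)
    have "\<bar>LINT x|lebesgue_on P. ramp (?s (?e n) x) * trace (G x)\<bar> \<le> \<delta> * C" for n
      using \<epsilon>0 by (intro bd) (auto simp: field_simps)
    then show ?thesis
      by (intro LIMSEQ_le_const2[OF tendsto_rabs[OF lim]]) auto
  qed
  have "\<bar>LINT x|lebesgue_on P. trace (G x)\<bar> \<le> 0"
  proof (rule field_le_epsilon)
    fix k :: real assume k: "k > 0"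
    have "\<bar>LINT x|lebesgue_on P. trace (G x)\<bar> \<le> k / (C + 1) * C"
      using k C0 by (intro small) auto
    also have "\<dots> \<le> 0 + k" using k C0 by (simp add: field_simps)
    finally show "\<bar>LINT x|lebesgue_on P. trace (G x)\<bar> \<le> 0 + k" .
  qed
  moreover have "(LINT x|lebesgue_on \<Omega>. trace (G x)) = (LINT x|lebesgue_on P. trace (G x))"
  proof -
    have "indicator \<Omega> x *\<^sub>R trace (G x) = indicator P x *\<^sub>R trace (G x)" for x
    proof (cases "x \<in> \<Omega> - P")
      case True
      have "x \<notin> ball x0 r"
      proof
        assume "x \<in> ball x0 r"
        then have "x \<in> cball x0 r" by simp
        then show False using True r by (auto simp: P_def)
      qed
      then have "G x = 0" using True closure_subset by (intro G0) auto
      then show ?thesis by (simp add: trace_def)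
    qed (use P in \<open>auto simp: indicator_def\<close>)
    moreover have "\<Omega> \<in> sets lebesgue" "P \<in> sets lebesgue" using \<Omega> P by auto
    ultimately show ?thesis by (simp add: integral_restrict_space del: real_scaleR_def scaleR_cancel_right)
  qed
  ultimately show ?thesis by simp
qed

section \<open>Gradients of smooth functions and the partition of unity\<close>

lemma grad_inner:
  fixes f :: "real ^ 'n \<Rightarrow> real"
  assumes "f differentiable (at x)"
  shows "(f has_derivative (\<lambda>h. grad f x \<bullet> h)) (at x)"
proof -
  have d: "(f has_derivative frechet_derivative f (at x)) (at x)"
    using assms by (simp add: frechet_derivative_works)
  then have lin: "linear (frechet_derivative f (at x))"
    by (rule has_derivative_linear)
  have "frechet_derivative f (at x) h = grad f x \<bullet> h" for h :: "real ^ 'n"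
  proof -
    have "frechet_derivative f (at x) h = frechet_derivative f (at x) (\<Sum>i\<in>UNIV. (h $ i) *\<^sub>R axis i 1)"
      by (simp add: basis_expansion flip: scalar_mult_eq_scaleR)
    also have "\<dots> = grad f x \<bullet> h"
      by (simp add: linear_sum[OF lin] linear_cmul[OF lin] grad_def partial_deriv_def inner_vec_def mult.commute)
    finally show ?thesis .
  qed
  then have "frechet_derivative f (at x) = (\<lambda>h. grad f x \<bullet> h)" by (simp add: fun_eq_iff)
  with d show ?thesis by simp
qed

text \<open>The index lists of length 0 and 1 are enough: the former gives differentiability of
  \<open>f\<close>, the latter continuity of its partial derivatives.\<close>

lemma smooth_onD:
  assumes "smooth_on f U" "open U"
  shows "y \<in> U \<Longrightarrow> (f has_derivative (\<lambda>h. grad f y \<bullet> h)) (at y)"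
    and "continuous_on U (grad f)"
proof -
  have "partial_derivs [] f differentiable_on U"
    using assms(1) unfolding smooth_on_def by blast
  then have "f differentiable_on U" by (simp add: partial_derivs_def)
  then show "y \<in> U \<Longrightarrow> (f has_derivative (\<lambda>h. grad f y \<bullet> h)) (at y)"
    using assms(2) by (intro grad_inner) (simp add: differentiable_on_eq_differentiable_at)
  have "partial_derivs [i] f differentiable_on U" for i
    using assms(1) unfolding smooth_on_def by blast
  then have "continuous_on U (partial_deriv i f)" for i
    by (intro differentiable_imp_continuous_on) (simp add: partial_derivs_def)
  then show "continuous_on U (grad f)"
    unfolding grad_def[abs_def] by (intro continuous_intros) auto
qed

lemma integral_trace_interior_patch:
  fixes \<Omega> :: "(real ^ 'n) set" and v :: "real ^ 'n \<Rightarrow> real ^ 'n" and G :: "real ^ 'n \<Rightarrow> real ^ 'n ^ 'n"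
  assumes \<Omega>: "open \<Omega>" and r: "cball x0 r \<subseteq> \<Omega>"
    and dv: "\<And>x. x \<in> closure \<Omega> \<Longrightarrow> (v has_derivative (\<lambda>h. G x *v h)) (at x within closure \<Omega>)"
    and cG: "continuous_on (closure \<Omega>) G"
    and v0: "\<And>x. x \<in> closure \<Omega> - ball x0 r \<Longrightarrow> v x = 0"
    and G0: "\<And>x. x \<in> closure \<Omega> - ball x0 r \<Longrightarrow> G x = 0"
  shows "(LINT x|lebesgue_on \<Omega>. trace (G x)) = 0"
proof (rule integral_trace_compact_support[OF \<Omega> compact_cball r])
  have sub: "\<Omega> \<subseteq> closure \<Omega>" by (rule closure_subset)
  show "(v has_derivative (\<lambda>h. G x *v h)) (at x)" if "x \<in> \<Omega>" for x
  proof -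
    have "x \<in> interior (closure \<Omega>)"
      using that \<Omega> interior_maximal[OF sub] by auto
    then show ?thesis using dv[of x] that sub by (metis at_within_interior subsetD)
  qed
  show "continuous_on \<Omega> G" using cG sub by (rule continuous_on_subset)
  show "v x = 0" if "x \<in> \<Omega> - cball x0 r" for x
    using that sub by (intro v0) auto
  show "G x = 0" if "x \<in> \<Omega> - cball x0 r" for x
    using that sub by (intro G0) auto
qed

text \<open>Squaring makes the positive part continuously differentiable, which is all the
  smoothness that a partition of unity must have here. For \<open>r > 0\<close> the function is
  positive exactly on the open ball.\<close>

definition bump :: "'a::euclidean_space \<Rightarrow> real \<Rightarrow> 'a \<Rightarrow> real"
  where "bump x r y = (max 0 (r\<^sup>2 - (y - x) \<bullet> (y - x)))\<^sup>2"

definition bump_grad :: "'a::euclidean_space \<Rightarrow> real \<Rightarrow> 'a \<Rightarrow> 'a"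
  where "bump_grad x r y = (- 4 * max 0 (r\<^sup>2 - (y - x) \<bullet> (y - x))) *\<^sub>R (y - x)"

lemma bump_outside:
  assumes "r > 0" "y \<notin> ball x r"
  shows "bump x r y = 0" "bump_grad x r y = 0"
proof -
  have "r \<le> norm (y - x)" using assms by (simp add: dist_norm norm_minus_commute)
  then have "r\<^sup>2 \<le> (y - x) \<bullet> (y - x)"
    using assms(1) by (simp flip: power2_norm_eq_inner)
  then show "bump x r y = 0" "bump_grad x r y = 0" by (auto simp: bump_def bump_grad_def)
qed

lemma bump_pos: "y \<in> ball x r \<Longrightarrow> bump x r y > 0"
proof -
  assume "y \<in> ball x r"
  then have "norm (y - x) < r" by (simp add: dist_norm norm_minus_commute)
  then have "(norm (y - x))\<^sup>2 < r\<^sup>2" by (intro power_strict_mono) auto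
  then show ?thesis by (simp add: bump_def power2_norm_eq_inner)
qed

lemma bump_nonneg: "bump x r y \<ge> 0"
  by (simp add: bump_def)

lemma has_derivative_bump: "(bump x r has_derivative (\<lambda>h. bump_grad x r y \<bullet> h)) (at y within S)"
proof -
  have "((\<lambda>y. r\<^sup>2 - (y - x) \<bullet> (y - x)) has_derivative (\<lambda>h. - 2 * ((y - x) \<bullet> h))) (at y within S)"
    by (auto intro!: derivative_eq_intros simp: inner_commute algebra_simps)
  from has_derivative_compose[OF this DERIV_max_0_square[unfolded has_field_derivative_def]]
  have "((\<lambda>y. (max 0 (r\<^sup>2 - (y - x) \<bullet> (y - x)))\<^sup>2) has_derivative
      (\<lambda>h. 2 * max 0 (r\<^sup>2 - (y - x) \<bullet> (y - x)) * (- 2 * ((y - x) \<bullet> h)))) (at y within S)" .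
  then show ?thesis unfolding bump_def[abs_def] bump_grad_def by (simp add: mult.assoc)
qed

lemma continuous_on_bump: "continuous_on S (bump x r)" "continuous_on S (bump_grad x r)"
  unfolding bump_def[abs_def] bump_grad_def[abs_def] by (intro continuous_intros)+

lemma defining_function_boundary:
  assumes "defining_function \<Omega> x U g" "open \<Omega>" "y \<in> frontier \<Omega>" "y \<in> U"
  shows "outer_normal \<Omega> y (grad g y /\<^sub>R norm (grad g y))"
  using assms by (auto simp: outer_normal_def defining_function_def intro!: exI[of _ U] exI[of _ g])

text \<open>A partition of unity splits \<open>v\<close> into fields supported in small balls,
  interior or at the boundary. Multiplication by a scalar preserves tangency, and since the
  gradients of the partition add up to zero, the divergences of the pieces add up to that of
  \<open>v\<close>.\<close>

theorem divergence_tangent_field: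
  fixes \<Omega> :: "(real ^ 'n) set" and v :: "real ^ 'n \<Rightarrow> real ^ 'n" and G :: "real ^ 'n \<Rightarrow> real ^ 'n ^ 'n"
  assumes dom: "smooth_bounded_domain \<Omega>"
    and dv: "\<And>x. x \<in> closure \<Omega> \<Longrightarrow> (v has_derivative (\<lambda>h. G x *v h)) (at x within closure \<Omega>)"
    and cG: "continuous_on (closure \<Omega>) G"
    and tan: "\<And>x \<nu>. x \<in> frontier \<Omega> \<Longrightarrow> outer_normal \<Omega> x \<nu> \<Longrightarrow> v x \<bullet> \<nu> = 0"
  shows "(LINT x|lebesgue_on \<Omega>. trace (G x)) = 0"
proof -
  have \<Omega>: "open \<Omega>" "bounded \<Omega>" using dom by (auto simp: smooth_bounded_domain_def)
  have cl: "compact (closure \<Omega>)" using \<Omega>(2) by (simp add: compact_closure)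
  have cv: "continuous_on (closure \<Omega>) v"
    using dv by (meson continuous_on_eq_continuous_within has_derivative_continuous)
  \<comment> \<open>The local claim is quantified over all admissible fields, because the radii have
    to be fixed before the finite cover is chosen, and the localised fields depend on the whole
    cover.\<close>
  define Q where "Q x0 r \<longleftrightarrow> (\<forall>w H. (\<forall>x\<in>closure \<Omega>. (w has_derivative (\<lambda>h. H x *v h)) (at x within closure \<Omega>)) \<and>
      continuous_on (closure \<Omega>) H \<and> (\<forall>x\<in>closure \<Omega> - ball x0 r. w x = 0) \<and> (\<forall>x\<in>closure \<Omega> - ball x0 r. H x = 0) \<and>
      (\<forall>x\<in>frontier \<Omega>. \<forall>\<nu>. outer_normal \<Omega> x \<nu> \<longrightarrow> w x \<bullet> \<nu> = 0) \<longrightarrow>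
      (LINT x|lebesgue_on \<Omega>. trace (H x)) = 0)" for x0 r
  have patch: "\<exists>r>0. Q x0 r" if x0: "x0 \<in> closure \<Omega>" for x0
  proof (cases "x0 \<in> \<Omega>")
    case True
    then obtain r where r: "r > 0" "cball x0 r \<subseteq> \<Omega>" using \<Omega>(1) open_contains_cball by blast
    have "Q x0 r"
      unfolding Q_def
    proof (intro allI impI, elim conjE)
      fix w :: "real ^ 'n \<Rightarrow> real ^ 'n" and H :: "real ^ 'n \<Rightarrow> real ^ 'n ^ 'n"
      assume w: "\<forall>x\<in>closure \<Omega>. (w has_derivative (\<lambda>h. H x *v h)) (at x within closure \<Omega>)"
        "continuous_on (closure \<Omega>) H" "\<forall>x\<in>closure \<Omega> - ball x0 r. w x = 0" "\<forall>x\<in>closure \<Omega> - ball x0 r. H x = 0"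
      show "(LINT x|lebesgue_on \<Omega>. trace (H x)) = 0"
        by (rule integral_trace_interior_patch[OF \<Omega>(1) r(2), of w H]) (use w in auto)
    qed
    then show ?thesis using r by blast
  next
    case False
    then have "x0 \<in> frontier \<Omega>" using x0 \<Omega>(1) by (simp add: frontier_def interior_open)
    then obtain U g where df: "defining_function \<Omega> x0 U g"
      using dom unfolding smooth_bounded_domain_def by blast
    then have U: "open U" "x0 \<in> U" "smooth_on g U" "grad g x0 \<noteq> 0" "\<Omega> \<inter> U = {y \<in> U. g y < 0}"
      by (auto simp: defining_function_def)
    \<comment> \<open>At \<open>x0\<close> the derivative of \<open>g\<close> in the direction of
      its own gradient is \<open>2 * ?c\<close>; by continuity it stays above \<open>?c\<close>
      nearby.\<close>
    let ?e = "grad g x0" and ?c = "(grad g x0 \<bullet> grad g x0) / 2"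
    have c: "?c > 0" using U(4) by simp
    have "continuous_on U (\<lambda>y. grad g y \<bullet> ?e)"
      by (intro continuous_intros smooth_onD U)
    then have "open (U \<inter> (\<lambda>y. grad g y \<bullet> ?e) -` {?c<..})"
      using U(1) by (intro continuous_open_preimage) auto
    moreover have "x0 \<in> U \<inter> (\<lambda>y. grad g y \<bullet> ?e) -` {?c<..}"
      using U c by auto
    ultimately obtain r where r: "r > 0" "cball x0 r \<subseteq> U \<inter> (\<lambda>y. grad g y \<bullet> ?e) -` {?c<..}"
      using open_contains_cball by blast
    have "Q x0 r"
      unfolding Q_def
    proof (intro allI impI, elim conjE)
      fix w :: "real ^ 'n \<Rightarrow> real ^ 'n" and H :: "real ^ 'n \<Rightarrow> real ^ 'n ^ 'n"
      assume w: "\<forall>x\<in>closure \<Omega>. (w has_derivative (\<lambda>h. H x *v h)) (at x within closure \<Omega>)"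
        "continuous_on (closure \<Omega>) H" "\<forall>x\<in>closure \<Omega> - ball x0 r. w x = 0" "\<forall>x\<in>closure \<Omega> - ball x0 r. H x = 0"
        "\<forall>x\<in>frontier \<Omega>. \<forall>\<nu>. outer_normal \<Omega> x \<nu> \<longrightarrow> w x \<bullet> \<nu> = 0"
      show "(LINT x|lebesgue_on \<Omega>. trace (H x)) = 0"
      proof (rule integral_trace_boundary_patch[OF \<Omega> U(1) smooth_onD[OF U(3,1)] U(5) _ c])
        show "cball x0 r \<subseteq> U" using r by auto
        show "?c \<le> grad g y \<bullet> ?e" if "y \<in> cball x0 r" for y
          using r(2) that by auto
        show "w y \<bullet> grad g y = 0" if "y \<in> frontier \<Omega> \<inter> U" for y
        proof -
          have "grad g y \<noteq> 0" using df that by (auto simp: defining_function_def)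
          moreover have "w y \<bullet> (grad g y /\<^sub>R norm (grad g y)) = 0"
            using w(5) that defining_function_boundary[OF df \<Omega>(1), of y] by blast
          ultimately show ?thesis by simp
        qed
      qed (use w in auto)
    qed
    then show ?thesis using r by blast
  qed
  then obtain R where R: "\<And>x0. x0 \<in> closure \<Omega> \<Longrightarrow> R x0 > 0" "\<And>x0. x0 \<in> closure \<Omega> \<Longrightarrow> Q x0 (R x0)"
    by metis
  obtain X where X: "X \<subseteq> closure \<Omega>" "finite X" "closure \<Omega> \<subseteq> (\<Union>x\<in>X. ball x (R x))"
  proof (rule compactE_image[OF cl, of "closure \<Omega>" "\<lambda>x. ball x (R x)"])
    show "closure \<Omega> \<subseteq> (\<Union>x\<in>closure \<Omega>. ball x (R x))" using R(1) by force
  qed auto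
  let ?b = "\<lambda>x. bump x (R x)" and ?bg = "\<lambda>x. bump_grad x (R x)"
  define B where "B y = (\<Sum>x\<in>X. ?b x y)" for y
  define Bg where "Bg y = (\<Sum>x\<in>X. ?bg x y)" for y
  have Bpos: "B y > 0" if y: "y \<in> closure \<Omega>" for y
  proof -
    obtain x where x: "x \<in> X" "y \<in> ball x (R x)" using X(3) y by auto
    then show ?thesis
      unfolding B_def using bump_pos bump_nonneg X(2) by (intro sum_pos2[where i=x]) auto
  qed
  have dB: "(B has_derivative (\<lambda>h. Bg y \<bullet> h)) (at y within S)" for y S
    unfolding B_def[abs_def] Bg_def inner_sum_left by (intro has_derivative_sum has_derivative_bump)
  have cB: "continuous_on S B" "continuous_on S Bg" for S
    unfolding B_def[abs_def] Bg_def[abs_def] by (intro continuous_on_sum continuous_on_bump)+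
  \<comment> \<open>The denominator is positive on the closure of \<Omega> only, so
    \<open>f x\<close> is differentiated within that set.\<close>
  define f where "f x y = ?b x y / B y" for x y
  define fg where "fg x y = (1 / B y) *\<^sub>R ?bg x y - (?b x y / (B y)\<^sup>2) *\<^sub>R Bg y" for x y
  have df: "(f x has_derivative (\<lambda>h. fg x y \<bullet> h)) (at y within closure \<Omega>)" if "y \<in> closure \<Omega>" for x y
  proof -
    have "((\<lambda>y. ?b x y / B y) has_derivative (\<lambda>h. - ?b x y * (inverse (B y) * (Bg y \<bullet> h) * inverse (B y)) + (?bg x y \<bullet> h) / B y)) (at y within closure \<Omega>)"
      using Bpos[OF that] by (intro has_derivative_divide has_derivative_bump dB) auto
    moreover have "- ?b x y * (inverse (B y) * (Bg y \<bullet> h) * inverse (B y)) + (?bg x y \<bullet> h) / B y = fg x y \<bullet> h" for h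
      using Bpos[OF that] by (simp add: fg_def inner_diff_left power2_eq_square divide_inverse)
    ultimately show ?thesis by (simp add: f_def[abs_def])
  qed
  have cf: "continuous_on (closure \<Omega>) (f x)" "continuous_on (closure \<Omega>) (fg x)" for x
    unfolding f_def[abs_def] fg_def[abs_def]
    using Bpos by (auto intro!: continuous_intros continuous_on_bump cB simp: less_imp_neq[symmetric])
  have sf: "(\<Sum>x\<in>X. f x y) = 1" "(\<Sum>x\<in>X. fg x y) = 0" if "y \<in> closure \<Omega>" for y
    using Bpos[OF that]
    by (simp_all add: f_def fg_def sum_subtractf flip: sum_divide_distrib scaleR_sum_right scaleR_sum_left B_def Bg_def)
       (simp add: power2_eq_square)
  let ?H = "\<lambda>x y. f x y *\<^sub>R G y + outer_prod (v y) (fg x y)"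
  have cH: "continuous_on (closure \<Omega>) (?H x)" for x
    by (intro continuous_intros continuous_on_outer_prod cf cG cv)
  have loc: "(LINT y|lebesgue_on \<Omega>. trace (?H x y)) = 0" if x: "x \<in> X" for x
  proof -
    have Rx: "R x > 0" using R(1) X(1) x by auto
    have f0: "f x y = 0" "fg x y = 0" if "y \<notin> ball x (R x)" for y
      using bump_outside[OF Rx that] by (auto simp: f_def fg_def)
    have QR: "Q x (R x)" using R(2) X(1) x by auto
    have h1: "\<forall>y\<in>closure \<Omega>. ((\<lambda>y. f x y *\<^sub>R v y) has_derivative (\<lambda>h. ?H x y *v h)) (at y within closure \<Omega>)"
      using dv df by (intro ballI has_derivative_scaleR_matrix[OF _ refl]) auto
    have h2: "\<forall>y\<in>closure \<Omega> - ball x (R x). f x y *\<^sub>R v y = 0" using f0 by auto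
    have h3: "\<forall>y\<in>closure \<Omega> - ball x (R x). ?H x y = 0" using f0 by (auto simp: outer_prod_def vec_eq_iff)
    have h4: "\<forall>y\<in>frontier \<Omega>. \<forall>\<nu>. outer_normal \<Omega> y \<nu> \<longrightarrow> (f x y *\<^sub>R v y) \<bullet> \<nu> = 0"
      using tan by auto
    note q = QR[unfolded Q_def, THEN spec, of "\<lambda>y. f x y *\<^sub>R v y", THEN spec, of "?H x"]
    show ?thesis
      by (rule mp[OF q]) (intro conjI h1 cH h2 h3 h4)
  qed
  have iH: "integrable (lebesgue_on \<Omega>) (\<lambda>y. trace (?H x y))" for x
  proof -
    have ct: "continuous_on (closure \<Omega>) (\<lambda>y. trace (?H x y))"
      by (intro continuous_on_trace cH)
    obtain M where "\<forall>y\<in>closure \<Omega>. \<bar>trace (?H x y)\<bar> \<le> M"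
      using compact_imp_bounded[OF compact_continuous_image[OF ct cl]] by (auto simp: bounded_iff)
    then show ?thesis
      using \<Omega> closure_subset[of \<Omega>]
      by (intro integrable_lebesgue_on_continuous_bounded[where B=M] continuous_on_subset[OF ct])
        (auto simp: lmeasurable_open)
  qed
  have "(LINT y|lebesgue_on \<Omega>. trace (G y)) = (LINT y|lebesgue_on \<Omega>. (\<Sum>x\<in>X. trace (?H x y)))"
  proof (rule Bochner_Integration.integral_cong[OF refl])
    fix y assume "y \<in> space (lebesgue_on \<Omega>)"
    then have y: "y \<in> closure \<Omega>" using closure_subset by auto
    have "(\<Sum>x\<in>X. trace (?H x y)) = (\<Sum>x\<in>X. f x y) * trace (G y) + v y \<bullet> (\<Sum>x\<in>X. fg x y)"
      by (simp add: trace_scaleR_add trace_outer_prod sum.distrib inner_sum_right sum_distrib_right)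
    then show "trace (G y) = (\<Sum>x\<in>X. trace (?H x y))" using sf[OF y] by simp
  qed
  also have "\<dots> = (\<Sum>x\<in>X. LINT y|lebesgue_on \<Omega>. trace (?H x y))"
    using iH by (rule Bochner_Integration.integral_sum)
  finally show ?thesis using loc by simp
qed

section \<open>Convexity of the energy\<close>

text \<open>At \<open>r = 0\<close> this is \<open>0\<close>, by division by zero and \<open>0 powr \<gamma> = 0\<close>; the energy of the model is there
  \<open>0\<close> or infinite.\<close>

definition energy_fun :: "real \<Rightarrow> real \<Rightarrow> real ^ 'n \<Rightarrow> real \<Rightarrow> real"
  where "energy_fun \<gamma> r m s = (norm m)\<^sup>2 / (2 * r) + cv \<gamma> * (r powr \<gamma> * exp (s / (cv \<gamma> * r)))"

text \<open>The first-order Taylor polynomial of the internal energy at \<open>(r0, \<sigma>)\<close>.\<close>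

definition tangent_energy :: "real \<Rightarrow> real \<Rightarrow> real \<Rightarrow> real \<Rightarrow> real \<Rightarrow> real"
  where "tangent_energy \<gamma> r0 \<sigma> r s =
    cv \<gamma> * r0 powr \<gamma> * exp (\<sigma> / (cv \<gamma> * r0)) * (1 - \<gamma> + \<gamma> * r / r0 + (\<gamma> - 1) * (s / r0 - \<sigma> * r / r0\<^sup>2))"

lemma cv_pos: "\<gamma> > 1 \<Longrightarrow> cv \<gamma> > 0"
  by (simp add: cv_def)

lemma divide_cv: "s / (cv \<gamma> * r) = (\<gamma> - 1) * (s / r)"
  by (simp add: cv_def)

lemma energy_fun_nonneg: "\<gamma> > 1 \<Longrightarrow> r \<ge> 0 \<Longrightarrow> energy_fun \<gamma> r m s \<ge> 0"
  unfolding energy_fun_def using cv_pos[of \<gamma>] by (intro add_nonneg_nonneg mult_nonneg_nonneg) auto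

lemma energy_fun_vacuum [simp]: "energy_fun \<gamma> 0 m s = 0"
  by (simp add: energy_fun_def)

text \<open>Both parts come from \<open>ln y \<le> y - 1\<close> and its equality case, taken at
  \<open>y = 1 / x\<close>.\<close>

lemma le_mult_ln:
  fixes x :: real
  assumes "x > 0"
  shows "x - 1 \<le> x * ln x" and "x - 1 = x * ln x \<Longrightarrow> x = 1"
proof -
  have "ln (1 / x) \<le> 1 / x - 1" using assms by (intro ln_le_minus_one) auto
  then have "x * (1 - 1 / x) \<le> x * ln x" using assms by (intro mult_left_mono) (auto simp: ln_div)
  then show "x - 1 \<le> x * ln x" using assms by (simp add: right_diff_distrib)
  assume "x - 1 = x * ln x"
  then have "ln x = 1 - 1 / x" using assms by (simp add: field_simps)
  then have "ln (1 / x) = 1 / x - 1" using assms by (simp add: ln_div)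
  then have "1 / x = 1" using assms by (intro ln_eq_minus_one) auto
  then show "x = 1" by simp
qed

lemma exp_eq_add_one:
  fixes x :: real
  assumes "exp x = 1 + x"
  shows "x = 0"
proof -
  have "exp x - 1 = x" using assms by simp
  then have "ln (exp x) = exp x - 1" by (simp only: ln_exp)
  then have "exp x = 1" by (intro ln_eq_minus_one) auto
  then show ?thesis by simp
qed

text \<open>Up to the positive factor \<open>P\<close>, the gap between energy and tangent plane is
  \<open>x * (exp z - (1 + z)) + (\<gamma> - 1) * (x * ln x - (x - 1))\<close> with the
  \<open>x\<close> and \<open>z\<close> of the proof. Both summands are nonnegative, and they vanish
  together only for \<open>z = 0\<close> and \<open>x = 1\<close>.\<close>

lemma internal_energy_ge_tangent:
  assumes "\<gamma> > 1" "r0 > 0" "r > 0"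
  shows "tangent_energy \<gamma> r0 \<sigma> r s \<le> cv \<gamma> * (r powr \<gamma> * exp (s / (cv \<gamma> * r)))" 
    and "tangent_energy \<gamma> r0 \<sigma> r s = cv \<gamma> * (r powr \<gamma> * exp (s / (cv \<gamma> * r))) \<Longrightarrow> r = r0 \<and> s = \<sigma>"
proof -
  let ?T = "tangent_energy \<gamma> r0 \<sigma> r s" and ?E = "cv \<gamma> * (r powr \<gamma> * exp (s / (cv \<gamma> * r)))"
  define P where "P = cv \<gamma> * r0 powr \<gamma> * exp (\<sigma> / (cv \<gamma> * r0))"
  define x where "x = r / r0"
  define y where "y = (\<gamma> - 1) * (s / r - \<sigma> / r0)"
  \<comment> \<open>\<open>exp z\<close> is the quotient of the temperatures
    \<open>r powr (\<gamma> - 1) * exp (s / (cv \<gamma> * r))\<close> of the two states.\<close>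
  define z where "z = (\<gamma> - 1) * ln x + y"
  have P: "P > 0" using cv_pos[of \<gamma>] assms by (simp add: P_def)
  have x: "x > 0" using assms by (simp add: x_def)
  have rx: "r = x * r0" using assms by (simp add: x_def)
  have E: "?E = P * (x * exp z)"
  proof -
    have "exp z * x = exp (\<gamma> * ln x + y)"
    proof -
      have "exp z * x = exp z * exp (ln x)" using x by simp
      then show ?thesis by (simp only: z_def flip: exp_add) (simp add: algebra_simps)
    qed
    also have "\<dots> = x powr \<gamma> * exp y" using x by (simp add: exp_add powr_def)
    finally have *: "x * exp z = x powr \<gamma> * exp y" by (simp add: mult.commute)
    have "exp (s / (cv \<gamma> * r)) = exp (\<sigma> / (cv \<gamma> * r0)) * exp y"
      unfolding divide_cv y_def by (simp add: right_diff_distrib flip: exp_add)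
    moreover have "r powr \<gamma> = x powr \<gamma> * r0 powr \<gamma>"
      using x assms by (subst rx) (simp add: powr_mult)
    ultimately show ?thesis by (simp add: P_def *)
  qed
  have T: "?T = P * (1 - \<gamma> + \<gamma> * x + x * y)"
  proof -
    have "x * y = (\<gamma> - 1) * (s / r0 - \<sigma> * r / r0\<^sup>2)"
      using assms by (simp add: x_def y_def field_simps power2_eq_square)
    then show ?thesis by (simp add: tangent_energy_def P_def x_def)
  qed
  have d: "x * exp z - (1 - \<gamma> + \<gamma> * x + x * y) = x * (exp z - (1 + z)) + (\<gamma> - 1) * (x * ln x - (x - 1))"
    by (simp add: z_def algebra_simps)
  have d1: "0 \<le> x * (exp z - (1 + z))"
    using x exp_ge_add_one_self[of z] by (intro mult_nonneg_nonneg) auto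
  have d2: "0 \<le> (\<gamma> - 1) * (x * ln x - (x - 1))"
    using assms le_mult_ln(1)[OF x] by (intro mult_nonneg_nonneg) auto
  show "?T \<le> ?E"
    unfolding E T using P d d1 d2 by (intro mult_left_mono) auto
  assume "?T = ?E"
  then have "1 - \<gamma> + \<gamma> * x + x * y = x * exp z" unfolding E T using P by simp
  then have "x * (exp z - (1 + z)) = 0" "(\<gamma> - 1) * (x * ln x - (x - 1)) = 0"
    using d d1 d2 by linarith+
  then have "exp z = 1 + z" "x - 1 = x * ln x" using x assms by auto
  then have "z = 0" "x = 1" using exp_eq_add_one le_mult_ln(2)[OF x] by auto
  then have "y = 0" "r = r0" using assms by (auto simp: z_def x_def)
  then show "r = r0 \<and> s = \<sigma>" using assms by (auto simp: y_def)
qed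

text \<open>The constant term \<open>1 - \<gamma>\<close> is negative and the entropy slope is
  positive. This keeps admissible vacuum states out of the equality case.\<close>

lemma tangent_energy_vacuum_neg:
  assumes "\<gamma> > 1" "r0 > 0" "s \<le> 0"
  shows "tangent_energy \<gamma> r0 \<sigma> 0 s < 0"
proof -
  have "(\<gamma> - 1) * (s / r0) \<le> 0" using assms by (intro mult_nonneg_nonpos) (auto simp: field_simps)
  then have "1 - \<gamma> + (\<gamma> - 1) * (s / r0) < 0" using assms by linarith
  then show ?thesis
    unfolding tangent_energy_def using assms cv_pos[of \<gamma>] by (simp add: mult_pos_neg)
qed

text \<open>Kinetic energy only widens the gap, strictly so for nonzero momentum at positive
  density. At vacuum the energy is 0, strictly above the negative tangent plane.\<close>

lemma energy_fun_ge_tangent: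
  assumes "\<gamma> > 1" "r0 > 0" "r \<ge> 0" "r = 0 \<Longrightarrow> s \<le> 0"
  shows "tangent_energy \<gamma> r0 \<sigma> r s \<le> energy_fun \<gamma> r m s"
    and "tangent_energy \<gamma> r0 \<sigma> r s = energy_fun \<gamma> r m s \<Longrightarrow> r = r0 \<and> m = 0 \<and> s = \<sigma>"
proof -
  have "tangent_energy \<gamma> r0 \<sigma> r s \<le> energy_fun \<gamma> r m s \<and>
    (tangent_energy \<gamma> r0 \<sigma> r s = energy_fun \<gamma> r m s \<longrightarrow> r = r0 \<and> m = 0 \<and> s = \<sigma>)"
  proof (cases "r = 0")
    case True
    then show ?thesis using tangent_energy_vacuum_neg[of \<gamma> r0 s \<sigma>] assms by auto
  next
    case False
    then have r: "r > 0" using assms by simp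
    have k: "(norm m)\<^sup>2 / (2 * r) \<ge> 0" using r by simp
    note * = internal_energy_ge_tangent[OF assms(1,2) r, of \<sigma> s]
    have "m = 0 \<and> r = r0 \<and> s = \<sigma>" if "tangent_energy \<gamma> r0 \<sigma> r s = energy_fun \<gamma> r m s"
    proof -
      have "(norm m)\<^sup>2 / (2 * r) = 0" using that k *(1) unfolding energy_fun_def by linarith
      then show ?thesis using that *(2) r by (simp add: energy_fun_def)
    qed
    then show ?thesis using * k by (auto simp: energy_fun_def)
  qed
  then show "tangent_energy \<gamma> r0 \<sigma> r s \<le> energy_fun \<gamma> r m s"
    and "tangent_energy \<gamma> r0 \<sigma> r s = energy_fun \<gamma> r m s \<Longrightarrow> r = r0 \<and> m = 0 \<and> s = \<sigma>"
    by auto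
qed

text \<open>The added linear term is the tangent of the kinetic energy at \<open>(r0, m0)\<close>;
  at positive density it lies below the kinetic energy by
  \<open>(norm (m - (r / r0) *\<^sub>R m0))\<^sup>2 / (2 * r)\<close>.\<close>

lemma energy_fun_ge_tangent_momentum:
  fixes m m0 :: "real ^ 'n"
  assumes "\<gamma> > 1" "r0 > 0" "r \<ge> 0" "r = 0 \<Longrightarrow> m = 0 \<and> s \<le> 0"
  shows "tangent_energy \<gamma> r0 \<sigma> r s + (m0 \<bullet> m / r0 - (norm m0)\<^sup>2 * r / (2 * r0\<^sup>2)) \<le> energy_fun \<gamma> r m s"
proof (cases "r = 0")
  case True
  then show ?thesis using energy_fun_ge_tangent(1)[of \<gamma> r0 r s \<sigma> m] assms by simp
next
  case False
  then have r: "r > 0" using assms by simp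
  have "0 \<le> (norm (m - (r / r0) *\<^sub>R m0))\<^sup>2" by simp
  also have "\<dots> = (norm m)\<^sup>2 - 2 * (r / r0) * (m0 \<bullet> m) + (r / r0)\<^sup>2 * (norm m0)\<^sup>2"
    by (simp only: power2_norm_eq_inner)
      (simp add: inner_diff_left inner_diff_right inner_commute power2_eq_square algebra_simps)
  finally have "0 \<le> ((norm m)\<^sup>2 - 2 * (r / r0) * (m0 \<bullet> m) + (r / r0)\<^sup>2 * (norm m0)\<^sup>2) / (2 * r)"
    using r by (intro divide_nonneg_pos) auto
  also have "\<dots> = (norm m)\<^sup>2 / (2 * r) - (m0 \<bullet> m / r0 - (norm m0)\<^sup>2 * r / (2 * r0\<^sup>2))"
    using r assms(2) by (simp add: field_simps power2_eq_square)
  finally show ?thesis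
    using internal_energy_ge_tangent(1)[OF assms(1,2) r, of \<sigma> s] by (simp add: energy_fun_def)
qed

section \<open>States of finite energy and Jensen's inequality on the phase space\<close>

lemma energy_integrand_eq:
  assumes "\<gamma> > 1" "r \<ge> 0"
  shows "kinetic r m + ennreal (cv \<gamma>) * pressure \<gamma> r s < \<infinity> \<Longrightarrow>
      (r = 0 \<longrightarrow> m = 0 \<and> s \<le> 0) \<and> kinetic r m + ennreal (cv \<gamma>) * pressure \<gamma> r s = ennreal (energy_fun \<gamma> r m s)"
  using assms cv_pos[OF assms(1)]
  by (auto simp: kinetic_def pressure_def energy_fun_def ennreal_mult_top split: if_splits
      simp flip: ennreal_plus ennreal_mult)

lemma borel_measurable_state:
  "(\<lambda>(r, m, s). r) \<in> borel_measurable (borel :: (real \<times> (real ^ 'n) \<times> real) measure)"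
  "(\<lambda>(r, m, s). m) \<in> borel_measurable (borel :: (real \<times> (real ^ 'n) \<times> real) measure)"
  "(\<lambda>(r, m, s). s) \<in> borel_measurable (borel :: (real \<times> (real ^ 'n) \<times> real) measure)"
  by (simp_all flip: borel_prod)

lemma borel_measurable_energy_integrand:
  "(\<lambda>(r, m, s). kinetic r m + ennreal (cv \<gamma>) * pressure \<gamma> r s)
    \<in> borel_measurable (borel :: (real \<times> (real ^ 'n) \<times> real) measure)"
  unfolding kinetic_def pressure_def by (simp flip: borel_prod)

text \<open>The supporting hyperplane at the mean is integrated against \<mu>. For this the three
  coordinates must be integrable: the density because the entropy bound keeps the internal energy
  above a multiple of it, the momentum by the inequality of arithmetic and geometric means, the
  entropy by a tangent plane from above and by \<open>s0 * r\<close> from below.\<close>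

lemma jensen_energy:
  fixes \<gamma> s0 :: real and \<mu> :: "(real \<times> (real ^ 'n) \<times> real) measure"
  assumes \<gamma>: "\<gamma> > 1" and prob: "prob_space \<mu>" and sets: "sets \<mu> = sets (restrict_space borel phase_space)"
    and fin: "mean_energy \<gamma> \<mu> < \<infinity>" and ent: "AE (r, m, s) in \<mu>. s0 * r \<le> s"
  shows "mean_density \<mu> \<ge> 0"
    and "mean_density \<mu> = 0 \<Longrightarrow> mean_entropy \<mu> \<le> 0"
    and "s0 * mean_density \<mu> \<le> mean_entropy \<mu>"
    and "ennreal (energy_fun \<gamma> (mean_density \<mu>) (mean_momentum \<mu>) (mean_entropy \<mu>)) \<le> mean_energy \<gamma> \<mu>"
proof -
  interpret prob_space \<mu> by (rule prob)
  have meas: "f \<in> borel_measurable \<mu>" if "f \<in> borel_measurable borel"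
    for f :: "real \<times> (real ^ 'n) \<times> real \<Rightarrow> 'b::topological_space"
    using measurable_restrict_space1[OF that] measurable_cong_sets[OF sets refl] by blast
  note m [measurable] = borel_measurable_state[THEN meas] borel_measurable_energy_integrand[THEN meas]
  have sp: "space \<mu> = phase_space" using sets_eq_imp_space_eq[OF sets] by (simp add: space_restrict_space)
  let ?g = "\<lambda>(r, m, s). kinetic r m + ennreal (cv \<gamma>) * pressure \<gamma> r s"
  let ?e = "\<lambda>(r, m, s). energy_fun \<gamma> r m s"
  have em: "?e \<in> borel_measurable (borel :: (real \<times> (real ^ 'n) \<times> real) measure)"
    unfolding energy_fun_def by (simp flip: borel_prod)
  note em [THEN meas, measurable]
  have fin': "integral\<^sup>N \<mu> ?g < \<infinity>" using fin by (simp add: mean_energy_def)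
  have "AE z in \<mu>. ?g z \<noteq> \<infinity>"
    using fin' by (intro nn_integral_PInf_AE) auto
  moreover have "AE z in \<mu>. z \<in> phase_space" using AE_space[of \<mu>] by (simp add: sp)
  ultimately have good: "AE (r, m, s) in \<mu>. r \<ge> 0 \<and> (r = 0 \<longrightarrow> m = 0 \<and> s \<le> 0) \<and> s0 * r \<le> s \<and>
      kinetic r m + ennreal (cv \<gamma>) * pressure \<gamma> r s = ennreal (energy_fun \<gamma> r m s)"
    using ent
  proof eventually_elim
    case (elim z)
    obtain r m s where z: "z = (r, m, s)" by (cases z)
    have "r \<ge> 0" using elim by (simp add: z phase_space_def)
    then show ?case using elim energy_integrand_eq[OF \<gamma>, of r m s] by (auto simp: z less_top)
  qed
  have eq: "mean_energy \<gamma> \<mu> = (\<integral>\<^sup>+z. ennreal (?e z) \<partial>\<mu>)"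
    unfolding mean_energy_def using good by (intro nn_integral_cong_AE) auto
  have e0: "AE z in \<mu>. 0 \<le> ?e z"
    using good by eventually_elim (auto simp: energy_fun_nonneg \<gamma>)
  have ie: "integrable \<mu> ?e"
    using e0 fin eq by (intro integrableI_nonneg) auto
  have me: "mean_energy \<gamma> \<mu> = ennreal (LINT z|\<mu>. ?e z)"
    unfolding eq using ie e0 by (rule nn_integral_eq_integral)
  \<comment> \<open>From \<open>s0 * r \<le> s\<close> the internal energy is at least
    \<open>k * r powr \<gamma>\<close>, hence at least \<open>k * r\<close> once
    \<open>r > 1\<close>.\<close>
  define k where "k = cv \<gamma> * exp ((\<gamma> - 1) * s0)"
  have k: "k > 0" using cv_pos[OF \<gamma>] by (simp add: k_def)
  have rb: "r \<le> 1 + energy_fun \<gamma> r m s / k" if "r \<ge> 0" "s0 * r \<le> s" for r s and m :: "real ^ 'n"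
  proof (cases "r \<le> 1")
    case True
    then show ?thesis using energy_fun_nonneg[OF \<gamma> that(1), of m s] k by (simp add: add_increasing2)
  next
    case False
    then have r: "r > 1" by simp
    have "r = r powr 1" using r by simp
    also have "\<dots> \<le> r powr \<gamma>" using r \<gamma> by (intro powr_mono) auto
    finally have a: "r \<le> r powr \<gamma>" .
    have "s0 \<le> s / r" using that r by (simp add: field_simps)
    then have "(\<gamma> - 1) * s0 \<le> (\<gamma> - 1) * (s / r)" using \<gamma> by (intro mult_left_mono) auto
    then have "exp ((\<gamma> - 1) * s0) \<le> exp ((\<gamma> - 1) * (s / r))" by (simp only: exp_le_cancel_iff)
    then have "cv \<gamma> * (r * exp ((\<gamma> - 1) * s0)) \<le> cv \<gamma> * (r powr \<gamma> * exp ((\<gamma> - 1) * (s / r)))"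
      using a r cv_pos[OF \<gamma>] by (intro mult_left_mono mult_mono) auto
    then have "k * r \<le> cv \<gamma> * (r powr \<gamma> * exp (s / (cv \<gamma> * r)))"
      unfolding k_def divide_cv by (simp only: mult_ac)
    then have "k * r \<le> energy_fun \<gamma> r m s"
      using r by (simp add: energy_fun_def add_increasing)
    then show ?thesis using k by (simp add: field_simps)
  qed
  have ir: "integrable \<mu> (\<lambda>(r, m, s). r)"
  proof (rule Bochner_Integration.integrable_bound)
    show "integrable \<mu> (\<lambda>z. 1 + ?e z / k)" using ie by simp
    show "AE z in \<mu>. norm (case z of (r, m, s) \<Rightarrow> r) \<le> norm (1 + ?e z / k)"
      using good
    proof eventually_elim
      case (elim z)
      then show ?case using rb by (cases z) (force intro: order_trans[OF _ abs_ge_self])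
    qed
  qed auto
  have im: "integrable \<mu> (\<lambda>(r, m, s). m)"
  proof (rule Bochner_Integration.integrable_bound)
    show "integrable \<mu> (\<lambda>z. ?e z + (case z of (r, m, s) \<Rightarrow> r))"
      using ie ir by (rule Bochner_Integration.integrable_add)
    show "AE z in \<mu>. norm (case z of (r, m, s) \<Rightarrow> m) \<le> norm (?e z + (case z of (r, m, s) \<Rightarrow> r))"
      using good
    proof eventually_elim
      case (elim z)
      obtain r m s where z: "z = (r, m, s)" by (cases z)
      have "norm m \<le> energy_fun \<gamma> r m s + r"
      proof (cases "r = 0")
        case False
        then have r: "r > 0" using elim by (simp add: z)
        have "0 \<le> (norm m - r)\<^sup>2 / (2 * r)" using r by simp
        also have "\<dots> = (norm m)\<^sup>2 / (2 * r) + r / 2 - norm m"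
          using r by (simp add: field_simps power2_eq_square)
        finally have "norm m \<le> (norm m)\<^sup>2 / (2 * r) + r" using r by simp
        moreover have "0 \<le> cv \<gamma> * (r powr \<gamma> * exp (s / (cv \<gamma> * r)))" using cv_pos[OF \<gamma>] by simp
        ultimately show ?thesis by (simp add: energy_fun_def)
      qed (use elim in \<open>auto simp: z\<close>)
      then show ?case by (simp add: z)
    qed
  qed auto
  have iS: "integrable \<mu> (\<lambda>(r, m, s). s)"
  proof (rule Bochner_Integration.integrable_bound)
    show "integrable \<mu> (\<lambda>z. (?e z + 1) + \<bar>s0\<bar> * (case z of (r, m, s) \<Rightarrow> r))"
      by (intro Bochner_Integration.integrable_add integrable_mult_right ie ir) simp
    show "AE z in \<mu>. norm (case z of (r, m, s) \<Rightarrow> s) \<le> norm ((?e z + 1) + \<bar>s0\<bar> * (case z of (r, m, s) \<Rightarrow> r))"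
      using good
    proof eventually_elim
      case (elim z)
      obtain r m s where z: "z = (r, m, s)" by (cases z)
      have r: "r \<ge> 0" using elim by (simp add: z)
      \<comment> \<open>At the reference state with density 1 and entropy 0 the tangent plane has
        slope 1 in \<open>s\<close>, which bounds \<open>s\<close> from above by the energy.\<close>
      have "tangent_energy \<gamma> 1 0 r s \<le> energy_fun \<gamma> r m s"
        using elim \<gamma> by (intro energy_fun_ge_tangent) (auto simp: z)
      moreover have "tangent_energy \<gamma> 1 0 r s = s - 1 + cv \<gamma> * \<gamma> * r"
        using \<gamma> by (simp add: tangent_energy_def cv_def field_simps)
      moreover have "0 \<le> cv \<gamma> * \<gamma> * r" using r \<gamma> cv_pos[OF \<gamma>] by simp
      ultimately have "s \<le> energy_fun \<gamma> r m s + 1" by linarith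
      moreover have "- \<bar>s0\<bar> * r \<le> s0 * r" using r by (intro mult_right_mono) auto
      then have "- (\<bar>s0\<bar> * r) \<le> s0 * r" by simp
      moreover have "s0 * r \<le> s" "0 \<le> energy_fun \<gamma> r m s" "0 \<le> \<bar>s0\<bar> * r"
        using elim energy_fun_nonneg[OF \<gamma> r] r by (auto simp: z)
      ultimately show ?case by (simp add: z)
    qed
  qed auto
  have proj: "(\<lambda>(r, m, s). r) = (fst :: real \<times> (real ^ 'n) \<times> real \<Rightarrow> real)"
    "(\<lambda>(r, m, s). m) = (\<lambda>z :: real \<times> (real ^ 'n) \<times> real. fst (snd z))"
    "(\<lambda>(r, m, s). s) = (\<lambda>z :: real \<times> (real ^ 'n) \<times> real. snd (snd z))"
    by auto
  note int = ir[unfolded proj] im[unfolded proj] iS[unfolded proj]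
  have mean: "mean_density \<mu> = (LINT z|\<mu>. fst z)" "mean_momentum \<mu> = (LINT z|\<mu>. fst (snd z))"
    "mean_entropy \<mu> = (LINT z|\<mu>. snd (snd z))"
    by (simp_all only: mean_density_def mean_momentum_def mean_entropy_def proj)
  show rho0: "mean_density \<mu> \<ge> 0"
    unfolding mean_density_def using good by (intro integral_nonneg_AE) auto
  show "mean_entropy \<mu> \<le> 0" if "mean_density \<mu> = 0"
  proof -
    have "AE z in \<mu>. (case z of (r, m, s) \<Rightarrow> r) = 0"
      using that ir good unfolding mean_density_def
      by (subst (asm) integral_nonneg_eq_0_iff_AE) auto
    then have "AE z in \<mu>. (case z of (r, m, s) \<Rightarrow> s) \<le> 0"
      using good by eventually_elim auto
    then have "AE z in \<mu>. 0 \<le> - (case z of (r, m, s) \<Rightarrow> s)" by simp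
    then have "0 \<le> (LINT z|\<mu>. - (case z of (r, m, s) \<Rightarrow> s))" by (rule integral_nonneg_AE)
    then show ?thesis by (simp add: mean_entropy_def)
  qed
  show "s0 * mean_density \<mu> \<le> mean_entropy \<mu>"
  proof -
    have "(LINT z|\<mu>. s0 * fst z) \<le> (LINT z|\<mu>. snd (snd z))"
      using good by (intro integral_mono_AE integrable_mult_right int) auto
    then show ?thesis by (simp add: mean)
  qed
  show "ennreal (energy_fun \<gamma> (mean_density \<mu>) (mean_momentum \<mu>) (mean_entropy \<mu>)) \<le> mean_energy \<gamma> \<mu>"
  \<comment> \<open>At mean density 0 the left-hand side has the default value 0. The hyperplane
    serves for positive mean density.\<close>
  proof (cases "mean_density \<mu> = 0")
    case False
    let ?R = "mean_density \<mu>" and ?M = "mean_momentum \<mu>" and ?S = "mean_entropy \<mu>"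
    have R: "?R > 0" using False rho0 by simp
    define P where "P = cv \<gamma> * ?R powr \<gamma> * exp (?S / (cv \<gamma> * ?R))"
    let ?a = "\<lambda>z. P * (1 - \<gamma> + \<gamma> * fst z / ?R +
        (\<gamma> - 1) * (snd (snd z) / ?R - ?S * fst z / ?R\<^sup>2)) +
        (?M \<bullet> fst (snd z) / ?R - (norm ?M)\<^sup>2 * fst z / (2 * ?R\<^sup>2))"
    have "(LINT z|\<mu>. ?a z) \<le> (LINT z|\<mu>. ?e z)"
    proof (intro integral_mono_AE ie)
      show "integrable \<mu> ?a"
        by (intro Bochner_Integration.integrable_add Bochner_Integration.integrable_diff integrable_mult_right
            integrable_divide integrable_inner_right int) simp_all
      show "AE z in \<mu>. ?a z \<le> ?e z"
        using good
      proof eventually_elim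
        case (elim z)
        then show ?case
          using energy_fun_ge_tangent_momentum[OF \<gamma> R, of "fst z" "fst (snd z)" "snd (snd z)" ?S ?M]
          by (cases z) (simp add: tangent_energy_def P_def)
      qed
    qed
    moreover have "(LINT z|\<mu>. ?a z) = P * (1 - \<gamma> + \<gamma> * ?R / ?R + (\<gamma> - 1) * (?S / ?R - ?S * ?R / ?R\<^sup>2)) +
        (?M \<bullet> ?M / ?R - (norm ?M)\<^sup>2 * ?R / (2 * ?R\<^sup>2))"
      unfolding mean[symmetric] using int by (simp add: prob_space flip: mean)
    moreover have "\<dots> = energy_fun \<gamma> ?R ?M ?S"
      using R by (simp add: energy_fun_def P_def flip: power2_norm_eq_inner)
        (simp add: field_simps power2_eq_square)
    ultimately show ?thesis unfolding me by (intro ennreal_leI) simp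
  qed simp
qed

section \<open>Averages of Young measures\<close>

lemma borel_measurable_lebesgue_on_borel:
  assumes "f \<in> borel_measurable (restrict_space borel S)"
  shows "f \<in> borel_measurable (lebesgue_on S)"
proof -
  have "(\<lambda>x. x) \<in> lebesgue_on S \<rightarrow>\<^sub>M restrict_space borel S"
    using id_borel_measurable_lebesgue_on[of S] by (intro measurable_restrict_space2) (auto simp: id_def)
  from measurable_compose[OF this assms] show ?thesis .
qed

text \<open>Off a closed set the distance to it is positive, so the first factor is eventually 0
  there. The second factor vanishes where \<open>norm z \<ge> real n\<close>, so that every member
  of the sequence has bounded support.\<close>

lemma closed_indicator_approx:
  fixes C :: "'a::euclidean_space set" and z :: 'a
  assumes "closed C" "C \<noteq> {}"
  shows "(\<lambda>n. max 0 (1 - real n * infdist z C) * max 0 (min 1 (real n - norm z))) \<longlonglongrightarrow> indicator C z"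
proof (cases "z \<in> C")
  case True
  have "eventually (\<lambda>n. max 0 (1 - real n * infdist z C) * max 0 (min 1 (real n - norm z)) = 1) sequentially"
    unfolding eventually_sequentially
  proof (intro exI allI impI)
    fix n assume "nat \<lceil>norm z + 1\<rceil> \<le> n"
    then have "norm z + 1 \<le> real n" by linarith
    then show "max 0 (1 - real n * infdist z C) * max 0 (min 1 (real n - norm z)) = 1"
      using True by simp
  qed
  then show ?thesis using True by (intro tendsto_eventually) simp
next
  case False
  then have d: "infdist z C > 0"
    using assms in_closed_iff_infdist_zero[of C z] infdist_nonneg[of z C] by linarith
  have "eventually (\<lambda>n. max 0 (1 - real n * infdist z C) * max 0 (min 1 (real n - norm z)) = 0) sequentially"
    unfolding eventually_sequentially
  proof (intro exI allI impI)
    fix n assume "nat \<lceil>1 / infdist z C\<rceil> \<le> n"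
    then have "1 / infdist z C \<le> real n" by linarith
    then have "1 \<le> real n * infdist z C" using d by (simp add: field_simps)
    then show "max 0 (1 - real n * infdist z C) * max 0 (min 1 (real n - norm z)) = 0"
      by simp
  qed
  then show ?thesis using False by (intro tendsto_eventually) simp
qed

text \<open>Young measures are tested with functions vanishing at infinity only. The indicator of a closed set
  is a bounded limit of such functions, and closed sets generate the Borel sets.\<close>

lemma measurable_nn_integral_young_measure:
  fixes V :: "real \<Rightarrow> real ^ 'n \<Rightarrow> (real \<times> (real ^ 'n) \<times> real) measure"
  assumes V: "young_measure \<Omega> V" and t: "t > 0" and g: "g \<in> borel_measurable borel"
  shows "(\<lambda>x. integral\<^sup>N (V t x) g) \<in> borel_measurable (restrict_space borel \<Omega>)"
proof -
  let ?M = "restrict_space borel \<Omega> :: (real ^ 'n) measure"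
  let ?P = "phase_space :: (real \<times> (real ^ 'n) \<times> real) set"
  have pv: "prob_space (V t x)" "sets (V t x) = sets (restrict_space borel ?P)" if "x \<in> \<Omega>" for x
    using V t that by (auto simp: young_measure_def)
  have meas: "f \<in> borel_measurable (V t x)" if "f \<in> borel_measurable borel" "x \<in> \<Omega>"
    for f :: "real \<times> (real ^ 'n) \<times> real \<Rightarrow> 'b::topological_space" and x
    using measurable_restrict_space1[OF that(1)] measurable_cong_sets[OF pv(2)[OF that(2)] refl] by blast
  have C0: "(\<lambda>x. integral\<^sup>L (V t x) f) \<in> borel_measurable ?M"
    if f: "continuous_on ?P f" "(f \<longlongrightarrow> 0) (inf at_infinity (principal ?P))" for f :: "real \<times> (real ^ 'n) \<times> real \<Rightarrow> real"
  proof -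
    have "(\<lambda>(t, x). integral\<^sup>L (V t x) f) \<in> borel_measurable (restrict_space borel ({0<..} \<times> \<Omega>))"
      using V[unfolded young_measure_def, THEN conjunct2, THEN spec, of f] f by simp
    then have 1: "(\<lambda>z. integral\<^sup>L (V (fst z) (snd z)) f) \<in> borel_measurable (restrict_space borel ({0<..} \<times> \<Omega>))"
      by (simp add: case_prod_beta')
    have "(\<lambda>x. (t, x)) \<in> ?M \<rightarrow>\<^sub>M restrict_space borel ({0<..} \<times> \<Omega>)"
      using t by (intro measurable_restrict_space2 measurable_restrict_space1)
        (auto simp: space_restrict_space intro!: borel_measurable_continuous_onI continuous_intros)
    from measurable_compose[OF this 1] show ?thesis by simp
  qed
  \<comment> \<open>The measures live on the trace of the Borel sets on the phase space. Pushing
    them forward to the full Borel algebra turns the family into a kernel, for which measurability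
    of integrals is known.\<close>
  define K where "K x = distr (V t x) borel (\<lambda>z. z)" for x
  have idm: "(\<lambda>z. z) \<in> V t x \<rightarrow>\<^sub>M borel" if "x \<in> \<Omega>" for x
    using that by (intro meas) auto
  have pK: "prob_space (K x)" if "x \<in> \<Omega>" for x
    unfolding K_def using prob_space.prob_space_distr[OF pv(1) idm] that by blast
  have "K \<in> ?M \<rightarrow>\<^sub>M subprob_algebra borel"
  proof (rule measurable_subprob_algebra_generated[where G="{C. closed C}" and \<Omega>=UNIV])
    show "sets borel = sigma_sets UNIV {C :: (real \<times> (real ^ 'n) \<times> real) set. closed C}"
      by (subst borel_eq_closed) simp
    show "Int_stable {C :: (real \<times> (real ^ 'n) \<times> real) set. closed C}"
      by (auto simp: Int_stable_def)
    show "subprob_space (K a)" if "a \<in> space ?M" for a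
      using that pK by (auto simp: space_restrict_space intro: prob_space_imp_subprob_space)
    show "sets (K a) = sets borel" for a by (simp add: K_def)
    show *: "(\<lambda>a. emeasure (K a) C) \<in> borel_measurable ?M" if "C \<in> {C. closed C}" for C
    proof (cases "C = {}")
      case False
      let ?f = "\<lambda>n z. max 0 (1 - real n * infdist z C) * max 0 (min 1 (real n - norm z))"
      have cf: "continuous_on S (?f n)" for S n
        by (intro continuous_intros)
      have bf: "norm (?f n z) \<le> 1" for n z
      proof -
        have "\<bar>max 0 (1 - real n * infdist z C)\<bar> * \<bar>max 0 (min 1 (real n - norm z))\<bar> \<le> 1 * 1"
          by (intro mult_mono) (auto simp: infdist_nonneg)
        then show ?thesis by (simp add: abs_mult)
      qed
      have "(\<lambda>x. integral\<^sup>L (V t x) (indicat_real C)) \<in> borel_measurable ?M"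
      proof (rule borel_measurable_LIMSEQ_real)
        show "(\<lambda>x. integral\<^sup>L (V t x) (?f n)) \<in> borel_measurable ?M" for n
        proof (rule C0[OF cf])
          have "eventually (\<lambda>z. ?f n z = 0) at_infinity"
            unfolding eventually_at_infinity by (intro exI[of _ "real n"]) auto
          then show "(?f n \<longlongrightarrow> 0) (inf at_infinity (principal ?P))"
            by (intro tendsto_mono[OF inf_le1] tendsto_eventually)
        qed
        show "(\<lambda>n. integral\<^sup>L (V t x) (?f n)) \<longlonglongrightarrow> integral\<^sup>L (V t x) (indicat_real C)" if x: "x \<in> space ?M" for x
        proof -
          have x\<Omega>: "x \<in> \<Omega>" using x by (simp add: space_restrict_space)
          interpret prob_space "V t x" by (rule pv(1)[OF x\<Omega>])
          show ?thesis
          proof (rule integral_dominated_convergence[where w="\<lambda>_. 1"])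
            show "AE z in V t x. (\<lambda>n. ?f n z) \<longlonglongrightarrow> indicator C z"
              using that \<open>C \<in> _\<close> False closed_indicator_approx by (intro AE_I2) blast
            show "indicat_real C \<in> borel_measurable (V t x)"
              using \<open>C \<in> _\<close> by (intro meas[OF _ x\<Omega>]) auto
            show "?f n \<in> borel_measurable (V t x)" for n
              by (intro meas[OF _ x\<Omega>] borel_measurable_continuous_onI cf)
          qed (use bf in auto)
        qed
      qed
      then have "(\<lambda>x. ennreal (integral\<^sup>L (V t x) (indicat_real C))) \<in> borel_measurable ?M"
        by measurable
      moreover have "emeasure (K x) C = ennreal (integral\<^sup>L (V t x) (indicat_real C))" if x: "x \<in> space ?M" for x
      proof -
        have x\<Omega>: "x \<in> \<Omega>" using x by (simp add: space_restrict_space)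
        interpret Kx: prob_space "K x" by (rule pK[OF x\<Omega>])
        have "integral\<^sup>L (V t x) (indicat_real C) = integral\<^sup>L (K x) (indicat_real C)"
          unfolding K_def using idm[OF x\<Omega>] \<open>C \<in> _\<close> by (subst integral_distr) auto
        also have "\<dots> = measure (K x) C" using \<open>C \<in> _\<close> by (simp add: K_def)
        finally show ?thesis by (simp add: Kx.emeasure_eq_measure)
      qed
      ultimately show ?thesis by (subst measurable_cong) auto
    qed simp
    show "(\<lambda>a. emeasure (K a) UNIV) \<in> borel_measurable ?M"
      by (rule *) simp
  qed auto
  from measurable_compose[OF this nn_integral_measurable_subprob_algebra[OF g]]
  have "(\<lambda>x. integral\<^sup>N (K x) g) \<in> borel_measurable ?M" .
  moreover have "integral\<^sup>N (K x) g = integral\<^sup>N (V t x) g" if "x \<in> space ?M" for x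
    unfolding K_def using g idm that by (subst nn_integral_distr) (auto simp: space_restrict_space)
  ultimately show ?thesis by (simp cong: measurable_cong)
qed

lemma AE_lebesgue_on_iff:
  "S \<in> sets lebesgue \<Longrightarrow> (AE x in lebesgue_on S. P x) \<longleftrightarrow> (AE x in lborel. x \<in> S \<longrightarrow> P x)"
  by (subst AE_restrict_space_iff) (auto simp: AE_completion_iff)

text \<open>Statements almost everywhere mean the same for \<open>lebesgue\<close> and
  \<open>lborel\<close>, and \<open>lborel\<close> on a product is the product of the factors, which
  gives slicing for arbitrary \<open>P\<close>.\<close>

lemma AE_lebesgue_on_prod:
  fixes A :: "'a::euclidean_space set" and B :: "'b::euclidean_space set"
  assumes A: "A \<in> sets borel" and B: "B \<in> sets borel" and P: "AE z in lebesgue_on (A \<times> B). P (fst z) (snd z)"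
  shows "AE x in lebesgue_on A. AE y in lebesgue_on B. P x y"
proof -
  have "A \<times> B \<in> sets borel" using A B by (rule borel_Times)
  then have "AE z in lborel. z \<in> A \<times> B \<longrightarrow> P (fst z) (snd z)"
    using P by (subst (asm) AE_lebesgue_on_iff) auto
  then have "AE z in lborel \<Otimes>\<^sub>M lborel. z \<in> A \<times> B \<longrightarrow> P (fst z) (snd z)"
    by (simp only: lborel_prod)
  then have "AE x in lborel. AE y in lborel. (x, y) \<in> A \<times> B \<longrightarrow> P (fst (x, y)) (snd (x, y))"
    by (rule lborel_pair.AE_pair)
  then have "AE x in lborel. x \<in> A \<longrightarrow> (AE y in lborel. y \<in> B \<longrightarrow> P x y)"
  proof eventually_elim
    case (elim x)
    show ?case
    proof
      assume x: "x \<in> A"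
      show "AE y in lborel. y \<in> B \<longrightarrow> P x y"
        using elim by eventually_elim (use x in auto)
    qed
  qed
  then show ?thesis using A B by (simp add: AE_lebesgue_on_iff)
qed

text \<open>The concentration measures carry nonnegative energy, so dropping them turns the energy
  identity into a bound. This bound makes the averaged energy finite at almost every point, as
  Jensen's inequality requires.\<close>

lemma dissipative_mv_solution_AE_time:
  assumes "open \<Omega>" and \<gamma>: "\<gamma> > 1"
    and sol: "dissipative_mv_solution \<Omega> \<gamma> s0 \<rho>0 m0 S0 E0 V Ckin Cint Cconv"
  shows "AE t in lebesgue_on {0<..}. (\<integral>\<^sup>+x. mean_energy \<gamma> (V t x) \<partial>lebesgue_on \<Omega>) \<le> ennreal E0 \<and>
    (AE x in lebesgue_on \<Omega>. mean_density (V t x) \<ge> 0 \<and>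
      (mean_density (V t x) = 0 \<longrightarrow> mean_entropy (V t x) \<le> 0) \<and>
      s0 * mean_density (V t x) \<le> mean_entropy (V t x) \<and>
      ennreal (energy_fun \<gamma> (mean_density (V t x)) (mean_momentum (V t x)) (mean_entropy (V t x)))
        \<le> mean_energy \<gamma> (V t x))"
proof -
  have Y: "young_measure \<Omega> V" and en: "energy_identity \<Omega> \<gamma> E0 V Ckin Cint"
    and s: "AE (t, x) in lebesgue_on ({0<..} \<times> \<Omega>). AE (r, m, s) in V t x. s0 * r \<le> s"
    using sol by (simp_all add: dissipative_mv_solution_def)
  have "AE t in lebesgue_on {0<..}. AE x in lebesgue_on \<Omega>. AE (r, m, s) in V t x. s0 * r \<le> s"
    using s assms(1) by (intro AE_lebesgue_on_prod) (auto simp: case_prod_beta)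
  moreover have "AE t in lebesgue_on {0<..}. (\<integral>\<^sup>+x. mean_energy \<gamma> (V t x) \<partial>lebesgue_on \<Omega>) \<le> ennreal E0"
  proof -
    have "AE t in lborel. t \<in> {0..} \<longrightarrow> (\<integral>\<^sup>+x. mean_energy \<gamma> (V t x) \<partial>lebesgue_on \<Omega>) +
        emeasure (Ckin t) (closure \<Omega>) + emeasure (Cint t) (closure \<Omega>) = ennreal E0"
      using en unfolding energy_identity_def by (subst (asm) AE_lebesgue_on_iff) auto
    then have "AE t in lborel. t \<in> {0<..} \<longrightarrow> (\<integral>\<^sup>+x. mean_energy \<gamma> (V t x) \<partial>lebesgue_on \<Omega>) \<le> ennreal E0"
    proof eventually_elim
      case (elim t)
      show ?case
      proof
        assume "t \<in> {0<..}"
        then have "t \<in> {0..}" by auto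
        with elim have "(\<integral>\<^sup>+x. mean_energy \<gamma> (V t x) \<partial>lebesgue_on \<Omega>) +
            emeasure (Ckin t) (closure \<Omega>) + emeasure (Cint t) (closure \<Omega>) = ennreal E0" by blast
        then show "(\<integral>\<^sup>+x. mean_energy \<gamma> (V t x) \<partial>lebesgue_on \<Omega>) \<le> ennreal E0"
          by (metis add.assoc le_iff_add)
      qed
    qed
    then show ?thesis by (subst AE_lebesgue_on_iff) auto
  qed
  moreover have "AE t in lebesgue_on {0<..}. t > (0::real)"
    by (rule AE_I2) simp
  ultimately show ?thesis
  proof eventually_elim
    case (elim t)
    have m: "(\<lambda>x. mean_energy \<gamma> (V t x)) \<in> borel_measurable (lebesgue_on \<Omega>)"
      unfolding mean_energy_def
      by (intro borel_measurable_lebesgue_on_borel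
          measurable_nn_integral_young_measure[OF Y elim(3) borel_measurable_energy_integrand])
    have "(\<integral>\<^sup>+x. mean_energy \<gamma> (V t x) \<partial>lebesgue_on \<Omega>) < top"
      using elim(2) by (rule le_less_trans) simp
    then have "AE x in lebesgue_on \<Omega>. mean_energy \<gamma> (V t x) \<noteq> \<infinity>"
      using m by (intro nn_integral_PInf_AE) auto
    moreover have "AE x in lebesgue_on \<Omega>. x \<in> \<Omega>" by (rule AE_I2) simp
    ultimately have "AE x in lebesgue_on \<Omega>. mean_density (V t x) \<ge> 0 \<and>
      (mean_density (V t x) = 0 \<longrightarrow> mean_entropy (V t x) \<le> 0) \<and>
      s0 * mean_density (V t x) \<le> mean_entropy (V t x) \<and>
      ennreal (energy_fun \<gamma> (mean_density (V t x)) (mean_momentum (V t x)) (mean_entropy (V t x)))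
        \<le> mean_energy \<gamma> (V t x)"
      using elim(1)
    proof eventually_elim
      case (elim x)
      have "prob_space (V t x)" "sets (V t x) = sets (restrict_space borel phase_space)"
        using Y elim \<open>0 < t\<close> by (auto simp: young_measure_def)
      moreover have "mean_energy \<gamma> (V t x) < \<infinity>" using elim by (simp add: less_top)
      ultimately show ?case
        using jensen_energy[OF \<gamma>, of "V t x" s0] elim by blast
    qed
    then show ?case using elim(2) by blast
  qed
qed

text \<open>The tangent plane at density \<open>\<rho>bar\<close>, momentum 0 and entropy \<sigma>
  is integrated over \<Omega>. As \<open>\<rho>bar\<close> and \<sigma> are the means of \<rho> and
  \<open>S\<close>, the linear terms cancel and the energy of the constant state remains. If this
  exhausts \<open>E0\<close>, energy and tangent plane agree almost everywhere, and strict convexity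
  identifies the state.\<close>

lemma energy_bound_imp_equilibrium:
  fixes \<rho> S :: "real ^ 'n \<Rightarrow> real" and m :: "real ^ 'n \<Rightarrow> real ^ 'n"
  assumes \<gamma>: "\<gamma> > 1" and \<rho>bar: "\<rho>bar > 0" and \<Omega>: "\<Omega> \<in> lmeasurable" "measure lebesgue \<Omega> > 0"
    and i\<rho>: "integrable (lebesgue_on \<Omega>) \<rho>" and iS: "integrable (lebesgue_on \<Omega>) S"
    and mm: "m \<in> borel_measurable (lebesgue_on \<Omega>)"
    and good: "AE x in lebesgue_on \<Omega>. \<rho> x \<ge> 0 \<and> (\<rho> x = 0 \<longrightarrow> S x \<le> 0) \<and> s0 * \<rho> x \<le> S x"
    and energy: "(\<integral>\<^sup>+x. ennreal (energy_fun \<gamma> (\<rho> x) (m x) (S x)) \<partial>lebesgue_on \<Omega>) \<le> ennreal E0" and "E0 \<ge> 0"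
    and mass: "(LINT x|lebesgue_on \<Omega>. \<rho> x) = \<rho>bar * measure lebesgue \<Omega>"
    and \<sigma>: "(LINT x|lebesgue_on \<Omega>. S x) = \<sigma> * measure lebesgue \<Omega>"
  shows "measure lebesgue \<Omega> * (cv \<gamma> * \<rho>bar powr \<gamma> * exp (\<sigma> / (cv \<gamma> * \<rho>bar))) \<le> E0"
    and "measure lebesgue \<Omega> * (cv \<gamma> * \<rho>bar powr \<gamma> * exp (\<sigma> / (cv \<gamma> * \<rho>bar))) = E0 \<Longrightarrow> AE x in lebesgue_on \<Omega>. \<rho> x = \<rho>bar \<and> m x = 0 \<and> S x = \<sigma>"
    and "s0 * \<rho>bar \<le> \<sigma>"
proof -
  interpret finite_measure "lebesgue_on \<Omega>" by (rule finite_measure_lebesgue_on[OF \<Omega>(1)])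
  let ?V = "measure lebesgue \<Omega>"
  let ?P = "cv \<gamma> * \<rho>bar powr \<gamma> * exp (\<sigma> / (cv \<gamma> * \<rho>bar))"
  let ?e = "\<lambda>x. energy_fun \<gamma> (\<rho> x) (m x) (S x)"
  let ?a = "\<lambda>x. tangent_energy \<gamma> \<rho>bar \<sigma> (\<rho> x) (S x)"
  have sp: "measure (lebesgue_on \<Omega>) \<Omega> = ?V"
    using \<Omega>(1) by (simp add: measure_restrict_space fmeasurableD)
  have [measurable]: "\<rho> \<in> borel_measurable (lebesgue_on \<Omega>)" "S \<in> borel_measurable (lebesgue_on \<Omega>)"
    using i\<rho> iS by auto
  note mm[measurable]
  have em: "?e \<in> borel_measurable (lebesgue_on \<Omega>)" unfolding energy_fun_def by measurable
  have e0: "AE x in lebesgue_on \<Omega>. 0 \<le> ?e x"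
    using good by eventually_elim (auto simp: energy_fun_nonneg \<gamma>)
  have ie: "integrable (lebesgue_on \<Omega>) ?e"
    using e0 em energy by (intro integrableI_nonneg) (auto intro: le_less_trans)
  have "ennreal (LINT x|lebesgue_on \<Omega>. ?e x) \<le> ennreal E0"
    using energy nn_integral_eq_integral[OF ie e0] by simp
  then have eE: "(LINT x|lebesgue_on \<Omega>. ?e x) \<le> E0" using \<open>E0 \<ge> 0\<close> by simp
  have ia: "integrable (lebesgue_on \<Omega>) ?a"
    unfolding tangent_energy_def
    by (intro Bochner_Integration.integrable_add Bochner_Integration.integrable_diff integrable_mult_right
        integrable_divide i\<rho> iS) simp_all
  have "(LINT x|lebesgue_on \<Omega>. ?a x) = ?P * ((1 - \<gamma>) * ?V + \<gamma> * (\<rho>bar * ?V) / \<rho>bar +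
      (\<gamma> - 1) * (\<sigma> * ?V / \<rho>bar - \<sigma> * (\<rho>bar * ?V) / \<rho>bar\<^sup>2))"
    unfolding tangent_energy_def using i\<rho> iS
    by (simp add: mass \<sigma> sp mult.commute[of ?V])
  also have "\<dots> = ?V * ?P" using \<rho>bar by (simp add: field_simps power2_eq_square)
  finally have aV: "(LINT x|lebesgue_on \<Omega>. ?a x) = ?V * ?P" .
  have ae: "AE x in lebesgue_on \<Omega>. ?a x \<le> ?e x"
    using good by eventually_elim (auto intro!: energy_fun_ge_tangent \<gamma> \<rho>bar)
  then have "(LINT x|lebesgue_on \<Omega>. ?a x) \<le> (LINT x|lebesgue_on \<Omega>. ?e x)"
    using ia ie by (intro integral_mono_AE)
  then show "?V * ?P \<le> E0" using aV eE by simp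
  show "AE x in lebesgue_on \<Omega>. \<rho> x = \<rho>bar \<and> m x = 0 \<and> S x = \<sigma>" if "?V * ?P = E0"
  proof -
    have "(LINT x|lebesgue_on \<Omega>. ?e x - ?a x) \<le> 0"
      using ia ie aV eE that by simp
    moreover have "(LINT x|lebesgue_on \<Omega>. ?e x - ?a x) \<ge> 0"
      using ae by (intro integral_nonneg_AE) auto
    ultimately have "(LINT x|lebesgue_on \<Omega>. ?e x - ?a x) = 0" by linarith
    then have "AE x in lebesgue_on \<Omega>. ?e x - ?a x = 0"
      using ia ie ae by (subst (asm) integral_nonneg_eq_0_iff_AE) auto
    then show ?thesis
      using good
    proof eventually_elim
      case (elim x)
      then show ?case
        using energy_fun_ge_tangent(2)[OF \<gamma> \<rho>bar, of "\<rho> x" "S x" \<sigma> "m x"] by auto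
    qed
  qed
  have "(LINT x|lebesgue_on \<Omega>. s0 * \<rho> x) \<le> (LINT x|lebesgue_on \<Omega>. S x)"
    using good i\<rho> iS by (intro integral_mono_AE integrable_mult_right) auto
  then have "s0 * \<rho>bar * ?V \<le> \<sigma> * ?V" by (simp add: mass \<sigma> mult.assoc)
  then show "s0 * \<rho>bar \<le> \<sigma>" using \<Omega>(2) by simp
qed

section \<open>Constant states as dissipative solutions\<close>

lemma C1_scalar_has_derivative_time:
  assumes "C1_scalar \<Omega> \<phi> \<phi>t G" "x \<in> closure \<Omega>" "0 \<le> a" "a \<le> t"
  shows "((\<lambda>t. \<phi> t x) has_real_derivative \<phi>t t x) (at t within {a..b})"
proof -
  have "((\<lambda>(t, x). \<phi> t x) has_derivative (\<lambda>(s, h). s * \<phi>t t x + G t x \<bullet> h))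
      (at (t, x) within {0..} \<times> closure \<Omega>)"
    using assms by (auto simp: C1_scalar_def)
  then have "((\<lambda>(t, x). \<phi> t x) has_derivative (\<lambda>(s, h). s * \<phi>t t x + G t x \<bullet> h))
      (at (t, x) within (\<lambda>t. (t, x)) ` {a..b})"
    by (rule has_derivative_subset) (use assms in auto)
  moreover have "((\<lambda>t. (t, x)) has_derivative (\<lambda>s. (s, 0))) (at t within {a..b})"
    by (auto intro!: derivative_eq_intros)
  ultimately have "((\<lambda>t. case (t, x) of (t, x) \<Rightarrow> \<phi> t x) has_derivative
      (\<lambda>s. case (s, 0) of (s, h) \<Rightarrow> s * \<phi>t t x + G t x \<bullet> h)) (at t within {a..b})"
    using has_derivative_in_compose by blast
  then show ?thesis by (simp add: has_field_derivative_def mult_commute_abs)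
qed

lemma C1_vector_has_derivative_space:
  assumes "C1_vector \<Omega> \<phi> \<phi>t G" "x \<in> closure \<Omega>" "0 \<le> t"
  shows "(\<phi> t has_derivative (\<lambda>h. G t x *v h)) (at x within closure \<Omega>)"
proof -
  have "((\<lambda>(t, x). \<phi> t x) has_derivative (\<lambda>(s, h). s *\<^sub>R \<phi>t t x + G t x *v h))
      (at (t, x) within {0..} \<times> closure \<Omega>)"
    using assms by (auto simp: C1_vector_def)
  then have "((\<lambda>(t, x). \<phi> t x) has_derivative (\<lambda>(s, h). s *\<^sub>R \<phi>t t x + G t x *v h))
      (at (t, x) within (\<lambda>x. (t, x)) ` closure \<Omega>)"
    by (rule has_derivative_subset) (use assms in auto)
  moreover have "((\<lambda>x. (t, x)) has_derivative (\<lambda>h. (0, h))) (at x within closure \<Omega>)"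
    by (auto intro!: derivative_eq_intros)
  ultimately have "((\<lambda>x. case (t, x) of (t, x) \<Rightarrow> \<phi> t x) has_derivative
      (\<lambda>h. case (0, h) of (s, h) \<Rightarrow> s *\<^sub>R \<phi>t t x + G t x *v h)) (at x within closure \<Omega>)"
    using has_derivative_in_compose by blast
  then show ?thesis by simp
qed

text \<open>The order of integration is exchanged, and the fundamental theorem of calculus is
  applied in time at each fixed point.\<close>

lemma C1_scalar_time_integral:
  fixes \<Omega> :: "(real ^ 'n) set"
  assumes \<Omega>: "open \<Omega>" "bounded \<Omega>" and C1: "C1_scalar \<Omega> \<phi> \<phi>t G" and t: "0 \<le> \<tau>1" "\<tau>1 \<le> \<tau>2"
    and int: "\<And>t. t \<ge> 0 \<Longrightarrow> integrable (lebesgue_on \<Omega>) (\<phi> t)"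
  shows "(LINT t|lebesgue_on {\<tau>1..\<tau>2}. LINT x|lebesgue_on \<Omega>. \<phi>t t x) =
    (LINT x|lebesgue_on \<Omega>. \<phi> \<tau>2 x) - (LINT x|lebesgue_on \<Omega>. \<phi> \<tau>1 x)"
proof -
  let ?A = "{\<tau>1..\<tau>2} \<times> \<Omega>" and ?K = "{\<tau>1..\<tau>2} \<times> closure \<Omega>"
  \<comment> \<open>Nothing is known of \<open>\<phi>t\<close> outside the closed cylinder. Cutting
    it off gives an integrable Borel function on the whole space, as Fubini's theorem
    demands.\<close>
  define F where "F t x = indicator ?A (t, x) * \<phi>t t x" for t x
  have ct: "continuous_on ?K (\<lambda>(t, x). \<phi>t t x)"
    using C1 t unfolding C1_scalar_def by (auto intro: continuous_on_subset)
  have mA: "?A \<in> sets borel" using \<Omega> by (intro borel_Times) auto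
  have cK: "compact ?K" using \<Omega> by (intro compact_Times) (auto simp: compact_closure)
  have "integrable lborel (\<lambda>z. indicator ?K z *\<^sub>R (case z of (t, x) \<Rightarrow> \<phi>t t x))"
    by (rule borel_integrable_compact[OF cK ct])
  then have "integrable lborel (\<lambda>z. indicator ?A z *\<^sub>R (indicator ?K z *\<^sub>R (case z of (t, x) \<Rightarrow> \<phi>t t x)))"
    using mA by (intro integrable_mult_indicator[of ?A lborel "\<lambda>z. indicator ?K z *\<^sub>R (case z of (t, x) \<Rightarrow> \<phi>t t x)"]) auto
  moreover have "(\<lambda>z. indicator ?A z *\<^sub>R (indicator ?K z *\<^sub>R (case z of (t, x) \<Rightarrow> \<phi>t t x))) = (\<lambda>(t, x). F t x)"
  proof
    fix z :: "real \<times> (real ^ 'n)"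
    have "z \<in> ?A \<Longrightarrow> z \<in> ?K" using closure_subset[of \<Omega>] by auto
    then show "indicator ?A z *\<^sub>R (indicator ?K z *\<^sub>R (case z of (t, x) \<Rightarrow> \<phi>t t x)) = (\<lambda>(t, x). F t x) z"
      by (cases z; cases "z \<in> ?A") (simp_all add: F_def)
  qed
  ultimately have iF: "integrable (lborel \<Otimes>\<^sub>M lborel) (\<lambda>(t, x). F t x)"
    by (simp add: lborel_prod)
  then have mF: "(\<lambda>(t, x). F t x) \<in> borel_measurable (lborel \<Otimes>\<^sub>M lborel)" by blast
  have inner: "(LINT x|lebesgue_on \<Omega>. \<phi>t t x) = (LINT x|lborel. F t x)" if "t \<in> {\<tau>1..\<tau>2}" for t
  proof (rule integral_lebesgue_on_eq_lborel)
    show "F t \<in> borel_measurable borel"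
      using measurable_compose[OF _ mF, of "\<lambda>x. (t, x)" borel] by simp
  qed (use \<Omega> that in \<open>auto simp: F_def\<close>)
  have "(LINT t|lebesgue_on {\<tau>1..\<tau>2}. LINT x|lebesgue_on \<Omega>. \<phi>t t x) = (LINT t|lborel. LINT x|lborel. F t x)"
  proof (rule integral_lebesgue_on_eq_lborel)
    show "(\<lambda>t. LINT x|lborel. F t x) \<in> borel_measurable borel"
      using lborel.borel_measurable_lebesgue_integral[OF mF] by simp
  qed (use inner in \<open>auto simp: F_def\<close>)
  also have "\<dots> = (LINT x|lborel. LINT t|lborel. F t x)"
    using lborel_pair.Fubini_integral[OF iF] by simp
  also have "\<dots> = (LINT x|lebesgue_on \<Omega>. \<phi> \<tau>2 x - \<phi> \<tau>1 x)"
  proof (rule integral_lebesgue_on_eq_lborel[symmetric])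
    have "(\<lambda>(x, t). F t x) \<in> borel_measurable (lborel \<Otimes>\<^sub>M lborel)"
      using measurable_compose[OF measurable_pair_swap' mF] by (simp add: case_prod_beta')
    then show "(\<lambda>x. LINT t|lborel. F t x) \<in> borel_measurable borel"
      using lborel.borel_measurable_lebesgue_integral by fastforce
    show "(LINT t|lborel. F t x) = \<phi> \<tau>2 x - \<phi> \<tau>1 x" if x: "x \<in> \<Omega>" for x
    proof -
      have xc: "x \<in> closure \<Omega>" using x closure_subset by auto
      have "(LINT t|lborel. indicator {\<tau>1..\<tau>2} t *\<^sub>R \<phi>t t x) = \<phi> \<tau>2 x - \<phi> \<tau>1 x"
      proof (rule integral_FTC_Icc[OF t(2)])
        show "((\<lambda>t. \<phi> t x) has_vector_derivative \<phi>t s x) (at s within {\<tau>1..\<tau>2})" if "\<tau>1 \<le> s" for s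
          using C1_scalar_has_derivative_time[OF C1 xc t(1) that]
          by (simp add: has_real_derivative_iff_has_vector_derivative)
        have "continuous_on {\<tau>1..\<tau>2} (\<lambda>s. case (s, x) of (t, x) \<Rightarrow> \<phi>t t x)"
          using xc by (intro continuous_on_compose2[OF ct]) (auto intro!: continuous_intros)
        then show "continuous_on {\<tau>1..\<tau>2} (\<lambda>s. \<phi>t s x)" by simp
      qed
      then show ?thesis using x by (simp add: F_def indicator_def)
    qed
  qed (use \<Omega> in \<open>auto simp: F_def\<close>)
  also have "\<dots> = (LINT x|lebesgue_on \<Omega>. \<phi> \<tau>2 x) - (LINT x|lebesgue_on \<Omega>. \<phi> \<tau>1 x)"
    using int t by (intro Bochner_Integration.integral_diff) auto
  finally show ?thesis .
qed

lemma C1_scalar_continuous: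
  "C1_scalar \<Omega> \<phi> \<phi>t G \<Longrightarrow> continuous_on ({0..} \<times> closure \<Omega>) (\<lambda>(t, x). \<phi> t x)"
  unfolding continuous_on_eq_continuous_within C1_scalar_def
  by (auto intro!: has_derivative_continuous)

lemma C1_scalar_slice:
  assumes C1: "C1_scalar \<Omega> \<phi> \<phi>t G" and t: "t \<ge> 0"
  shows "continuous_on (closure \<Omega>) (\<phi> t)"
proof -
  have "continuous_on (closure \<Omega>) (\<lambda>x. case (t, x) of (t, x) \<Rightarrow> \<phi> t x)"
    using t by (intro continuous_on_compose2[OF C1_scalar_continuous[OF C1]]) (auto intro!: continuous_intros)
  then show ?thesis by simp
qed

lemma C1_scalar_bounded:
  assumes "bounded \<Omega>" "C1_scalar \<Omega> \<phi> \<phi>t G"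
  shows "\<exists>M. \<forall>t\<in>{0..T}. \<forall>x\<in>closure \<Omega>. \<bar>\<phi> t x\<bar> \<le> M"
proof -
  have "compact ({0..T} \<times> closure \<Omega>)" using assms by (intro compact_Times) (auto simp: compact_closure)
  moreover have "continuous_on ({0..T} \<times> closure \<Omega>) (\<lambda>(t, x). \<phi> t x)"
    by (rule continuous_on_subset[OF C1_scalar_continuous[OF assms(2)]]) auto
  ultimately have "bounded ((\<lambda>(t, x). \<phi> t x) ` ({0..T} \<times> closure \<Omega>))"
    by (intro compact_imp_bounded compact_continuous_image)
  then show ?thesis unfolding bounded_iff by force
qed

lemma C1_scalar_integrable:
  assumes \<Omega>: "open \<Omega>" "bounded \<Omega>" and C1: "C1_scalar \<Omega> \<phi> \<phi>t G" and t: "t \<ge> 0"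
  shows "integrable (lebesgue_on \<Omega>) (\<phi> t)"
proof -
  obtain M where "\<forall>s\<in>{0..t}. \<forall>x\<in>closure \<Omega>. \<bar>\<phi> s x\<bar> \<le> M"
    using C1_scalar_bounded[OF \<Omega>(2) C1] by blast
  then show ?thesis
    using \<Omega> t closure_subset[of \<Omega>]
    by (intro integrable_lebesgue_on_continuous_bounded[where B=M] continuous_on_subset[OF C1_scalar_slice[OF C1 t]])
      (auto simp: lmeasurable_open)
qed

lemma C1_scalar_integral_tendsto:
  fixes \<Omega> :: "(real ^ 'n) set"
  assumes \<Omega>: "open \<Omega>" "bounded \<Omega>" and C1: "C1_scalar \<Omega> \<phi> \<phi>t G" and t0: "t0 \<ge> 0"
  shows "((\<lambda>t. LINT x|lebesgue_on \<Omega>. \<phi> t x) \<longlongrightarrow> (LINT x|lebesgue_on \<Omega>. \<phi> t0 x)) (at t0 within {0..})"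
  unfolding tendsto_at_iff_sequentially
proof (intro allI impI)
  fix X assume X: "\<forall>i. X i \<in> {0..} - {t0}" "X \<longlonglongrightarrow> t0"
  obtain T where T: "\<And>i. \<bar>X i\<bar> \<le> T"
    using convergent_imp_Bseq[OF convergentI[OF X(2)]] by (auto simp: Bseq_def)
  obtain M where M: "\<forall>s\<in>{0..T}. \<forall>x\<in>closure \<Omega>. \<bar>\<phi> s x\<bar> \<le> M"
    using C1_scalar_bounded[OF \<Omega>(2) C1] by blast
  have X0: "0 \<le> X i" "X i \<le> T" for i using X(1) T[of i] by auto
  interpret finite_measure "lebesgue_on \<Omega>"
    using \<Omega> by (intro finite_measure_lebesgue_on) (simp add: lmeasurable_open)
  have "(\<lambda>i. LINT x|lebesgue_on \<Omega>. \<phi> (X i) x) \<longlonglongrightarrow> (LINT x|lebesgue_on \<Omega>. \<phi> t0 x)"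
  proof (rule integral_dominated_convergence[where w="\<lambda>_. M"])
    show "\<phi> t0 \<in> borel_measurable (lebesgue_on \<Omega>)" "\<phi> (X i) \<in> borel_measurable (lebesgue_on \<Omega>)" for i
      using C1_scalar_integrable[OF \<Omega> C1] t0 X0 by blast+
    show "AE x in lebesgue_on \<Omega>. norm (\<phi> (X i) x) \<le> M" for i
      using M X0 subsetD[OF closure_subset[of \<Omega>]] by (intro AE_I2) simp
    show "AE x in lebesgue_on \<Omega>. (\<lambda>i. \<phi> (X i) x) \<longlonglongrightarrow> \<phi> t0 x"
    proof (rule AE_I2)
      fix x assume "x \<in> space (lebesgue_on \<Omega>)"
      then have x: "x \<in> closure \<Omega>" using closure_subset by auto
      have "(\<lambda>i. (X i, x)) \<longlonglongrightarrow> (t0, x)" using X(2) by (intro tendsto_intros)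
      then have "(\<lambda>i. case (X i, x) of (t, x) \<Rightarrow> \<phi> t x) \<longlonglongrightarrow> (case (t0, x) of (t, x) \<Rightarrow> \<phi> t x)"
        using x t0 X0 by (intro continuous_on_tendsto_compose[OF C1_scalar_continuous[OF C1]]) auto
      then show "(\<lambda>i. \<phi> (X i) x) \<longlonglongrightarrow> \<phi> t0 x" by simp
    qed
  qed simp
  then show "((\<lambda>t. LINT x|lebesgue_on \<Omega>. \<phi> t x) \<circ> X) \<longlonglongrightarrow> (LINT x|lebesgue_on \<Omega>. \<phi> t0 x)"
    by (simp add: o_def)
qed

section \<open>Dirac masses and the comparison solution\<close>

lemma const_in_Lp:
  assumes "\<Omega> \<in> lmeasurable"
  shows "(\<lambda>x. c) \<in> Lp p \<Omega>"
proof -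
  interpret finite_measure "lebesgue_on \<Omega>" by (rule finite_measure_lebesgue_on[OF assms])
  show ?thesis by (simp add: Lp_def)
qed

lemma const_in_C_weak_loc:
  assumes "\<Omega> \<in> lmeasurable"
  shows "(\<lambda>t x. c) \<in> C_weak_loc p \<Omega>"
  by (auto simp: C_weak_loc_def const_in_Lp[OF assms])

lemma measure_family_null: "measure_family K (\<lambda>t. null_measure (restrict_space borel K))"
  by (auto simp: measure_family_def intro!: exI[of _ 0] finite_measureI)

lemma state_return:
  fixes r s :: real
  assumes "r > 0" and \<gamma>: "\<gamma> > 1"
  defines "\<delta> \<equiv> return (restrict_space borel phase_space) (r, 0 :: real ^ 'n, s)"
  shows "mean_density \<delta> = r" "mean_momentum \<delta> = 0" "mean_entropy \<delta> = s"
    "mean_convection \<delta> = 0" "mean_entropy_flux \<delta> = 0"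
    "mean_pressure \<gamma> \<delta> = r powr \<gamma> * exp (s / (cv \<gamma> * r))"
    "mean_energy \<gamma> \<delta> = ennreal (cv \<gamma> * r powr \<gamma> * exp (s / (cv \<gamma> * r)))"
proof -
  let ?N = "restrict_space borel (phase_space :: (real \<times> (real ^ 'n) \<times> real) set)"
  have z: "(r, 0, s) \<in> space ?N" using assms(1) by (simp add: space_restrict_space phase_space_def)
  note int = integral_return[OF z measurable_restrict_space1]
  note nnint = nn_integral_return[OF z measurable_restrict_space1]
  note m = borel_measurable_state
  show "mean_density \<delta> = r" "mean_momentum \<delta> = 0" "mean_entropy \<delta> = s"
    unfolding \<delta>_def mean_density_def mean_momentum_def mean_entropy_def by (subst int[OF m(1)] int[OF m(2)] int[OF m(3)]; simp)+
  have cs: "continuous_on UNIV (\<lambda>z :: real \<times> (real ^ 'n) \<times> real. outer_prod (fst (snd z)) (fst (snd z)))"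
    by (intro continuous_on_outer_prod continuous_intros)
  have "(\<lambda>z :: real \<times> (real ^ 'n) \<times> real. fst z) \<in> borel_measurable borel"
    by (intro borel_measurable_continuous_onI continuous_intros)
  with borel_measurable_continuous_onI[OF cs]
  have "(\<lambda>z :: real \<times> (real ^ 'n) \<times> real. outer_prod (fst (snd z)) (fst (snd z)) /\<^sub>R fst z) \<in> borel_measurable borel"
    by measurable
  then have "(\<lambda>(r, m, s). outer_prod m m /\<^sub>R r) \<in> borel_measurable (borel :: (real \<times> (real ^ 'n) \<times> real) measure)"
    by (simp add: case_prod_beta')
  from int[OF this] show "mean_convection \<delta> = 0"
    unfolding \<delta>_def mean_convection_def by (simp add: outer_prod_def vec_eq_iff)
  have "(\<lambda>(r, m, s). (s / r) *\<^sub>R m) \<in> borel_measurable (borel :: (real \<times> (real ^ 'n) \<times> real) measure)"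
    by (simp flip: borel_prod)
  from int[OF this] show "mean_entropy_flux \<delta> = 0"
    unfolding \<delta>_def mean_entropy_flux_def by simp
  have "(\<lambda>(r, m, s). enn2real (pressure \<gamma> r s)) \<in> borel_measurable (borel :: (real \<times> (real ^ 'n) \<times> real) measure)"
    unfolding pressure_def by (simp flip: borel_prod)
  from int[OF this] show "mean_pressure \<gamma> \<delta> = r powr \<gamma> * exp (s / (cv \<gamma> * r))"
    unfolding \<delta>_def mean_pressure_def using assms(1) by (simp add: pressure_def)
  from nnint[OF borel_measurable_energy_integrand]
  show "mean_energy \<gamma> \<delta> = ennreal (cv \<gamma> * r powr \<gamma> * exp (s / (cv \<gamma> * r)))"
    unfolding \<delta>_def mean_energy_def using assms(1) cv_pos[OF \<gamma>]
    by (simp add: pressure_def kinetic_def mult.assoc flip: ennreal_mult)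
qed

lemma AE_return_entropy:
  assumes "r > 0" "s0 * r \<le> s"
  shows "AE (r, m, s) in return (restrict_space borel phase_space) (r, 0 :: real ^ 'n, s). s0 * r \<le> s"
proof -
  let ?N = "restrict_space borel (phase_space :: (real \<times> (real ^ 'n) \<times> real) set)"
  have z: "(r, 0, s) \<in> space ?N" using assms(1) by (simp add: space_restrict_space phase_space_def)
  have [measurable]: "(\<lambda>z :: real \<times> (real ^ 'n) \<times> real. fst z) \<in> borel_measurable borel"
    "(\<lambda>z :: real \<times> (real ^ 'n) \<times> real. snd (snd z)) \<in> borel_measurable borel"
    by (intro borel_measurable_continuous_onI continuous_intros)+
  have "Measurable.pred borel (\<lambda>z :: real \<times> (real ^ 'n) \<times> real. s0 * fst z \<le> snd (snd z))"
    by measurable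
  then have "Measurable.pred ?N (\<lambda>(r, m, s). s0 * r \<le> s)"
    by (intro measurable_restrict_space1) (simp add: case_prod_beta')
  from AE_return[OF z this] show ?thesis using assms by simp
qed

text \<open>The witness is a Dirac mass without concentrations. The continuity equation becomes
  integration in time of the test function, the momentum equation becomes the divergence theorem,
  and the only entropy production is a nonnegative jump from \<open>Sinit\<close> to
  \<open>Sbar\<close> at time 0.\<close>

lemma constant_state_dissipative:
  fixes \<Omega> :: "(real ^ 'n) set"
  assumes dom: "smooth_bounded_domain \<Omega>" and \<gamma>: "\<gamma> > 1" and \<rho>bar: "\<rho>bar > 0"
    and E0: "measure lebesgue \<Omega> * (cv \<gamma> * \<rho>bar powr \<gamma> * exp (Sbar / (cv \<gamma> * \<rho>bar))) = E0"
    and S0: "Sinit \<le> Sbar" and s0: "s0 * \<rho>bar \<le> Sbar"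
  shows "dissipative_solution \<Omega> \<gamma> s0 l (\<lambda>x. \<rho>bar) (\<lambda>x. 0) (\<lambda>x. Sinit) E0 (\<lambda>t x. \<rho>bar) (\<lambda>t x. 0) (\<lambda>t x. Sbar)"
proof -
  have \<Omega>: "open \<Omega>" "bounded \<Omega>" using dom by (auto simp: smooth_bounded_domain_def)
  have m\<Omega>: "\<Omega> \<in> lmeasurable" using \<Omega> by (simp add: lmeasurable_open)
  interpret finite_measure "lebesgue_on \<Omega>" by (rule finite_measure_lebesgue_on[OF m\<Omega>])
  define V where "V t x = return (restrict_space borel phase_space) (\<rho>bar, 0 :: real ^ 'n, Sbar)"
    for t :: real and x :: "real ^ 'n"
  define Ck where "Ck t = null_measure (restrict_space borel (closure \<Omega>))" for t :: real
  define Cc where "Cc t = null_measure (restrict_space borel (sphere (0 :: real ^ 'n) 1 \<times> closure \<Omega>))" for t :: real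
  let ?P = "\<rho>bar powr \<gamma> * exp (Sbar / (cv \<gamma> * \<rho>bar))"
  note ret = state_return[OF \<rho>bar \<gamma>, where 'n='n and s=Sbar]
  have V: "mean_density (V t x) = \<rho>bar" "mean_momentum (V t x) = 0" "mean_entropy (V t x) = Sbar"
    "mean_convection (V t x) = 0" "mean_entropy_flux (V t x) = 0" "mean_pressure \<gamma> (V t x) = ?P"
    "mean_energy \<gamma> (V t x) = ennreal (cv \<gamma> * \<rho>bar powr \<gamma> * exp (Sbar / (cv \<gamma> * \<rho>bar)))" for t x
    unfolding V_def by (rule ret)+
  have "E0 \<ge> 0" unfolding E0[symmetric] using cv_pos[OF \<gamma>] by simp
  have young: "young_measure \<Omega> V"
  proof -
    have "(\<rho>bar, 0, Sbar) \<in> space (restrict_space borel (phase_space :: (real \<times> (real ^ 'n) \<times> real) set))"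
      using \<rho>bar by (simp add: space_restrict_space phase_space_def)
    then show ?thesis
      by (auto simp: young_measure_def V_def intro!: prob_space_return)
  qed
  have energy: "energy_identity \<Omega> \<gamma> E0 V Ck Ck"
  proof -
    have "(\<integral>\<^sup>+x. mean_energy \<gamma> (V t x) \<partial>lebesgue_on \<Omega>) = ennreal E0" for t
    proof -
      have "(\<integral>\<^sup>+x. mean_energy \<gamma> (V t x) \<partial>lebesgue_on \<Omega>) =
          ennreal (cv \<gamma> * \<rho>bar powr \<gamma> * exp (Sbar / (cv \<gamma> * \<rho>bar))) * emeasure (lebesgue_on \<Omega>) \<Omega>"
        by (simp add: V)
      also have "emeasure (lebesgue_on \<Omega>) \<Omega> = ennreal (measure lebesgue \<Omega>)"
        using m\<Omega> by (simp add: emeasure_eq_measure measure_restrict_space fmeasurableD)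
      finally show ?thesis
        using cv_pos[OF \<gamma>] by (simp add: E0[symmetric] mult.commute flip: ennreal_mult)
    qed
    then show ?thesis by (simp add: energy_identity_def Ck_def)
  qed
  have continuity: "continuity_equation \<Omega> (\<lambda>x. \<rho>bar) V"
    unfolding continuity_equation_def
  proof (intro conjI allI impI)
    fix \<tau>1 \<tau>2 :: real and \<phi> \<phi>t :: "real \<Rightarrow> real ^ 'n \<Rightarrow> real" and G :: "real \<Rightarrow> real ^ 'n \<Rightarrow> real ^ 'n"
    assume a: "0 \<le> \<tau>1 \<and> \<tau>1 < \<tau>2 \<and> C1_scalar \<Omega> \<phi> \<phi>t G \<and> compact_support \<Omega> \<phi>"
    then have C1: "C1_scalar \<Omega> \<phi> \<phi>t G" by blast
    show "(LINT t|lebesgue_on {\<tau>1..\<tau>2}. LINT x|lebesgue_on \<Omega>.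
         mean_density (V t x) * \<phi>t t x + mean_momentum (V t x) \<bullet> G t x) =
      (LINT x|lebesgue_on \<Omega>. mean_density (V \<tau>2 x) * \<phi> \<tau>2 x) -
      (LINT x|lebesgue_on \<Omega>. mean_density (V \<tau>1 x) * \<phi> \<tau>1 x)"
      using C1_scalar_time_integral[OF \<Omega> C1, of \<tau>1 \<tau>2] C1_scalar_integrable[OF \<Omega> C1] a
      by (simp add: V right_diff_distrib)
  qed (simp add: V)
  have momentum: "momentum_equation \<Omega> \<gamma> (\<lambda>x. 0) V Ck Cc"
    unfolding momentum_equation_def
  proof (intro conjI allI impI, goal_cases)
    case (2 \<tau>1 \<tau>2 \<phi> \<phi>t G)
    then have C1: "C1_vector \<Omega> \<phi> \<phi>t G" by blast
    have div: "(LINT x|lebesgue_on \<Omega>. trace (G t x)) = 0" if t: "t \<ge> 0" for t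
    proof (rule divergence_tangent_field[OF dom, of "\<phi> t"])
      show "(\<phi> t has_derivative (\<lambda>h. G t x *v h)) (at x within closure \<Omega>)" if "x \<in> closure \<Omega>" for x
        using C1_vector_has_derivative_space[OF C1 that t] .
      have cG: "continuous_on ({0..} \<times> closure \<Omega>) (\<lambda>(t, x). G t x)"
        using C1 by (simp add: C1_vector_def)
      have "continuous_on (closure \<Omega>) (\<lambda>x. case (t, x) of (t, x) \<Rightarrow> G t x)"
        using t by (intro continuous_on_compose2[OF cG]) (auto intro!: continuous_intros)
      then show "continuous_on (closure \<Omega>) (G t)" by simp
      show "\<phi> t x \<bullet> \<nu> = 0" if "x \<in> frontier \<Omega>" "outer_normal \<Omega> x \<nu>" for x \<nu>
        using 2 that t by blast
    qed
    have "(LINT t|lebesgue_on {\<tau>1..\<tau>2}. LINT x|lebesgue_on \<Omega>. ?P * trace (G t x)) = (LINT t|lebesgue_on {\<tau>1..\<tau>2}. 0)"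
      using 2 div by (intro Bochner_Integration.integral_cong) auto
    then show ?case by (simp add: V Ck_def Cc_def)
  qed (simp add: V)
  have entropy: "entropy_inequality \<Omega> (\<lambda>x. Sinit) V"
    unfolding entropy_inequality_def
  proof (intro allI impI)
    fix \<tau>1 \<tau>2 :: real and \<phi> \<phi>t :: "real \<Rightarrow> real ^ 'n \<Rightarrow> real" and G :: "real \<Rightarrow> real ^ 'n \<Rightarrow> real ^ 'n"
    assume a: "0 \<le> \<tau>1 \<and> \<tau>1 < \<tau>2 \<and> C1_scalar \<Omega> \<phi> \<phi>t G \<and> (\<forall>t\<ge>0. \<forall>x\<in>closure \<Omega>. 0 \<le> \<phi> t x)"
    then have C1: "C1_scalar \<Omega> \<phi> \<phi>t G" and t: "0 \<le> \<tau>1" "\<tau>1 < \<tau>2" by blast+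
    let ?F = "\<lambda>t. LINT x|lebesgue_on \<Omega>. \<phi> t x"
    have lim: "((\<lambda>t. Sbar * ?F t) \<longlongrightarrow> Sbar * ?F t0) (at t0)" if "t0 > 0" for t0
    proof -
      have "at t0 within {0..} = at t0" using that by (intro at_within_interior) auto
      then show ?thesis
        using C1_scalar_integral_tendsto[OF \<Omega> C1, of t0] that by (intro tendsto_mult_left) auto
    qed
    have F0: "?F 0 \<ge> 0" using a closure_subset by (intro integral_nonneg_AE AE_I2) auto
    have I: "(LINT t|lebesgue_on {\<tau>1..\<tau>2}. LINT x|lebesgue_on \<Omega>.
        mean_entropy (V t x) * \<phi>t t x + mean_entropy_flux (V t x) \<bullet> G t x) = Sbar * ?F \<tau>2 - Sbar * ?F \<tau>1"
      using C1_scalar_time_integral[OF \<Omega> C1, of \<tau>1 \<tau>2] C1_scalar_integrable[OF \<Omega> C1] t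
      by (simp add: V right_diff_distrib)
    have le: "Sinit * ?F 0 \<le> Sbar * ?F 0" using S0 F0 by (intro mult_right_mono)
    \<comment> \<open>At time 0 the value from the left is the initial entropy, not the entropy of
      the solution. The inequality thereby gains \<open>(Sbar - Sinit) * ?F 0\<close>, which is
      nonnegative because the test function is.\<close>
    let ?a = "if \<tau>1 = 0 then Sinit * ?F 0 else Sbar * ?F \<tau>1"
    show "\<exists>a b. (if \<tau>1 = 0 then a = (LINT x|lebesgue_on \<Omega>. Sinit * \<phi> 0 x)
              else ((\<lambda>t. LINT x|lebesgue_on \<Omega>. mean_entropy (V t x) * \<phi> t x) \<longlongrightarrow> a) (at_left \<tau>1)) \<and>
             ((\<lambda>t. LINT x|lebesgue_on \<Omega>. mean_entropy (V t x) * \<phi> t x) \<longlongrightarrow> b) (at_right \<tau>2) \<and>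
             (LINT t|lebesgue_on {\<tau>1..\<tau>2}. LINT x|lebesgue_on \<Omega>.
                mean_entropy (V t x) * \<phi>t t x + mean_entropy_flux (V t x) \<bullet> G t x) \<le> b - a"
    proof (rule exI[of _ ?a], rule exI[of _ "Sbar * ?F \<tau>2"], intro conjI)
      show "if \<tau>1 = 0 then ?a = (LINT x|lebesgue_on \<Omega>. Sinit * \<phi> 0 x)
          else ((\<lambda>t. LINT x|lebesgue_on \<Omega>. mean_entropy (V t x) * \<phi> t x) \<longlongrightarrow> ?a) (at_left \<tau>1)"
        using t lim[of \<tau>1] by (auto simp: V intro: filterlim_mono[OF _ order_refl at_le])
      show "((\<lambda>t. LINT x|lebesgue_on \<Omega>. mean_entropy (V t x) * \<phi> t x) \<longlongrightarrow> Sbar * ?F \<tau>2) (at_right \<tau>2)"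
        using t lim[of \<tau>2] by (auto simp: V intro: filterlim_mono[OF _ order_refl at_le])
      show "(LINT t|lebesgue_on {\<tau>1..\<tau>2}. LINT x|lebesgue_on \<Omega>.
          mean_entropy (V t x) * \<phi>t t x + mean_entropy_flux (V t x) \<bullet> G t x) \<le> Sbar * ?F \<tau>2 - ?a"
        using I le by auto
    qed
  qed
  have mf: "measure_family (closure \<Omega>) Ck" "measure_family (sphere 0 1 \<times> closure \<Omega>) Cc"
    unfolding Ck_def Cc_def by (rule measure_family_null)+
  have ent: "AE (t, x) in lebesgue_on ({0<..} \<times> \<Omega>). AE (r, m, s) in V t x. s0 * r \<le> s"
    unfolding V_def using AE_return_entropy[OF \<rho>bar s0, where 'n='n]
    by (intro AE_I2) (simp only: split_paired_all prod.case)
  have "dissipative_mv_solution \<Omega> \<gamma> s0 (\<lambda>x. \<rho>bar) (\<lambda>x. 0) (\<lambda>x. Sinit) E0 V Ck Ck Cc"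
    unfolding dissipative_mv_solution_def
    using young energy continuity momentum entropy mf ent
    by (intro conjI) (simp_all add: Ck_def Cc_def)
  moreover have "\<forall>t\<ge>0. AE x in lebesgue_on \<Omega>. \<rho>bar = mean_density (V t x) \<and> 0 = mean_momentum (V t x) \<and>
      Sbar = mean_entropy (V t x)"
    by (simp add: V)
  moreover have "(\<lambda>t x. Sbar) \<in> BV_weak_loc l \<Omega>"
    by (auto simp: BV_weak_loc_def BV_loc_def intro!: exI[of _ 0])
  moreover have "(\<lambda>t x. Sbar) \<in> Linf_Lp \<gamma> \<Omega>"
    by (auto simp: Linf_Lp_def const_in_Lp[OF m\<Omega>])
  ultimately show ?thesis
    unfolding dissipative_solution_def using \<open>E0 \<ge> 0\<close>
    by (intro conjI IntI exI[of _ V] exI[of _ Ck] exI[of _ Cc] const_in_Lp[OF m\<Omega>] const_in_C_weak_loc[OF m\<Omega>])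
qed

section \<open>Functions of time\<close>

lemma AE_lebesgue_on_dense:
  fixes a b :: real
  assumes P: "AE t in lebesgue_on {0<..}. P t" and "0 \<le> a" "a < b"
  shows "\<exists>t. a < t \<and> t < b \<and> P t"
proof (rule ccontr)
  assume n: "\<not> ?thesis"
  have "AE t in lborel. t \<in> {0<..} \<longrightarrow> P t" using P by (subst (asm) AE_lebesgue_on_iff) auto
  then have "AE t in lborel. t \<notin> {a<..<b}"
    by eventually_elim (use n assms in force)
  then have "{a<..<b} \<in> null_sets lborel" by (subst AE_iff_null_sets) auto
  then have "emeasure lborel {a<..<b} = 0" by auto
  then show False using assms by simp
qed

text \<open>If every step were at least \<epsilon>, then \<open>n\<close> steps would have variation
  at least \<open>n * \<epsilon>\<close>, which exceeds any bound.\<close>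

lemma BV_loc_no_oscillation:
  assumes BV: "BV_loc g" and s: "incseq s \<or> decseq s" "range s \<subseteq> {0..T}" and "\<epsilon> > 0"
  shows "\<exists>k. \<bar>g (s (Suc k)) - g (s k)\<bar> < \<epsilon>"
proof (rule ccontr)
  assume "\<not> ?thesis"
  then have step: "\<epsilon> \<le> \<bar>g (s (Suc k)) - g (s k)\<bar>" for k by (simp add: not_less)
  have "T \<ge> 0" using s(2) by (auto simp: image_subset_iff dest: spec[of _ 0])
  then obtain B where "\<forall>n::nat. \<forall>s. mono_on {..n} s \<and> s ` {..n} \<subseteq> {0..T} \<longrightarrow>
      (\<Sum>k<n. \<bar>g (s (Suc k)) - g (s k)\<bar>) \<le> B"
    using BV[unfolded BV_loc_def, rule_format, of T] by auto
  then have B: "(\<Sum>k<n. \<bar>g (s (Suc k)) - g (s k)\<bar>) \<le> B"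
    if "mono_on {..n} s" "s ` {..n} \<subseteq> {0..T}" for n :: nat and s
    using that by simp
  have le: "(\<Sum>k<n. \<bar>g (s (Suc k)) - g (s k)\<bar>) \<le> B" for n :: nat
  proof (cases "incseq s")
    case True
    then show ?thesis using s(2) by (intro B) (auto simp: mono_on_def incseq_def)
  next
    case False
    \<comment> \<open>Partitions in \<open>BV_loc\<close> are increasing, so a decreasing sequence
      is read backwards.\<close>
    let ?r = "\<lambda>k. s (n - k)"
    have "(\<Sum>k<n. \<bar>g (?r (Suc k)) - g (?r k)\<bar>) \<le> B"
      using False s by (intro B) (auto simp: mono_on_def decseq_def)
    also have "(\<Sum>k<n. \<bar>g (?r (Suc k)) - g (?r k)\<bar>) = (\<Sum>k<n. \<bar>g (s (n - Suc k)) - g (s (Suc (n - Suc k)))\<bar>)"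
      by (intro sum.cong) (auto simp: Suc_diff_Suc)
    also have "\<dots> = (\<Sum>k<n. \<bar>g (s k) - g (s (Suc k))\<bar>)"
      by (rule sum.nat_diff_reindex)
    finally show ?thesis by (simp add: abs_minus_commute)
  qed
  obtain n :: nat where n: "B < real n * \<epsilon>" using reals_Archimedean3[OF \<open>\<epsilon> > 0\<close>] by blast
  have "real n * \<epsilon> = (\<Sum>k<n. \<epsilon>)" by simp
  also have "\<dots> \<le> (\<Sum>k<n. \<bar>g (s (Suc k)) - g (s k)\<bar>)" by (intro sum_mono step)
  finally show False using le[of n] n by simp
qed

text \<open>For \<open>R\<close> one of the two strict orders on the reals, this produces a monotone
  sequence that keeps switching between \<open>A\<close> and \<open>B\<close>, in conflict with
  bounded variation when \<open>A\<close> and \<open>B\<close> separate the values of a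
  function.\<close>

lemma alternating_sequence:
  assumes start: "\<exists>x\<in>I. A x" and stepB: "\<And>x. x \<in> I \<Longrightarrow> \<exists>y\<in>I. R x y \<and> B y"
    and stepA: "\<And>x. x \<in> I \<Longrightarrow> \<exists>y\<in>I. R x y \<and> A y"
  shows "\<exists>s. \<forall>k::nat. (s k \<in> I \<and> (if even k then A (s k) else B (s k))) \<and> R (s k) (s (Suc k))"
proof (rule dependent_nat_choice)
  show "\<exists>x. x \<in> I \<and> (if even (0::nat) then A x else B x)" using start by auto
  fix x and n :: nat
  assume "x \<in> I \<and> (if even n then A x else B x)"
  then show "\<exists>y. (y \<in> I \<and> (if even (Suc n) then A y else B y)) \<and> R x y"
    using stepA[of x] stepB[of x] by (cases "even n") auto
qed

text \<open>The value \<open>C\<close> is attained arbitrarily close to \<open>t\<close>. If the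
  limit failed, values at distance at least \<epsilon> from \<open>C\<close> would be as well, and a
  monotone sequence of times alternating between the two kinds would have infinite
  variation.\<close>

lemma BV_loc_tendsto:
  assumes BV: "BV_loc g" and C: "AE t in lebesgue_on {0<..}. g t = C" and t: "t > 0"
  shows "(g \<longlongrightarrow> C) (at_left t)" and "(g \<longlongrightarrow> C) (at_right t)"
proof -
  show "(g \<longlongrightarrow> C) (at_left t)"
  proof (rule ccontr)
    assume "\<not> ?thesis"
    then obtain \<epsilon> where \<epsilon>: "\<epsilon> > 0" "\<not> eventually (\<lambda>s. dist (g s) C < \<epsilon>) (at_left t)"
      by (auto simp: tendsto_iff)
    have p: "\<exists>s. b < s \<and> s < t \<and> \<bar>g s - C\<bar> \<ge> \<epsilon>" if "b < t" for b
      using \<epsilon>(2) that unfolding eventually_at_left_field by (auto simp: dist_real_def not_less dest!: spec[of _ b])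
    have q: "\<exists>s. b < s \<and> s < t \<and> g s = C" if "0 \<le> b" "b < t" for b
      using AE_lebesgue_on_dense[OF C that] .
    have "\<exists>s. \<forall>k::nat. (s k \<in> {0<..<t} \<and> (if even k then g (s k) = C else \<bar>g (s k) - C\<bar> \<ge> \<epsilon>)) \<and> (<) (s k) (s (Suc k))"
    proof (rule alternating_sequence)
      show "\<exists>x\<in>{0<..<t}. g x = C" using q[of 0] t by auto
      show "\<exists>y\<in>{0<..<t}. (<) x y \<and> g y = C" if "x \<in> {0<..<t}" for x
        using q[of x] that by force
      show "\<exists>y\<in>{0<..<t}. (<) x y \<and> \<bar>g y - C\<bar> \<ge> \<epsilon>" if "x \<in> {0<..<t}" for x
        using p[of x] that by force
    qed
    then obtain s where "\<forall>k::nat. (s k \<in> {0<..<t} \<and> (if even k then g (s k) = C else \<bar>g (s k) - C\<bar> \<ge> \<epsilon>)) \<and> (<) (s k) (s (Suc k))"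
      by blast
    then have s: "0 < s k \<and> s k < t \<and> (if even k then g (s k) = C else \<bar>g (s k) - C\<bar> \<ge> \<epsilon>)"
      "(<) (s k) (s (Suc k))" for k
      by (auto split: if_splits)
    have "\<exists>k. \<bar>g (s (Suc k)) - g (s k)\<bar> < \<epsilon>"
    proof (rule BV_loc_no_oscillation[OF BV _ _ \<epsilon>(1), where T=t])
      show "incseq s \<or> decseq s" using s(2) by (auto intro!: incseq_SucI less_imp_le)
      have "0 \<le> s k \<and> s k \<le> t" for k using s(1)[of k] by linarith
      then show "range s \<subseteq> {0..t}" by auto
    qed
    then obtain k where k: "\<bar>g (s (Suc k)) - g (s k)\<bar> < \<epsilon>" ..
    show False using k s(1)[of k] s(1)[of "Suc k"] by (cases "even k") auto
  qed
  show "(g \<longlongrightarrow> C) (at_right t)"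
  proof (rule ccontr)
    assume "\<not> ?thesis"
    then obtain \<epsilon> where \<epsilon>: "\<epsilon> > 0" "\<not> eventually (\<lambda>s. dist (g s) C < \<epsilon>) (at_right t)"
      by (auto simp: tendsto_iff)
    have p: "\<exists>s. t < s \<and> s < b \<and> \<bar>g s - C\<bar> \<ge> \<epsilon>" if "t < b" for b
      using \<epsilon>(2) that unfolding eventually_at_right_field by (auto simp: dist_real_def not_less dest!: spec[of _ b])
    have q: "\<exists>s. t < s \<and> s < b \<and> g s = C" if "t < b" for b
      using AE_lebesgue_on_dense[OF C _ that] t by auto
    have "\<exists>s. \<forall>k::nat. (s k \<in> {t<..<t + 1} \<and> (if even k then g (s k) = C else \<bar>g (s k) - C\<bar> \<ge> \<epsilon>)) \<and> (>) (s k) (s (Suc k))"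
    proof (rule alternating_sequence)
      show "\<exists>x\<in>{t<..<t + 1}. g x = C" using q[of "t + 1"] t by auto
      show "\<exists>y\<in>{t<..<t + 1}. (>) x y \<and> g y = C" if "x \<in> {t<..<t + 1}" for x
        using q[of x] that by force
      show "\<exists>y\<in>{t<..<t + 1}. (>) x y \<and> \<bar>g y - C\<bar> \<ge> \<epsilon>" if "x \<in> {t<..<t + 1}" for x
        using p[of x] that by force
    qed
    then obtain s where "\<forall>k::nat. (s k \<in> {t<..<t + 1} \<and> (if even k then g (s k) = C else \<bar>g (s k) - C\<bar> \<ge> \<epsilon>)) \<and> (>) (s k) (s (Suc k))"
      by blast
    then have s: "t < s k \<and> s k < t + 1 \<and> (if even k then g (s k) = C else \<bar>g (s k) - C\<bar> \<ge> \<epsilon>)"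
      "(>) (s k) (s (Suc k))" for k
      by (auto split: if_splits)
    have "\<exists>k. \<bar>g (s (Suc k)) - g (s k)\<bar> < \<epsilon>"
    proof (rule BV_loc_no_oscillation[OF BV _ _ \<epsilon>(1), where T="t + 1"])
      show "incseq s \<or> decseq s" using s(2) by (auto intro!: decseq_SucI less_imp_le)
      have "0 \<le> s k \<and> s k \<le> t + 1" for k using s(1)[of k] t by linarith
      then show "range s \<subseteq> {0..t + 1}" by auto
    qed
    then obtain k where k: "\<bar>g (s (Suc k)) - g (s k)\<bar> < \<epsilon>" ..
    show False using k s(1)[of k] s(1)[of "Suc k"] by (cases "even k") auto
  qed
qed

text \<open>If \<open>L\<close> exceeded \<open>C\<close>, so would \<open>f\<close> on a whole
  interval next to \<tau>, which has positive measure.\<close>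

lemma one_sided_limit_le:
  fixes f :: "real \<Rightarrow> real"
  assumes le: "AE t in lebesgue_on {0<..}. f t \<le> C" and \<tau>: "\<tau> > 0"
  shows "(f \<longlongrightarrow> L) (at_left \<tau>) \<Longrightarrow> L \<le> C" and "(f \<longlongrightarrow> L) (at_right \<tau>) \<Longrightarrow> L \<le> C"
proof -
  assume "(f \<longlongrightarrow> L) (at_left \<tau>)"
  show "L \<le> C"
  proof (rule ccontr)
    assume "\<not> L \<le> C"
    then have "eventually (\<lambda>t. C < f t) (at_left \<tau>)"
      using \<open>(f \<longlongrightarrow> L) (at_left \<tau>)\<close> by (intro order_tendstoD) auto
    then obtain b where b: "b < \<tau>" "\<And>t. b < t \<Longrightarrow> t < \<tau> \<Longrightarrow> C < f t"
      unfolding eventually_at_left_field by blast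
    obtain t where "max b 0 < t" "t < \<tau>" "f t \<le> C"
      using AE_lebesgue_on_dense[OF le, of "max b 0" \<tau>] b \<tau> by auto
    then show False using b(2)[of t] by auto
  qed
next
  assume "(f \<longlongrightarrow> L) (at_right \<tau>)"
  show "L \<le> C"
  proof (rule ccontr)
    assume "\<not> L \<le> C"
    then have "eventually (\<lambda>t. C < f t) (at_right \<tau>)"
      using \<open>(f \<longlongrightarrow> L) (at_right \<tau>)\<close> by (intro order_tendstoD) auto
    then obtain b where b: "b > \<tau>" "\<And>t. \<tau> < t \<Longrightarrow> t < b \<Longrightarrow> C < f t"
      unfolding eventually_at_right_field by blast
    obtain t where "\<tau> < t" "t < b" "f t \<le> C"
      using AE_lebesgue_on_dense[OF le, of \<tau> b] b \<tau> by auto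
    then show False using b(2)[of t] by auto
  qed
qed

text \<open>Times at which \<open>f\<close> differs from \<open>C\<close> by at least
  \<open>1 / (n + 1)\<close> do not accumulate at any positive time. They form a countable set for
  each \<open>n\<close>, which requires no regularity of \<open>f\<close>.\<close>

lemma one_sided_limits_imp_AE:
  fixes f :: "real \<Rightarrow> real"
  assumes "\<And>\<tau>. \<tau> > 0 \<Longrightarrow> (f \<longlongrightarrow> C) (at_left \<tau>)" "\<And>\<tau>. \<tau> > 0 \<Longrightarrow> (f \<longlongrightarrow> C) (at_right \<tau>)"
  shows "AE t in lebesgue_on {0<..}. f t = C"
proof -
  let ?A = "\<lambda>n::nat. {t \<in> {0<..}. 1 / (real n + 1) \<le> \<bar>f t - C\<bar>}"
  have "countable (?A n)" for n
  proof -
    have "?A n sparse_in {0<..}"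
      unfolding sparse_in_eventually_iff[OF open_greaterThan]
    proof
      fix y :: real assume y: "y \<in> {0<..}"
      have "eventually (\<lambda>t. dist (f t) C < 1 / (real n + 1)) (at_left y)"
        "eventually (\<lambda>t. dist (f t) C < 1 / (real n + 1)) (at_right y)"
        using y assms by (auto intro!: tendstoD)
      then have "eventually (\<lambda>t. dist (f t) C < 1 / (real n + 1)) (at y)"
        by (simp add: eventually_at_split)
      then show "eventually (\<lambda>t. t \<notin> ?A n) (at y)"
        by eventually_elim (simp add: dist_real_def)
    qed
    from sparse_imp_countable[OF open_greaterThan this] have "countable ({0<..} \<inter> ?A n)" .
    moreover have "{0<..} \<inter> ?A n = ?A n" by blast
    ultimately show ?thesis by simp
  qed
  then have "countable (\<Union>n. ?A n)" by auto
  then have "AE t in lborel. t \<notin> (\<Union>n. ?A n)"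
    by (intro AE_not_in countable_imp_null_set_lborel)
  then have "AE t in lborel. t \<in> {0<..} \<longrightarrow> f t = C"
  proof eventually_elim
    case (elim t)
    show ?case
    proof (rule ccontr)
      assume a: "\<not> (t \<in> {0<..} \<longrightarrow> f t = C)"
      then obtain n where "1 / (real n + 1) < \<bar>f t - C\<bar>"
        using reals_Archimedean[of "\<bar>f t - C\<bar>"] by (auto simp: inverse_eq_divide add.commute)
      then show False using elim a by (auto dest!: spec[of _ n])
    qed
  qed
  then show ?thesis by (subst AE_lebesgue_on_iff) auto
qed

section \<open>From almost every time to all times, by weak continuity\<close>

lemma Lp_imp_integrable:
  fixes f :: "real ^ 'n \<Rightarrow> 'b::euclidean_space"
  assumes "f \<in> Lp p \<Omega>" "p \<ge> 1" "\<Omega> \<in> lmeasurable"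
  shows "integrable (lebesgue_on \<Omega>) f"
proof -
  interpret finite_measure "lebesgue_on \<Omega>" by (rule finite_measure_lebesgue_on[OF assms(3)])
  have f: "f \<in> borel_measurable (lebesgue_on \<Omega>)" "integrable (lebesgue_on \<Omega>) (\<lambda>x. norm (f x) powr p)"
    using assms(1) by (auto simp: Lp_def)
  show ?thesis
  proof (rule Bochner_Integration.integrable_bound)
    show "integrable (lebesgue_on \<Omega>) (\<lambda>x. 1 + norm (f x) powr p)" using f by simp
    have "norm (f x) \<le> 1 + norm (f x) powr p" for x
    proof (cases "norm (f x) \<le> 1")
      case False
      then have "norm (f x) powr 1 \<le> norm (f x) powr p" using assms(2) by (intro powr_mono) auto
      then show ?thesis using False by simp
    qed (simp add: add_increasing2)
    then show "AE x in lebesgue_on \<Omega>. norm (f x) \<le> norm (1 + norm (f x) powr p)"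
      by (intro AE_I2) (simp add: abs_of_nonneg)
  qed (rule f)
qed

text \<open>The test function is built from the deviation \<open>w\<close> at the time
  \<open>t\<close> itself. Normalised to norm at most 1 it lies in the dual space, and its pairing
  with \<open>w\<close> is nonnegative and vanishes only where \<open>w\<close> does. Weak
  continuity shows that the integral of this pairing is zero.\<close>

lemma C_weak_loc_const:
  fixes u :: "real \<Rightarrow> real ^ 'n \<Rightarrow> 'b::euclidean_space"
  assumes u: "u \<in> C_weak_loc p \<Omega>" and p: "p > 1" and \<Omega>: "\<Omega> \<in> lmeasurable"
    and ae: "AE t in lebesgue_on {0<..}. AE x in lebesgue_on \<Omega>. u t x = c" and t: "t > 0"
  shows "AE x in lebesgue_on \<Omega>. u t x = c"
proof -
  interpret finite_measure "lebesgue_on \<Omega>" by (rule finite_measure_lebesgue_on[OF \<Omega>])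
  have uL: "u s \<in> Lp p \<Omega>" if "s \<ge> 0" for s using u that by (simp add: C_weak_loc_def)
  have iu: "integrable (lebesgue_on \<Omega>) (u s)" if "s \<ge> 0" for s
    using Lp_imp_integrable[OF uL[OF that] _ \<Omega>] p by simp
  then have mu: "u s \<in> borel_measurable (lebesgue_on \<Omega>)" if "s \<ge> 0" for s
    using that by auto
  note [measurable] = mu[OF less_imp_le[OF t]]
  define w where "w x = u t x - c" for x
  define \<psi> where "\<psi> x = w x /\<^sub>R (1 + norm (w x))" for x
  have [measurable]: "w \<in> borel_measurable (lebesgue_on \<Omega>)" "\<psi> \<in> borel_measurable (lebesgue_on \<Omega>)"
    unfolding w_def \<psi>_def by measurable
  have \<psi>1: "norm (\<psi> x) \<le> 1" for x
  proof -
    have "norm (\<psi> x) = norm (w x) / (1 + norm (w x))"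
      by (simp add: \<psi>_def divide_inverse mult.commute abs_of_pos add_pos_nonneg)
    also have "\<dots> \<le> 1" by (simp add: divide_le_eq_1 add_pos_nonneg)
    finally show ?thesis .
  qed
  have iw\<psi>: "integrable (lebesgue_on \<Omega>) (\<lambda>x. v x \<bullet> \<psi> x)" if "integrable (lebesgue_on \<Omega>) v" for v :: "real ^ 'n \<Rightarrow> 'b"
  proof (rule Bochner_Integration.integrable_bound[OF that])
    show "(\<lambda>x. v x \<bullet> \<psi> x) \<in> borel_measurable (lebesgue_on \<Omega>)"
      using that by (intro borel_measurable_inner) auto
    have "norm (v x \<bullet> \<psi> x) \<le> norm (v x)" for x
      using Cauchy_Schwarz_ineq2[of "v x" "\<psi> x"] mult_left_mono[OF \<psi>1[of x], of "norm (v x)"] by simp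
    then show "AE x in lebesgue_on \<Omega>. norm (v x \<bullet> \<psi> x) \<le> norm (v x)" by simp
  qed
  have "\<psi> \<in> Lp (p / (p - 1)) \<Omega>"
  proof -
    have "integrable (lebesgue_on \<Omega>) (\<lambda>x. norm (\<psi> x) powr (p / (p - 1)))"
    proof (rule integrable_const_bound[where B=1])
      have "norm (\<psi> x) powr (p / (p - 1)) \<le> 1 powr (p / (p - 1))" for x
        using \<psi>1[of x] p by (intro powr_mono2) auto
      then show "AE x in lebesgue_on \<Omega>. norm (norm (\<psi> x) powr (p / (p - 1))) \<le> 1" by simp
    qed measurable
    then show ?thesis by (simp add: Lp_def)
  qed
  then have cont: "continuous_on {0..} (\<lambda>s. LINT x|lebesgue_on \<Omega>. u s x \<bullet> \<psi> x)"
    using u by (simp add: C_weak_loc_def)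
  let ?g = "\<lambda>s. LINT x|lebesgue_on \<Omega>. u s x \<bullet> \<psi> x" and ?c = "LINT x|lebesgue_on \<Omega>. c \<bullet> \<psi> x"
  have aeg: "AE s in lebesgue_on {0<..}. ?g s = ?c"
  proof -
    have "AE s in lebesgue_on {0<..}. s > (0::real)" by (rule AE_I2) simp
    then show ?thesis
      using ae
    proof eventually_elim
      case (elim s)
      have "(\<lambda>x. u s x \<bullet> \<psi> x) \<in> borel_measurable (lebesgue_on \<Omega>)"
        using mu[of s] elim by (intro borel_measurable_inner) auto
      then show ?case
        using elim by (intro integral_cong_AE) auto
    qed
  qed
  \<comment> \<open>The time \<open>t\<close> may belong to the exceptional null set; continuity
    from the right carries the equality over to it.\<close>
  have gt: "?g t = ?c"
  proof -
    have lim: "(?g \<longlongrightarrow> ?g t) (at_right t)"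
      using cont t unfolding continuous_on_def
      by (meson atLeast_iff greaterThan_iff less_imp_le order_less_trans subsetI tendsto_within_subset)
    show ?thesis
    proof (rule antisym)
      show "?g t \<le> ?c"
        by (rule one_sided_limit_le(2)[OF _ t lim]) (use aeg in auto)
      have "- ?g t \<le> - ?c"
        by (rule one_sided_limit_le(2)[OF _ t tendsto_minus[OF lim]]) (use aeg in auto)
      then show "?c \<le> ?g t" by simp
    qed
  qed
  have "(LINT x|lebesgue_on \<Omega>. w x \<bullet> \<psi> x) = 0"
    using iw\<psi>[OF iu[of t]] iw\<psi>[of "\<lambda>x. c"] t gt by (simp add: w_def inner_diff_left)
  moreover have "integrable (lebesgue_on \<Omega>) (\<lambda>x. w x \<bullet> \<psi> x)"
    using iu[of t] t by (intro iw\<psi>) (simp add: w_def[abs_def])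
  moreover have nn: "w x \<bullet> \<psi> x \<ge> 0" for x by (simp add: \<psi>_def)
  ultimately have "AE x in lebesgue_on \<Omega>. w x \<bullet> \<psi> x = 0"
    by (subst (asm) integral_nonneg_eq_0_iff_AE) auto
  then show ?thesis
  proof eventually_elim
    case (elim x)
    have "1 + norm (w x) \<noteq> 0" by (metis add_nonneg_eq_0_iff norm_ge_zero zero_le_one zero_neq_one)
    then show ?case using elim by (simp add: \<psi>_def w_def)
  qed
qed

section \<open>Test functions of time alone\<close>

lemma C1_scalar_time_only:
  fixes \<Omega> :: "(real ^ 'n) set"
  assumes "\<And>t. t \<ge> 0 \<Longrightarrow> (f has_real_derivative f' t) (at t)" "continuous_on {0..} f'"
  shows "C1_scalar \<Omega> (\<lambda>t x. f t) (\<lambda>t x. f' t) (\<lambda>t x. 0)"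
  unfolding C1_scalar_def
proof (intro conjI allI impI ballI)
  fix t :: real and x :: "real ^ 'n"
  assume t: "t \<ge> 0"
  have "(f has_derivative (\<lambda>s. f' t * s)) (at t)"
    using assms(1)[OF t] by (simp add: has_field_derivative_def)
  from has_derivative_compose[OF has_derivative_fst[OF has_derivative_ident], of f "\<lambda>s. f' t * s" "(t, x)"] this
  have "((\<lambda>z. f (fst z)) has_derivative (\<lambda>z. f' t * fst z)) (at (t, x) within {0..} \<times> closure \<Omega>)"
    by simp
  then show "((\<lambda>(t, x). f t) has_derivative (\<lambda>(s, h). s * f' t + 0 \<bullet> h)) (at (t, x) within {0..} \<times> closure \<Omega>)"
    by (simp add: case_prod_beta' mult.commute)
next
  have "continuous_on ({0..} \<times> closure \<Omega>) (\<lambda>z. f' (fst z))"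
    by (intro continuous_on_compose2[OF assms(2)] continuous_intros) auto
  then show "continuous_on ({0..} \<times> closure \<Omega>) (\<lambda>(t, x). f' t)"
    by (simp add: case_prod_beta')
qed (simp add: case_prod_beta')

lemma continuity_equation_mass:
  fixes \<Omega> :: "(real ^ 'n) set"
  assumes ce: "continuity_equation \<Omega> \<rho>0 V" and \<Omega>: "bounded \<Omega>" and t: "t > 0"
  shows "(LINT x|lebesgue_on \<Omega>. mean_density (V t x)) = (LINT x|lebesgue_on \<Omega>. mean_density (V 0 x))"
proof -
  \<comment> \<open>The continuity equation demands compact support. This function of time is 1 up
    to \<open>t\<close>, with derivative 0 there, and vanishes from \<open>t + 2\<close> on.\<close>
  let ?f = "\<lambda>s. ramp (t + 2 - s)" and ?f' = "\<lambda>s. - ramp' (t + 2 - s)"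
  have d: "(?f has_real_derivative ?f' s) (at s)" for s
  proof -
    have "((\<lambda>s. t + 2 - s) has_real_derivative - 1) (at s)" by (auto intro!: derivative_eq_intros)
    from DERIV_chain2[OF DERIV_ramp this] show ?thesis by simp
  qed
  have C1: "C1_scalar \<Omega> (\<lambda>s x. ?f s) (\<lambda>s x. ?f' s) (\<lambda>s x. 0)"
    by (intro C1_scalar_time_only d continuous_intros continuous_on_compose2[OF continuous_on_ramp(2)[of UNIV]]) auto
  have cs: "compact_support \<Omega> (\<lambda>s x. ?f s)"
    unfolding compact_support_def
  proof (intro exI[of _ "{0..t + 2} \<times> closure \<Omega>"] conjI allI impI ballI)
    show "compact ({0..t + 2} \<times> closure \<Omega>)"
      using \<Omega> by (intro compact_Times) (auto simp: compact_closure)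
    show "?f s = 0" if "0 \<le> s" "x \<in> closure \<Omega>" "(s, x) \<notin> {0..t + 2} \<times> closure \<Omega>" for s x
      using that by (intro ramp_simps) auto
  qed auto
  have ce': "(LINT s|lebesgue_on {0..t}. LINT x|lebesgue_on \<Omega>.
         mean_density (V s x) * ?f' s + mean_momentum (V s x) \<bullet> 0) =
      (LINT x|lebesgue_on \<Omega>. mean_density (V t x) * ?f t) -
      (LINT x|lebesgue_on \<Omega>. mean_density (V 0 x) * ?f 0)"
    using ce[unfolded continuity_equation_def, THEN conjunct2, rule_format,
        of 0 t "\<lambda>s x. ?f s" "\<lambda>s x. ?f' s" "\<lambda>s x. 0"] C1 cs t
    by simp
  have "(LINT s|lebesgue_on {0..t}. LINT x|lebesgue_on \<Omega>.
         mean_density (V s x) * ?f' s + mean_momentum (V s x) \<bullet> 0) = (LINT s|lebesgue_on {0..t}. 0)"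
    by (rule Bochner_Integration.integral_cong) (auto simp: ramp_simps)
  moreover have "?f t = 1" "?f 0 = 1" using t by (auto intro: ramp_simps)
  ultimately show ?thesis using ce' by simp
qed

lemma entropy_inequality_total:
  fixes \<Omega> :: "(real ^ 'n) set"
  assumes ei: "entropy_inequality \<Omega> S0 V" and t: "0 \<le> \<tau>1" "\<tau>1 < \<tau>2"
  shows "\<exists>a b. (if \<tau>1 = 0 then a = (LINT x|lebesgue_on \<Omega>. S0 x)
              else ((\<lambda>t. LINT x|lebesgue_on \<Omega>. mean_entropy (V t x)) \<longlongrightarrow> a) (at_left \<tau>1)) \<and>
             ((\<lambda>t. LINT x|lebesgue_on \<Omega>. mean_entropy (V t x)) \<longlongrightarrow> b) (at_right \<tau>2) \<and> a \<le> b"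
proof -
  \<comment> \<open>The entropy inequality is tested without compact support, so the constant 1 is
    admissible and both integrands on the left vanish.\<close>
  have C1: "C1_scalar \<Omega> (\<lambda>s x. 1) (\<lambda>s x. 0) (\<lambda>s x. 0)"
    by (intro C1_scalar_time_only) auto
  obtain a b where ab:
    "if \<tau>1 = 0 then a = (LINT x|lebesgue_on \<Omega>. S0 x * 1)
      else ((\<lambda>t. LINT x|lebesgue_on \<Omega>. mean_entropy (V t x) * 1) \<longlongrightarrow> a) (at_left \<tau>1)"
    "((\<lambda>t. LINT x|lebesgue_on \<Omega>. mean_entropy (V t x) * 1) \<longlongrightarrow> b) (at_right \<tau>2)"
    "(LINT t|lebesgue_on {\<tau>1..\<tau>2}. LINT x|lebesgue_on \<Omega>.
      mean_entropy (V t x) * 0 + mean_entropy_flux (V t x) \<bullet> 0) \<le> b - a"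
    using ei[unfolded entropy_inequality_def, rule_format, of \<tau>1 \<tau>2 "\<lambda>s x. 1" "\<lambda>s x. 0" "\<lambda>s x. 0"] C1 t
    by auto
  show ?thesis
    using ab by (intro exI[of _ a] exI[of _ b]) (cases "\<tau>1 = 0"; simp)
qed

text \<open>This holds by completeness of \<open>lebesgue\<close>. It lends the measurability of
  \<rho> and \<open>S\<close> to the averages of the Young measure.\<close>

lemma borel_measurable_lebesgue_on_AE:
  fixes f g :: "'a::euclidean_space \<Rightarrow> 'b::euclidean_space"
  assumes f: "f \<in> borel_measurable (lebesgue_on S)" and S: "S \<in> sets lebesgue"
    and ae: "AE x in lebesgue_on S. f x = g x"
  shows "g \<in> borel_measurable (lebesgue_on S)"
proof -
  have "(\<lambda>x. if x \<in> S then f x else 0) \<in> borel_measurable lebesgue"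
    using f S by (rule borel_measurable_if_I)
  moreover have "AE x in lebesgue. x \<in> S \<longrightarrow> f x = g x"
    using ae S by (subst (asm) AE_restrict_space_iff) auto
  then have "AE x in lebesgue. (if x \<in> S then f x else 0) = (if x \<in> S then g x else 0)"
    by eventually_elim auto
  ultimately have "(\<lambda>x. if x \<in> S then g x else 0) \<in> borel_measurable lebesgue"
    by (rule borel_measurable_AE)
  then show ?thesis by (rule borel_measurable_if_D)
qed

section \<open>Maximal solutions\<close>

text \<open>For the entropy the claim concerns the values at \<open>t-\<close> and \<open>t+\<close>
  in the dual of \<open>W0\<close> and the values at almost every time, since a value at a jump
  depends on the representative. Existence of \<open>Sbar\<close> belongs to the claim, because
  positivity of \<open>E0\<close> is itself a consequence.\<close>

theorem proposition5p1:
  fixes \<Omega> :: "(real ^ 'n) set" and \<gamma> s0 l \<rho>bar Sinit E0 :: real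
    and \<rho> S :: "real \<Rightarrow> real ^ 'n \<Rightarrow> real" and m :: "real \<Rightarrow> real ^ 'n \<Rightarrow> real ^ 'n"
  assumes "CARD('n) \<in> {1, 2, 3}" and "smooth_bounded_domain \<Omega>"
    and "\<gamma> > 1" and "l > real CARD('n) / 2 + 1"
    and "\<rho>bar > 0"
    and "maximal_dissipative_solution \<Omega> \<gamma> s0 l (\<lambda>x. \<rho>bar) (\<lambda>x. 0) (\<lambda>x. Sinit) E0 \<rho> m S"
  shows "(\<exists>!Sbar :: real.
       (LINT x|lebesgue_on \<Omega>. cv \<gamma> * \<rho>bar powr \<gamma> * exp (Sbar / (cv \<gamma> * \<rho>bar))) = E0) \<and>
    (\<forall>Sbar :: real.
       (LINT x|lebesgue_on \<Omega>. cv \<gamma> * \<rho>bar powr \<gamma> * exp (Sbar / (cv \<gamma> * \<rho>bar))) = E0 \<longrightarrow>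
       (\<forall>t>0. (AE x in lebesgue_on \<Omega>. \<rho> t x = \<rho>bar) \<and> (AE x in lebesgue_on \<Omega>. m t x = 0) \<and>
         has_weak_limit l \<Omega> S (\<lambda>x. Sbar) (at_left t) \<and>
         has_weak_limit l \<Omega> S (\<lambda>x. Sbar) (at_right t)) \<and>
       (AE t in lebesgue_on {0<..}. AE x in lebesgue_on \<Omega>. S t x = Sbar))"
proof -
  note dom = assms(2) and \<gamma> = assms(3) and \<rho>bar = assms(5)
  have \<Omega>: "open \<Omega>" "bounded \<Omega>" "\<Omega> \<noteq> {}" using dom by (auto simp: smooth_bounded_domain_def)
  have m\<Omega>: "\<Omega> \<in> lmeasurable" using \<Omega> by (simp add: lmeasurable_open)
  interpret finite_measure "lebesgue_on \<Omega>" by (rule finite_measure_lebesgue_on[OF m\<Omega>])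
  define D where "D = measure lebesgue \<Omega>"
  have "\<not> negligible \<Omega>" using \<Omega> open_not_negligible by blast
  then have D: "D > 0"
    using m\<Omega> measure_nonneg[of lebesgue \<Omega>] unfolding D_def by (auto simp: negligible_iff_measure less_le)
  have sp: "measure (lebesgue_on \<Omega>) \<Omega> = D"
    unfolding D_def using m\<Omega> by (simp add: measure_restrict_space fmeasurableD)
  have const: "(LINT x|lebesgue_on \<Omega>. c) = D * c" for c :: real by (simp add: sp)
  \<comment> \<open>The energy density of the constant state with density \<open>\<rho>bar\<close>
    and entropy \<sigma>. It is increasing in \<sigma>, so energy bounds become entropy
    bounds.\<close>
  define K where "K \<sigma> = cv \<gamma> * \<rho>bar powr \<gamma> * exp (\<sigma> / (cv \<gamma> * \<rho>bar))" for \<sigma>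
  have cvp: "cv \<gamma> * \<rho>bar > 0" using cv_pos[OF \<gamma>] \<rho>bar by simp
  have Kpos: "K \<sigma> > 0" for \<sigma> using cv_pos[OF \<gamma>] \<rho>bar by (simp add: K_def)
  have Kle: "K \<sigma> \<le> K \<sigma>' \<longleftrightarrow> \<sigma> \<le> \<sigma>'" for \<sigma> \<sigma>'
  proof -
    have "cv \<gamma> * \<rho>bar powr \<gamma> > 0" using cv_pos[OF \<gamma>] \<rho>bar by simp
    then have "K \<sigma> \<le> K \<sigma>' \<longleftrightarrow> \<sigma> / (cv \<gamma> * \<rho>bar) \<le> \<sigma>' / (cv \<gamma> * \<rho>bar)"
      unfolding K_def by (simp only: mult_le_cancel_left_pos exp_le_cancel_iff)
    then show ?thesis using cvp by (simp only: divide_le_cancel) auto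
  qed
  have sol: "dissipative_solution \<Omega> \<gamma> s0 l (\<lambda>x. \<rho>bar) (\<lambda>x. 0) (\<lambda>x. Sinit) E0 \<rho> m S"
    and maxi: "\<And>\<rho>' m' S'. dissipative_solution \<Omega> \<gamma> s0 l (\<lambda>x. \<rho>bar) (\<lambda>x. 0) (\<lambda>x. Sinit) E0 \<rho>' m' S' \<Longrightarrow>
       more_dissipative \<Omega> (\<lambda>x. Sinit) S' S \<Longrightarrow> same_production \<Omega> (\<lambda>x. Sinit) S' S"
    using assms(6) unfolding maximal_dissipative_solution_def by blast+
  have reg: "0 \<le> E0" "\<rho> \<in> C_weak_loc \<gamma> \<Omega>" "m \<in> C_weak_loc (2 * \<gamma> / (\<gamma> + 1)) \<Omega>"
    "S \<in> Linf_Lp \<gamma> \<Omega>" "S \<in> BV_weak_loc l \<Omega>"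
    using sol unfolding dissipative_solution_def by blast+
  obtain V Ckin Cint Cconv where
    mv: "dissipative_mv_solution \<Omega> \<gamma> s0 (\<lambda>x. \<rho>bar) (\<lambda>x. 0) (\<lambda>x. Sinit) E0 V Ckin Cint Cconv"
    and V: "\<And>t. t \<ge> 0 \<Longrightarrow> AE x in lebesgue_on \<Omega>. \<rho> t x = mean_density (V t x) \<and> m t x = mean_momentum (V t x) \<and>
          S t x = mean_entropy (V t x)"
    using sol unfolding dissipative_solution_def by blast
  have p2: "2 * \<gamma> / (\<gamma> + 1) > 1" using \<gamma> by (simp add: field_simps)
  have Lp: "\<rho> t \<in> Lp \<gamma> \<Omega>" "m t \<in> Lp (2 * \<gamma> / (\<gamma> + 1)) \<Omega>" "S t \<in> Lp \<gamma> \<Omega>" if "t \<ge> 0" for t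
    using reg that by (auto simp: C_weak_loc_def Linf_Lp_def)
  have int: "integrable (lebesgue_on \<Omega>) (\<rho> t)" "integrable (lebesgue_on \<Omega>) (m t)"
    "integrable (lebesgue_on \<Omega>) (S t)" if "t \<ge> 0" for t
    using Lp[OF that] p2 \<gamma> m\<Omega> by (auto intro: Lp_imp_integrable)
  have meas: "\<rho> t \<in> borel_measurable (lebesgue_on \<Omega>)" "m t \<in> borel_measurable (lebesgue_on \<Omega>)"
    "S t \<in> borel_measurable (lebesgue_on \<Omega>)" if "t \<ge> 0" for t
    using int[OF that] by auto
  \<comment> \<open>A Young measure is measurable over positive times only. At time 0, where the
    mass is compared with the data, measurability is inherited from \<rho> and
    \<open>S\<close>.\<close>
  have meansm: "(\<lambda>x. mean_density (V t x)) \<in> borel_measurable (lebesgue_on \<Omega>)"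
    "(\<lambda>x. mean_entropy (V t x)) \<in> borel_measurable (lebesgue_on \<Omega>)" if t: "t \<ge> 0" for t
  proof -
    have "AE x in lebesgue_on \<Omega>. \<rho> t x = mean_density (V t x)" "AE x in lebesgue_on \<Omega>. S t x = mean_entropy (V t x)"
      using V[OF t] by (eventually_elim, simp)+
    then show "(\<lambda>x. mean_density (V t x)) \<in> borel_measurable (lebesgue_on \<Omega>)"
      "(\<lambda>x. mean_entropy (V t x)) \<in> borel_measurable (lebesgue_on \<Omega>)"
      using meas[OF t] fmeasurableD[OF m\<Omega>] by (blast intro: borel_measurable_lebesgue_on_AE)+
  qed
  have mass: "(LINT x|lebesgue_on \<Omega>. \<rho> t x) = \<rho>bar * D" if t: "t > 0" for t
  proof -
    have ce: "continuity_equation \<Omega> (\<lambda>x. \<rho>bar) V" using mv by (simp add: dissipative_mv_solution_def)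
    have "(LINT x|lebesgue_on \<Omega>. \<rho> t x) = (LINT x|lebesgue_on \<Omega>. mean_density (V t x))"
      using V[of t] t meas meansm by (intro integral_cong_AE) auto
    also have "\<dots> = (LINT x|lebesgue_on \<Omega>. mean_density (V 0 x))"
      by (rule continuity_equation_mass[OF ce \<Omega>(2) t])
    also have "\<dots> = (LINT x|lebesgue_on \<Omega>. \<rho>bar)"
      using ce meansm by (intro integral_cong_AE) (auto simp: continuity_equation_def)
    finally show ?thesis by (simp add: sp mult.commute)
  qed
  define f where "f t = (LINT x|lebesgue_on \<Omega>. S t x)" for t
  have fV: "f t = (LINT x|lebesgue_on \<Omega>. mean_entropy (V t x))" if "t \<ge> 0" for t
    unfolding f_def using V[OF that] that meas meansm by (intro integral_cong_AE) auto
  \<comment> \<open>The number \<open>f t / D\<close> is the mean entropy at time \<open>t\<close>.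
    The equality case is kept as an implication, to be released when maximality has determined
    \<open>f\<close>.\<close>
  have good: "AE t in lebesgue_on {0<..}. D * K (f t / D) \<le> E0 \<and>
      (D * K (f t / D) = E0 \<longrightarrow> (AE x in lebesgue_on \<Omega>. \<rho> t x = \<rho>bar \<and> m t x = 0 \<and> S t x = f t / D)) \<and>
      s0 * \<rho>bar \<le> f t / D"
  proof -
    have "AE t in lebesgue_on {0<..}. t > (0::real)" by (rule AE_I2) simp
    then show ?thesis
      using dissipative_mv_solution_AE_time[OF \<Omega>(1) \<gamma> mv]
    proof eventually_elim
      case (elim t)
      then have t: "t > 0" "t \<ge> 0" by auto
      have en: "(\<integral>\<^sup>+x. mean_energy \<gamma> (V t x) \<partial>lebesgue_on \<Omega>) \<le> ennreal E0" using elim by blast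
      have ae: "AE x in lebesgue_on \<Omega>. (\<rho> t x \<ge> 0 \<and> (\<rho> t x = 0 \<longrightarrow> S t x \<le> 0) \<and> s0 * \<rho> t x \<le> S t x) \<and>
          ennreal (energy_fun \<gamma> (\<rho> t x) (m t x) (S t x)) \<le> mean_energy \<gamma> (V t x)"
        using elim(2)[THEN conjunct2] V[OF t(2)] by eventually_elim auto
      have "(\<integral>\<^sup>+x. ennreal (energy_fun \<gamma> (\<rho> t x) (m t x) (S t x)) \<partial>lebesgue_on \<Omega>) \<le>
          (\<integral>\<^sup>+x. mean_energy \<gamma> (V t x) \<partial>lebesgue_on \<Omega>)"
        using ae by (intro nn_integral_mono_AE) auto
      then have en': "(\<integral>\<^sup>+x. ennreal (energy_fun \<gamma> (\<rho> t x) (m t x) (S t x)) \<partial>lebesgue_on \<Omega>) \<le> ennreal E0"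
        using en by (rule order_trans)
      have ae': "AE x in lebesgue_on \<Omega>. \<rho> t x \<ge> 0 \<and> (\<rho> t x = 0 \<longrightarrow> S t x \<le> 0) \<and> s0 * \<rho> t x \<le> S t x"
        using ae by eventually_elim blast
      have fD: "(LINT x|lebesgue_on \<Omega>. S t x) = f t / D * measure lebesgue \<Omega>"
        using D by (simp add: f_def flip: D_def)
      note eq = energy_bound_imp_equilibrium[OF \<gamma> \<rho>bar m\<Omega> D[unfolded D_def] int(1)[OF t(2)] int(3)[OF t(2)]
          meas(2)[OF t(2)] ae' en' reg(1) mass[OF t(1), unfolded D_def] fD]
      show ?case
        unfolding K_def using eq by (simp only: D_def) blast
    qed
  qed
  \<comment> \<open>A single good time suffices: as \<open>K\<close> is positive it shows
    \<open>E0 > 0\<close>, and it transfers the lower entropy bound to \<open>Sb\<close>.\<close>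
  obtain t1 where t1: "D * K (f t1 / D) \<le> E0" "s0 * \<rho>bar \<le> f t1 / D"
    using AE_lebesgue_on_dense[OF good, of 0 1] by auto
  have E0: "E0 > 0" using t1(1) D Kpos[of "f t1 / D"] mult_pos_pos[of D "K (f t1 / D)"] by linarith
  define Sb where "Sb = cv \<gamma> * \<rho>bar * ln (E0 / (D * (cv \<gamma> * \<rho>bar powr \<gamma>)))"
  have Sb: "D * K Sb = E0"
  proof -
    have "D * (cv \<gamma> * \<rho>bar powr \<gamma>) > 0" using D cv_pos[OF \<gamma>] \<rho>bar by simp
    then show ?thesis
      using E0 D cv_pos[OF \<gamma>] \<rho>bar by (simp add: K_def Sb_def)
  qed
  have uniq: "D * K \<sigma> = E0 \<longleftrightarrow> \<sigma> = Sb" for \<sigma>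
    using Sb D Kle[of \<sigma> Sb] Kle[of Sb \<sigma>] by (metis mult_left_cancel order_antisym order_refl less_irrefl)
  have Kbd: "\<sigma> \<le> Sb" if "D * K \<sigma> \<le> E0" for \<sigma>
    using that Kle[of \<sigma> Sb] D unfolding Sb[symmetric] by simp
  have ei: "entropy_inequality \<Omega> (\<lambda>x. Sinit) V" using mv by (simp add: dissipative_mv_solution_def)
  have fle: "AE t in lebesgue_on {0<..}. f t \<le> D * Sb"
    using good
  proof eventually_elim
    case (elim t)
    then have "f t / D \<le> Sb" using Kbd by blast
    then show ?case using D by (simp add: field_simps)
  qed
  have right: "\<exists>b. (f \<longlongrightarrow> b) (at_right \<tau>) \<and> D * Sinit \<le> b" if \<tau>: "\<tau> > 0" for \<tau>
  proof -
    obtain b where b: "((\<lambda>t. LINT x|lebesgue_on \<Omega>. mean_entropy (V t x)) \<longlongrightarrow> b) (at_right \<tau>)" "D * Sinit \<le> b"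
      using entropy_inequality_total[OF ei _ \<tau>] by (auto simp: sp)
    have "eventually (\<lambda>t. (LINT x|lebesgue_on \<Omega>. mean_entropy (V t x)) = f t) (at_right \<tau>)"
      using eventually_at_right_less[of \<tau>] by eventually_elim (use fV \<tau> in auto)
    then show ?thesis using b by (auto dest: tendsto_cong)
  qed
  have left: "\<exists>a. (f \<longlongrightarrow> a) (at_left \<tau>)" if \<tau>: "\<tau> > 0" for \<tau>
  proof -
    obtain a where a: "((\<lambda>t. LINT x|lebesgue_on \<Omega>. mean_entropy (V t x)) \<longlongrightarrow> a) (at_left \<tau>)"
      using entropy_inequality_total[OF ei _ less_add_one, of \<tau>] \<tau> by auto
    have "eventually (\<lambda>t. t \<in> {0<..<\<tau>}) (at_left \<tau>)" using \<tau> by (rule eventually_at_left_real)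
    then have "eventually (\<lambda>t. (LINT x|lebesgue_on \<Omega>. mean_entropy (V t x)) = f t) (at_left \<tau>)"
      by eventually_elim (use fV in auto)
    then show ?thesis using a by (auto dest: tendsto_cong)
  qed
  \<comment> \<open>Started at time 0, the entropy inequality bounds every right limit of
    \<open>f\<close> from below by \<open>D * Sinit\<close>, while the energy bounds it from above
    by \<open>D * Sb\<close>.\<close>
  have "Sinit \<le> Sb"
  proof -
    obtain b where "(f \<longlongrightarrow> b) (at_right 1)" "D * Sinit \<le> b" using right[of 1] by auto
    then have "D * Sinit \<le> D * Sb" using one_sided_limit_le(2)[OF fle, of 1 b] by simp
    then show ?thesis using D by simp
  qed
  moreover have "s0 * \<rho>bar \<le> Sb" using t1 Kbd by force
  ultimately have comp: "dissipative_solution \<Omega> \<gamma> s0 l (\<lambda>x. \<rho>bar) (\<lambda>x. 0) (\<lambda>x. Sinit) E0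
      (\<lambda>t x. \<rho>bar) (\<lambda>t x. 0) (\<lambda>t x. Sb)"
    using Sb by (intro constant_state_dissipative dom \<gamma> \<rho>bar) (auto simp: K_def D_def)
  have prod: "entropy_production \<Omega> (\<lambda>x. Sinit) S t = f t - D * Sinit" if "t \<ge> 0" for t
    unfolding entropy_production_def f_def using int(3)[OF that] by (simp add: sp)
  have prod_bar: "entropy_production \<Omega> (\<lambda>x. Sinit) (\<lambda>t x. Sb) = (\<lambda>t. D * (Sb - Sinit))"
    by (simp add: entropy_production_def sp fun_eq_iff)
  have Lim_bar: "Lim F (entropy_production \<Omega> (\<lambda>x. Sinit) (\<lambda>t x. Sb)) = D * (Sb - Sinit)"
    if "F \<noteq> bot" for F :: "real filter"
    unfolding prod_bar by (intro tendsto_Lim that tendsto_const)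
  have LimL: "Lim (at_left \<tau>) (entropy_production \<Omega> (\<lambda>x. Sinit) S) = a - D * Sinit"
    if "\<tau> > 0" "(f \<longlongrightarrow> a) (at_left \<tau>)" for \<tau> a
  proof (rule tendsto_Lim)
    have "eventually (\<lambda>t. t \<in> {0<..<\<tau>}) (at_left \<tau>)" using that by (intro eventually_at_left_real)
    then have "eventually (\<lambda>t. f t - D * Sinit = entropy_production \<Omega> (\<lambda>x. Sinit) S t) (at_left \<tau>)"
      by eventually_elim (use prod in auto)
    moreover have "((\<lambda>t. f t - D * Sinit) \<longlongrightarrow> a - D * Sinit) (at_left \<tau>)"
      using that by (intro tendsto_intros)
    ultimately show "(entropy_production \<Omega> (\<lambda>x. Sinit) S \<longlongrightarrow> a - D * Sinit) (at_left \<tau>)"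
      by (rule Lim_transform_eventually[rotated])
  qed simp
  have LimR: "Lim (at_right \<tau>) (entropy_production \<Omega> (\<lambda>x. Sinit) S) = b - D * Sinit"
    if "\<tau> > 0" "(f \<longlongrightarrow> b) (at_right \<tau>)" for \<tau> b
  proof (rule tendsto_Lim)
    have "eventually (\<lambda>t. f t - D * Sinit = entropy_production \<Omega> (\<lambda>x. Sinit) S t) (at_right \<tau>)"
      using eventually_at_right_less[of \<tau>] by eventually_elim (use prod that in auto)
    moreover have "((\<lambda>t. f t - D * Sinit) \<longlongrightarrow> b - D * Sinit) (at_right \<tau>)"
      using that by (intro tendsto_intros)
    ultimately show "(entropy_production \<Omega> (\<lambda>x. Sinit) S \<longlongrightarrow> b - D * Sinit) (at_right \<tau>)"
      by (rule Lim_transform_eventually[rotated])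
  qed simp
  have "more_dissipative \<Omega> (\<lambda>x. Sinit) (\<lambda>t x. Sb) S"
    unfolding more_dissipative_def
  proof (intro allI impI)
    fix \<tau> :: real assume \<tau>: "\<tau> > 0"
    obtain a b where ab: "(f \<longlongrightarrow> a) (at_left \<tau>)" "(f \<longlongrightarrow> b) (at_right \<tau>)"
      using left[OF \<tau>] right[OF \<tau>] by blast
    have "a \<le> D * Sb" "b \<le> D * Sb"
      using one_sided_limit_le[OF fle \<tau>] ab by blast+
    then show "Lim (at_left \<tau>) (entropy_production \<Omega> (\<lambda>x. Sinit) S) \<le>
        Lim (at_left \<tau>) (entropy_production \<Omega> (\<lambda>x. Sinit) (\<lambda>t x. Sb)) \<and>
      Lim (at_right \<tau>) (entropy_production \<Omega> (\<lambda>x. Sinit) S) \<le>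
        Lim (at_right \<tau>) (entropy_production \<Omega> (\<lambda>x. Sinit) (\<lambda>t x. Sb))"
      by (simp add: LimL[OF \<tau> ab(1)] LimR[OF \<tau> ab(2)] Lim_bar right_diff_distrib)
  qed
  then have same: "same_production \<Omega> (\<lambda>x. Sinit) (\<lambda>t x. Sb) S" by (rule maxi[OF comp])
  have "(f \<longlongrightarrow> D * Sb) (at_left \<tau>)" if \<tau>: "\<tau> > 0" for \<tau>
  proof -
    obtain a where a: "(f \<longlongrightarrow> a) (at_left \<tau>)" using left[OF \<tau>] ..
    moreover have "Lim (at_left \<tau>) (entropy_production \<Omega> (\<lambda>x. Sinit) (\<lambda>t x. Sb)) =
        Lim (at_left \<tau>) (entropy_production \<Omega> (\<lambda>x. Sinit) S)"
      using same \<tau> less_imp_le[OF \<tau>] unfolding same_production_def by blast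
    then have "a = D * Sb" by (simp add: LimL[OF \<tau> a] Lim_bar right_diff_distrib)
    ultimately show ?thesis by simp
  qed
  moreover have "(f \<longlongrightarrow> D * Sb) (at_right \<tau>)" if \<tau>: "\<tau> > 0" for \<tau>
  proof -
    obtain b where b: "(f \<longlongrightarrow> b) (at_right \<tau>)" using right[OF \<tau>] by blast
    moreover have "Lim (at_right \<tau>) (entropy_production \<Omega> (\<lambda>x. Sinit) (\<lambda>t x. Sb)) =
        Lim (at_right \<tau>) (entropy_production \<Omega> (\<lambda>x. Sinit) S)"
      using same \<tau> less_imp_le[OF \<tau>] unfolding same_production_def by blast
    then have "b = D * Sb" by (simp add: LimR[OF \<tau> b] Lim_bar right_diff_distrib)
    ultimately show ?thesis by simp
  qed
  ultimately have "AE t in lebesgue_on {0<..}. f t = D * Sb" by (rule one_sided_limits_imp_AE)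
  \<comment> \<open>Where \<open>f t = D * Sb\<close> the constant state of mean entropy already has
    energy \<open>E0\<close>, and the implication in \<open>good\<close> fires.\<close>
  with good have eq: "AE t in lebesgue_on {0<..}. AE x in lebesgue_on \<Omega>. \<rho> t x = \<rho>bar \<and> m t x = 0 \<and> S t x = Sb"
    by eventually_elim (use Sb D in simp)
  have eq\<rho>: "AE t in lebesgue_on {0<..}. AE x in lebesgue_on \<Omega>. \<rho> t x = \<rho>bar"
    and eqm: "AE t in lebesgue_on {0<..}. AE x in lebesgue_on \<Omega>. m t x = 0"
    and eqS: "AE t in lebesgue_on {0<..}. AE x in lebesgue_on \<Omega>. S t x = Sb"
    using eq by (auto elim!: eventually_mono)
  have weak: "has_weak_limit l \<Omega> S (\<lambda>x. Sb) (at_left t) \<and> has_weak_limit l \<Omega> S (\<lambda>x. Sb) (at_right t)"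
    if t: "t > 0" for t
  proof -
    have "((\<lambda>t. LINT x|lebesgue_on \<Omega>. S t x * \<phi> x) \<longlongrightarrow> (LINT x|lebesgue_on \<Omega>. Sb * \<phi> x)) (at_left t) \<and>
        ((\<lambda>t. LINT x|lebesgue_on \<Omega>. S t x * \<phi> x) \<longlongrightarrow> (LINT x|lebesgue_on \<Omega>. Sb * \<phi> x)) (at_right t)"
      if \<phi>: "\<phi> \<in> W0 l \<Omega>" for \<phi>
    proof -
      have BV: "BV_loc (\<lambda>t. LINT x|lebesgue_on \<Omega>. S t x * \<phi> x)" using reg(5) \<phi> by (simp add: BV_weak_loc_def)
      have \<phi>m: "\<phi> \<in> borel_measurable (lebesgue_on \<Omega>)" using \<phi> by (simp add: W0_def)
      have "AE t in lebesgue_on {0<..}. t > (0::real)" by (rule AE_I2) simp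
      then have "AE t in lebesgue_on {0<..}. (LINT x|lebesgue_on \<Omega>. S t x * \<phi> x) = (LINT x|lebesgue_on \<Omega>. Sb * \<phi> x)"
        using eqS
      proof eventually_elim
        case (elim t)
        then show ?case using meas(3)[of t] \<phi>m by (intro integral_cong_AE) auto
      qed
      from BV_loc_tendsto[OF BV this t] show ?thesis by blast
    qed
    then show ?thesis by (auto simp: has_weak_limit_def)
  qed
  have concl: "(\<forall>t>0. (AE x in lebesgue_on \<Omega>. \<rho> t x = \<rho>bar) \<and> (AE x in lebesgue_on \<Omega>. m t x = 0) \<and>
         has_weak_limit l \<Omega> S (\<lambda>x. Sb) (at_left t) \<and> has_weak_limit l \<Omega> S (\<lambda>x. Sb) (at_right t)) \<and>
       (AE t in lebesgue_on {0<..}. AE x in lebesgue_on \<Omega>. S t x = Sb)"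
    using C_weak_loc_const[OF reg(2) \<gamma> m\<Omega> eq\<rho>] C_weak_loc_const[OF reg(3) p2 m\<Omega> eqm] weak eqS by blast
  have lint: "(LINT x|lebesgue_on \<Omega>. cv \<gamma> * \<rho>bar powr \<gamma> * exp (\<sigma> / (cv \<gamma> * \<rho>bar))) = E0 \<longleftrightarrow> \<sigma> = Sb" for \<sigma>
    unfolding const K_def[symmetric] by (rule uniq)
  show ?thesis unfolding lint using concl by blast
qed

end
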